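(* Let $u$ be a local weak super-solution in $\Omega_T=\Omega\times(-T,T)$ to $$\partial_t u=\sum_{i=1}^N\partial_i\big(|\partial_i u|^{p_i-2}\partial_i u\big)$$ that is locally bounded from below. Then $u$ is lower semi-continuous, i.e. $u$ coincides almost everywhere in $\Omega_T$ with a lower semi-continuous function $\Omega_T\to(-\infty,+\infty]$.
   Context: $N\in\mathbb{N}$, $N>1$; $\Omega\subset\mathbb{R}^N$ is a bounded open set, $T>0$. The exponents $p_1,\dots,p_N$ are fixed, $\bar p=N\big(\sum_{i=1}^N 1/p_i\big)^{-1}$, $\bar p<N$, $\bar p^*=N\bar p/(N-\bar p)$, and $2<p_1\le p_2\le\dots\le p_N<\bar p^*$. Local weak super-solution: a function $u\in C^0((-T,T);L^2_{loc}(\Omega))$ with $u\in L^1_{loc}((-T,T);W^{1,1}_{loc}(\Omega))$ and $\partial_i u\in L^{p_i}_{loc}((-T,T);L^{p_i}_{loc}(\Omega))$ for all $i$ such that for all $-T<t_1<t_2<T$, all compact $K\subset\Omega$ and all nonnegative smooth $\varphi$ on $\Omega_T$ with $\varphi(\cdot,t)$ supported in $K$ for every $t$, $$\int_K u\varphi\,dx\Big|_{t_1}^{t_2}+\int_{t_1}^{t_2}\!\!\int_K\Big(-u\,\partial_t\varphi+\sum_{i=1}^N|\partial_i u|^{p_i-2}\partial_i u\,\partial_i\varphi\Big)dx\,dt\ \ge0.$$ *)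

theory Defs
  imports "HOL-Analysis.Analysis"
begin

text \<open>Smoothness on an open set \<open>S\<close>. For finite-dimensional domains, \<open>Ck_on k S f\<close> says that
  all iterated directional derivatives of order at most \<open>k\<close> exist and are continuous on \<open>S\<close>.\<close>

primrec Ck_on ::
    "nat \<Rightarrow> 'a::real_normed_vector set \<Rightarrow> ('a \<Rightarrow> 'b::real_normed_vector) \<Rightarrow> bool" where
  "Ck_on 0 S f \<longleftrightarrow> continuous_on S f"
| "Ck_on (Suc k) S f \<longleftrightarrow>
     (\<forall>x\<in>S. f differentiable (at x)) \<and> (\<forall>v. Ck_on k S (\<lambda>x. frechet_derivative f (at x) v))"

definition smooth_on :: "'a::real_normed_vector set \<Rightarrow> ('a \<Rightarrow> 'b::real_normed_vector) \<Rightarrow> bool" where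
  "smooth_on S f \<longleftrightarrow> (\<forall>k. Ck_on k S f)"

definition Lp_on :: "real \<Rightarrow> 'a::euclidean_space set \<Rightarrow> ('a \<Rightarrow> real) \<Rightarrow> bool" where
  "Lp_on q A f \<longleftrightarrow>
     f \<in> borel_measurable (lebesgue_on A) \<and> integrable (lebesgue_on A) (\<lambda>x. \<bar>f x\<bar> powr q)"

definition Lp_loc :: "real \<Rightarrow> 'a::euclidean_space set \<Rightarrow> ('a \<Rightarrow> real) \<Rightarrow> bool" where
  "Lp_loc q \<Omega> f \<longleftrightarrow> (\<forall>K. compact K \<and> K \<subseteq> \<Omega> \<longrightarrow> Lp_on q K f)"

text \<open>\<open>weak_partial \<Omega> i f g\<close>: the locally integrable function \<open>g\<close> is the weak \<open>i\<close>-th partial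
  derivative of the locally integrable function \<open>f\<close> on the open set \<open>\<Omega>\<close>. Thus \<open>f\<close> belongs to
  W^{1,1}_loc(\<open>\<Omega>\<close>) iff it has a weak partial derivative in every direction.\<close>

definition weak_partial ::
    "(real^'n) set \<Rightarrow> 'n::finite \<Rightarrow> (real^'n \<Rightarrow> real) \<Rightarrow> (real^'n \<Rightarrow> real) \<Rightarrow> bool" where
  "weak_partial \<Omega> i f g \<longleftrightarrow>
     Lp_loc 1 \<Omega> f \<and> Lp_loc 1 \<Omega> g \<and>
     (\<forall>\<phi>::real^'n \<Rightarrow> real. \<forall>K.
        smooth_on \<Omega> \<phi> \<and> compact K \<and> K \<subseteq> \<Omega> \<and> closure {x\<in>\<Omega>. \<phi> x \<noteq> 0} \<subseteq> K \<longrightarrow>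
        (LINT x:\<Omega>|lebesgue. f x * frechet_derivative \<phi> (at x) (axis i 1)) =
          - (LINT x:\<Omega>|lebesgue. g x * \<phi> x))"

definition cylinder :: "(real^'n::finite) set \<Rightarrow> real \<Rightarrow> ((real^'n) \<times> real) set" where
  "cylinder \<Omega> T = \<Omega> \<times> {-T<..<T}"

text \<open>\<open>u \<in> C^0((-T,T); L^2_loc(\<Omega>))\<close>. The slice \<open>u(\<cdot>,t)\<close> is meaningful for every \<open>t\<close>.\<close>

definition C0_L2_loc :: "(real^'n::finite) set \<Rightarrow> real \<Rightarrow> ((real^'n) \<times> real \<Rightarrow> real) \<Rightarrow> bool" where
  "C0_L2_loc \<Omega> T u \<longleftrightarrow>
     (\<forall>t\<in>{-T<..<T}. Lp_loc 2 \<Omega> (\<lambda>x. u (x, t))) \<and>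
     (\<forall>K. compact K \<and> K \<subseteq> \<Omega> \<longrightarrow>
        (\<forall>t\<in>{-T<..<T}.
           ((\<lambda>s. LINT x:K|lebesgue. (u (x, s) - u (x, t))\<^sup>2) \<longlongrightarrow> 0) (at t within {-T<..<T})))"

text \<open>\<open>f \<in> L^q_loc((-T,T); L^q_loc(\<Omega>))\<close>, as jointly measurable functions on the cylinder.\<close>

definition Lp_Lp_loc ::
    "real \<Rightarrow> (real^'n::finite) set \<Rightarrow> real \<Rightarrow> ((real^'n) \<times> real \<Rightarrow> real) \<Rightarrow> bool" where
  "Lp_Lp_loc q \<Omega> T f \<longleftrightarrow>
     (\<forall>K s\<^sub>1 s\<^sub>2. compact K \<and> K \<subseteq> \<Omega> \<and> -T < s\<^sub>1 \<and> s\<^sub>1 < s\<^sub>2 \<and> s\<^sub>2 < T \<longrightarrow> Lp_on q (K \<times> {s\<^sub>1..s\<^sub>2}) f)"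

text \<open>\<open>u \<in> L^1_loc((-T,T); W^{1,1}_loc(\<Omega>))\<close> with weak spatial gradient \<open>Du\<close>, i.e. \<open>Du i = \<partial>\<^sub>i u\<close>;
  strong measurability in time is rendered as joint measurability of \<open>u\<close> and \<open>Du\<close>.\<close>

definition L1_W11_loc_grad ::
    "(real^'n::finite) set \<Rightarrow> real \<Rightarrow> ((real^'n) \<times> real \<Rightarrow> real) \<Rightarrow>
     ('n \<Rightarrow> (real^'n) \<times> real \<Rightarrow> real) \<Rightarrow> bool" where
  "L1_W11_loc_grad \<Omega> T u Du \<longleftrightarrow>
     Lp_Lp_loc 1 \<Omega> T u \<and> (\<forall>i. Lp_Lp_loc 1 \<Omega> T (Du i)) \<and>
     (AE t in lebesgue. t \<in> {-T<..<T} \<longrightarrow>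
        (\<forall>i. weak_partial \<Omega> i (\<lambda>x. u (x, t)) (\<lambda>x. Du i (x, t))))"

text \<open>The weak gradient is unique almost everywhere, so the existential quantifier over \<open>Du\<close> in
  the next definition only names it.\<close>

definition local_weak_supersolution ::
    "('n::finite \<Rightarrow> real) \<Rightarrow> (real^'n) set \<Rightarrow> real \<Rightarrow> ((real^'n) \<times> real \<Rightarrow> real) \<Rightarrow> bool" where
  "local_weak_supersolution p \<Omega> T u \<longleftrightarrow>
     C0_L2_loc \<Omega> T u \<and>
     (\<exists>Du. L1_W11_loc_grad \<Omega> T u Du \<and>
        (\<forall>i. Lp_Lp_loc (p i) \<Omega> T (Du i)) \<and>
        (\<forall>t\<^sub>1 t\<^sub>2 K. \<forall>\<phi>::(real^'n) \<times> real \<Rightarrow> real.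
           -T < t\<^sub>1 \<and> t\<^sub>1 < t\<^sub>2 \<and> t\<^sub>2 < T \<and> compact K \<and> K \<subseteq> \<Omega> \<and>
           smooth_on (cylinder \<Omega> T) \<phi> \<and> (\<forall>z\<in>cylinder \<Omega> T. 0 \<le> \<phi> z) \<and>
           (\<forall>t\<in>{-T<..<T}. closure {x\<in>\<Omega>. \<phi> (x, t) \<noteq> 0} \<subseteq> K) \<longrightarrow>
           0 \<le> (LINT x:K|lebesgue. u (x, t\<^sub>2) * \<phi> (x, t\<^sub>2)) - (LINT x:K|lebesgue. u (x, t\<^sub>1) * \<phi> (x, t\<^sub>1)) +
               (LINT t:{t\<^sub>1..t\<^sub>2}|lebesgue. LINT x:K|lebesgue.
                  - u (x, t) * frechet_derivative \<phi> (at (x, t)) (0, 1) +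
                  (\<Sum>i\<in>UNIV. \<bar>Du i (x, t)\<bar> powr (p i - 2) * Du i (x, t) *
                     frechet_derivative \<phi> (at (x, t)) (axis i 1, 0)))))"

text \<open>Lower bounds are essential ones, \<open>u\<close> being determined only up to null sets.\<close>

definition locally_bounded_below_on :: "'a::euclidean_space set \<Rightarrow> ('a \<Rightarrow> real) \<Rightarrow> bool" where
  "locally_bounded_below_on S u \<longleftrightarrow>
     (\<forall>C. compact C \<and> C \<subseteq> S \<longrightarrow> (\<exists>m. AE z in lebesgue. z \<in> C \<longrightarrow> m \<le> u z))"

definition lower_semicontinuous_on :: "'a::topological_space set \<Rightarrow> ('a \<Rightarrow> ereal) \<Rightarrow> bool" where
  "lower_semicontinuous_on S f \<longleftrightarrow> (\<forall>x\<in>S. f x \<le> Liminf (at x within S) f)"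

definition harmonic_mean :: "('n::finite \<Rightarrow> real) \<Rightarrow> real" where
  "harmonic_mean p = real CARD('n) / (\<Sum>i\<in>UNIV. 1 / p i)"

definition sobolev_conjugate :: "nat \<Rightarrow> real \<Rightarrow> real" where
  "sobolev_conjugate N q = real N * q / (real N - q)"

end

theory Submission
  imports Defs
begin

text \<open>
  Redefine \<open>u\<close> at every point as its essential lower limit, the limit of its essential infima over
  shrinking neighbourhoods. The new function is lower semicontinuous for trivial reasons and at most
  \<open>u\<close> almost everywhere. What has to be proved is the opposite inequality: at almost every point \<open>z\<close> with
  \<open>u z \<ge> k\<close>, and for every \<open>gap > 0\<close>, the bound \<open>u \<ge> k - gap\<close> holds almost everywhere near \<open>z\<close>
  (\<open>local_lower_bound_AE\<close>).

  This is a consequence of the De Giorgi lemma, \<open>de_giorgi_lemma\<close>: if \<open>u\<close> is below \<open>k\<close> only on a small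
  fraction of a suitable box, then \<open>u \<ge> k - gap\<close> on half of the box. Almost every point of the set
  where \<open>u \<ge> k\<close> is a density point of this set, so the smallness holds in some small box about the point
  (\<open>density_points\<close>), because translations are continuous in the mean.

  Two features make the De Giorgi lemma accessible. Since \<open>u\<close> is locally bounded from below, the
  truncations \<open>v = max 0 (k - u)\<close> are bounded, by the same number in all small boxes. In the boxes with
  half-sides \<open>r powr (1 / p i)\<close> in space and \<open>r\<close> in time, the equation for \<open>u\<close> is invariant under scaling
  without changing the values of \<open>u\<close> (\<open>truncation_estimates_scale\<close>). Hence a single estimate on the
  unit cube suffices, with a threshold depending only on \<open>p\<close>, \<open>gap\<close> and the bound for \<open>v\<close>.

  Secondly, for bounded \<open>v\<close> an elementary gain of integrability in the mean can take the place of an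
  anisotropic Sobolev inequality. With a cutoff function \<open>\<zeta>\<close>, the energy inequality bounds both
  the integrals of \<open>v\<^sup>2 * \<zeta>\<close> squared over time slices and the mean oscillation of \<open>v\<^sup>2 * \<zeta>\<close> under spatial
  translations by multiples of the measure \<open>Y\<close> of the sublevel set of \<open>u\<close>. At a point where \<open>v\<^sup>2 * \<zeta>\<close> is
  large, it is far from its mean over a spatial box of side \<open>\<delta>\<close>, as this mean is small by the slice
  estimate; and the deviation from the mean is small on average by the translation estimate. With \<open>\<delta>\<close>
  chosen best, the next sublevel set has measure at most a multiple of \<open>Y\<close> to the power \<open>1 + 1 / N\<close>
  in space dimension \<open>N\<close> (\<open>superlevel_measure_bound\<close>, \<open>de_giorgi_step\<close>), and the iteration converges.

  The energy and translation estimates come from the equation mollified in space and time, which turns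
  the weak formulation into a pointwise differential inequality
  (\<open>kernel_supersolution_representative\<close>). It is multiplied by the square of the truncation of the
  mollified \<open>u\<close> times \<open>\<zeta>\<close> and integrated by parts (\<open>mollified_estimates\<close>). In the limit
  (\<open>truncation_estimates_supersolution\<close>) the critical term is the product of a mollified flux and
  a mollified gradient. By Young's inequality inside the convolutions it is at most twice the mollification of
  \<open>\<bar>Du i\<bar> powr p i\<close> (\<open>convol_flux_bound\<close>), which converges in the mean and thus serves as a majorant.
\<close>

section \<open>Smooth mollifiers\<close>

lemma Ck_on_subset: "Ck_on k UNIV f \<Longrightarrow> Ck_on k S f"
  by (induction k arbitrary: f) (auto intro: continuous_on_subset)

lemma smooth_on_subset: "smooth_on UNIV f \<Longrightarrow> smooth_on S f"
  by (simp add: smooth_on_def Ck_on_subset)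

lemma Ck_on_Suc_imp: "Ck_on (Suc k) UNIV f \<Longrightarrow> Ck_on k UNIV f"
proof (induction k arbitrary: f)
  case 0
  then show ?case
    by (auto intro!: differentiable_imp_continuous_on simp: differentiable_on_def)
qed auto

lemma Ck_on_SucI:
  assumes "\<And>x. (f has_derivative F x) (at x)" "\<And>v. Ck_on k UNIV (\<lambda>x. F x v)"
  shows "Ck_on (Suc k) UNIV f"
proof -
  have "frechet_derivative f (at x) = F x" for x
    using frechet_derivative_at[OF assms(1)] by simp
  then show ?thesis using assms by (auto simp: differentiable_def)
qed

lemma Ck_on_SucD:
  assumes "Ck_on (Suc k) UNIV f"
  shows "(f has_derivative frechet_derivative f (at x)) (at x)"
    "Ck_on k UNIV (\<lambda>x. frechet_derivative f (at x) v)"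
  using assms by (auto simp: frechet_derivative_works)

lemma Ck_on_const: "Ck_on k UNIV (\<lambda>_. c)"
proof (induction k arbitrary: c)
  case (Suc k)
  show ?case by (rule Ck_on_SucI[where F="\<lambda>_ _. 0"]) (auto simp: Suc)
qed simp

lemma Ck_on_add:
  "Ck_on k UNIV f \<Longrightarrow> Ck_on k UNIV g \<Longrightarrow> Ck_on k UNIV (\<lambda>x. f x + g x)"
proof (induction k arbitrary: f g)
  case 0 then show ?case by (simp add: continuous_on_add)
next
  case (Suc k)
  note f = Ck_on_SucD[OF Suc.prems(1)] and g = Ck_on_SucD[OF Suc.prems(2)]
  show ?case
    by (rule Ck_on_SucI[OF has_derivative_add[OF f(1) g(1)]]) (intro Suc.IH f g)
qed

lemma Ck_on_mult:
  fixes f g :: "'a::real_normed_vector \<Rightarrow> real"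
  shows "Ck_on k UNIV f \<Longrightarrow> Ck_on k UNIV g \<Longrightarrow> Ck_on k UNIV (\<lambda>x. f x * g x)"
proof (induction k arbitrary: f g)
  case 0 then show ?case by (simp add: continuous_on_mult)
next
  case (Suc k)
  note f = Ck_on_SucD[OF Suc.prems(1)] and g = Ck_on_SucD[OF Suc.prems(2)]
  show ?case
    by (rule Ck_on_SucI[OF has_derivative_mult[OF f(1) g(1)]])
      (intro Suc.IH Ck_on_add f g Ck_on_Suc_imp[OF Suc.prems(1)] Ck_on_Suc_imp[OF Suc.prems(2)])
qed

lemma Ck_on_prod:
  fixes f :: "'i \<Rightarrow> 'a::real_normed_vector \<Rightarrow> real"
  assumes "\<And>i. i \<in> I \<Longrightarrow> Ck_on k UNIV (f i)"
  shows "Ck_on k UNIV (\<lambda>x. \<Prod>i\<in>I. f i x)"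
  using assms
  by (induction I rule: infinite_finite_induct) (auto intro: Ck_on_const Ck_on_mult)

lemma Ck_on_affine:
  assumes "bounded_linear L"
  shows "Ck_on k UNIV f \<Longrightarrow> Ck_on k UNIV (\<lambda>x. f (a + L x))"
proof (induction k arbitrary: f)
  case 0
  have "continuous_on UNIV (\<lambda>x. a + L x)"
    using assms by (intro continuous_intros linear_continuous_on)
  with 0 show ?case by (auto intro: continuous_on_compose2)
next
  case (Suc k)
  note f = Ck_on_SucD[OF Suc.prems]
  have "((\<lambda>x. f (a + L x)) has_derivative (\<lambda>v. frechet_derivative f (at (a + L x)) (L v))) (at x)" for x
  proof -
    have "((\<lambda>x. a + L x) has_derivative (\<lambda>v. L v)) (at x)"
      by (auto intro!: derivative_eq_intros bounded_linear_imp_has_derivative[OF assms])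
    from has_derivative_compose[OF this f(1)] show ?thesis .
  qed
  then show ?case by (rule Ck_on_SucI) (intro Suc.IH f)
qed

text \<open>The classical flat function \<open>exp (- 1 / x)\<close>, divided by \<open>x ^ k\<close>. The whole family is
  considered at once because the derivative of one member is a linear combination of two others, so
  that smoothness follows by induction on the order.\<close>

definition flat :: "nat \<Rightarrow> real \<Rightarrow> real" where
  "flat k x = (if x > 0 then exp (- (1 / x)) / x ^ k else 0)"

lemma flat_tendsto_0: "(flat k \<longlongrightarrow> 0) (at 0)"
proof -
  have "((\<lambda>x. flat k x) \<longlongrightarrow> 0) (at_right 0)"
  proof -
    have "((\<lambda>y::real. y ^ k / exp y) \<longlongrightarrow> 0) at_top" by (rule tendsto_power_div_exp_0)
    then have "((\<lambda>x::real. inverse x ^ k / exp (inverse x)) \<longlongrightarrow> 0) (at_right 0)"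
      by (rule filterlim_compose[OF _ filterlim_inverse_at_top_right])
    moreover have "\<forall>\<^sub>F x in at_right 0. inverse x ^ k / exp (inverse x) = flat k x"
      by (auto simp: flat_def eventually_at_right_field exp_minus field_simps power_inverse
          intro!: exI[of _ 1])
    ultimately show ?thesis using tendsto_cong by force
  qed
  moreover have "((\<lambda>x. flat k x) \<longlongrightarrow> 0) (at_left 0)"
    by (rule tendsto_eventually)
      (auto simp: flat_def eventually_at_left_field intro!: exI[of _ "-1"])
  ultimately show ?thesis by (simp add: filterlim_split_at)
qed

lemma has_derivative_flat:
  "(flat k has_real_derivative (- real k * flat (Suc k) x + flat (Suc (Suc k)) x)) (at x)"
proof -
  consider "x > 0" | "x < 0" | "x = 0" by linarith
  then show ?thesis
  proof cases
    case 1
    have "((\<lambda>x. exp (- (1 / x)) / x ^ k) has_real_derivative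
        (- real k * flat (Suc k) x + flat (Suc (Suc k)) x)) (at x)"
      using 1 apply (cases k)
       apply (auto intro!: derivative_eq_intros simp: flat_def field_simps)
      apply (metis One_nat_def power_eq_if)
      done
    moreover have "\<forall>\<^sub>F y in nhds x. flat k y = exp (- (1 / y)) / y ^ k"
      using eventually_nhds_in_open[of "{0<..}" x] 1
      by (auto simp: flat_def elim!: eventually_mono)
    ultimately show ?thesis by (subst DERIV_cong_ev[OF refl _ refl])
  next
    case 2
    have "\<forall>\<^sub>F y in nhds x. flat k y = 0"
      using eventually_nhds_in_open[of "{..<0}" x] 2
      by (auto simp: flat_def elim!: eventually_mono)
    then show ?thesis using 2 by (subst DERIV_cong_ev[OF refl _ refl]) (auto simp: flat_def)
  next
    case 3
    have eq: "(\<lambda>h. (flat k (0 + h) - flat k 0) / h) = flat (Suc k)"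
      by (auto simp: flat_def)
    have "(flat k has_real_derivative 0) (at 0)"
      unfolding DERIV_def eq by (rule flat_tendsto_0)
    then show ?thesis using 3 by (simp add: flat_def)
  qed
qed

lemma Ck_on_flat_affine:
  fixes l :: "'a::real_normed_vector \<Rightarrow> real"
  assumes l: "bounded_linear l"
  shows "Ck_on j UNIV (\<lambda>y. flat k (a + l y))"
proof (induction j arbitrary: k)
  case 0
  have "continuous_on UNIV (flat k)"
    by (rule DERIV_continuous_on) (rule has_field_derivative_at_within[OF has_derivative_flat])
  moreover have "continuous_on UNIV (\<lambda>y. a + l y)"
    using l by (intro continuous_intros linear_continuous_on)
  ultimately show ?case by (auto intro: continuous_on_compose2)
next
  case (Suc j)
  have "((\<lambda>y. flat k (a + l y)) has_derivative
      (\<lambda>v. (- real k * flat (Suc k) (a + l y) + flat (Suc (Suc k)) (a + l y)) * l v)) (at y)" for y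
  proof -
    have "((\<lambda>y. a + l y) has_derivative (\<lambda>v. l v)) (at y)"
      by (auto intro!: derivative_eq_intros bounded_linear_imp_has_derivative[OF l])
    from has_derivative_compose[OF this has_derivative_flat[THEN has_field_derivative_imp_has_derivative]]
    show ?thesis by simp
  qed
  then show ?case
    by (rule Ck_on_SucI) (intro Ck_on_mult Ck_on_add Ck_on_const Suc)
qed

text \<open>The product over all coordinates \<open>s\<close> of \<open>flat 0 (d + s) * flat 0 (d - s)\<close> is smooth and
  supported in a small cube, and it is positive at the origin, so it can be normalised.\<close>

lemma smooth_mollifier_exists:
  assumes "\<epsilon> > 0"
  shows "\<exists>\<kappa>::'a::euclidean_space \<Rightarrow> real. smooth_on UNIV \<kappa> \<and> (\<forall>z. 0 \<le> \<kappa> z) \<and>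
    (\<forall>z. \<epsilon> \<le> norm z \<longrightarrow> \<kappa> z = 0) \<and> integrable lborel \<kappa> \<and> integral\<^sup>L lborel \<kappa> = 1"
proof -
  \<comment> \<open>each coordinate is below \<open>d\<close> on the support, hence the norm is below \<open>DIM('a) * d = \<epsilon>\<close>\<close>
  define d where "d = \<epsilon> / DIM('a)"
  define k where "k z = (\<Prod>b\<in>Basis. flat 0 (d + z \<bullet> b) * flat 0 (d + - (z \<bullet> b)))" for z :: 'a
  have d: "d > 0" using assms by (simp add: d_def)
  have Ck: "Ck_on j UNIV k" for j
    unfolding k_def
    by (intro Ck_on_prod Ck_on_mult Ck_on_flat_affine bounded_linear_minus bounded_linear_inner_left)
  have nn: "0 \<le> k z" for z by (auto simp: k_def flat_def intro!: prod_nonneg)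
  have supp: "k z = 0" if "\<epsilon> \<le> norm z" for z
  proof (rule ccontr)
    assume "k z \<noteq> 0"
    then have *: "\<bar>z \<bullet> b\<bar> < d" if "b \<in> Basis" for b
      using that by (force simp: k_def flat_def split: if_splits)
    have "norm z \<le> (\<Sum>b\<in>Basis. \<bar>z \<bullet> b\<bar>)" by (rule norm_le_l1)
    also have "\<dots> < (\<Sum>b\<in>(Basis::'a set). d)" by (rule sum_strict_mono) (auto simp: *)
    also have "\<dots> = \<epsilon>" by (simp add: d_def)
    finally show False using that by simp
  qed
  have cont: "continuous_on UNIV k" using Ck[of 0] by simp
  have int: "integrable lborel k"
  proof -
    have "integrable lborel (\<lambda>z. indicator (cball 0 \<epsilon>) z *\<^sub>R k z)"
      by (rule borel_integrable_compact) (auto intro: continuous_on_subset[OF cont])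
    also have "(\<lambda>z. indicator (cball 0 \<epsilon>) z *\<^sub>R k z) = k"
      using supp by (auto simp: indicator_def fun_eq_iff)
    finally show ?thesis .
  qed
  have pos: "integral\<^sup>L lborel k > 0"
  proof (rule ccontr)
    assume "\<not> ?thesis"
    then have "integral\<^sup>L lborel k = 0" using nn by (simp add: antisym)
    then have "AE z in lborel. k z = 0"
      using int nn by (simp add: integral_nonneg_eq_0_iff_AE)
    then have "AE z in lebesgue. z \<in> {z. k z = 0}"
      by (auto intro: AE_completion)
    then have "0 \<in> {z. k z = 0}"
      by (rule mem_closed_if_AE_lebesgue[rotated])
        (intro closed_Collect_eq continuous_intros cont)
    then show False using d by (simp add: k_def flat_def)
  qed
  show ?thesis
  proof (intro exI[of _ "\<lambda>z. k z * inverse (integral\<^sup>L lborel k)"] conjI allI impI)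
    show "smooth_on UNIV (\<lambda>z. k z * inverse (integral\<^sup>L lborel k))"
      unfolding smooth_on_def by (intro allI Ck_on_mult Ck Ck_on_const)
  qed (use nn pos int supp in \<open>auto simp: less_imp_le\<close>)
qed

section \<open>Translations are continuous in the mean\<close>

lemma nn_integral_lborel_shift:
  fixes a :: "'a::euclidean_space"
  assumes [measurable]: "f \<in> borel_measurable borel"
  shows "(\<integral>\<^sup>+x. f (x + a) \<partial>lborel) = (\<integral>\<^sup>+x. f x \<partial>lborel)"
  by (subst (2) lborel_distr_plus[of a, symmetric]) (simp add: nn_integral_distr add.commute)

lemma integrable_lborel_shift:
  fixes a :: "'a::euclidean_space" and f :: "'a \<Rightarrow> real"
  assumes "integrable lborel f"
  shows "integrable lborel (\<lambda>x. f (x + a))"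
proof -
  have [measurable]: "f \<in> borel_measurable borel" using assms by auto
  have "integrable (distr lborel borel ((+) a)) f" by (simp add: lborel_distr_plus assms)
  then show ?thesis by (subst (asm) integrable_distr_eq) (simp_all add: add.commute)
qed

lemma integral_lborel_shift:
  fixes a :: "'a::euclidean_space" and f :: "'a \<Rightarrow> real"
  assumes [measurable]: "f \<in> borel_measurable borel"
  shows "(\<integral>x. f (x + a) \<partial>lborel) = (\<integral>x. f x \<partial>lborel)"
  by (subst (2) lborel_distr_plus[of a, symmetric]) (simp add: integral_distr add.commute)

lemma distr_lborel_reflect:
  fixes a :: "'a::euclidean_space"
  shows "distr lborel borel (\<lambda>x. a - x) = lborel"
  by (subst (2) lborel_affine[of "-1" a]) (auto simp: density_1)

lemma nn_integral_lborel_reflect: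
  fixes a :: "'a::euclidean_space"
  assumes [measurable]: "f \<in> borel_measurable borel"
  shows "(\<integral>\<^sup>+x. f (a - x) \<partial>lborel) = (\<integral>\<^sup>+x. f x \<partial>lborel)"
  by (subst (2) distr_lborel_reflect[of a, symmetric]) (simp add: nn_integral_distr)

lemma integral_lborel_reflect:
  fixes a :: "'a::euclidean_space" and f :: "'a \<Rightarrow> real"
  assumes [measurable]: "f \<in> borel_measurable borel"
  shows "(\<integral>x. f (a - x) \<partial>lborel) = (\<integral>x. f x \<partial>lborel)"
  by (subst (2) distr_lborel_reflect[of a, symmetric]) (simp add: integral_distr)

text \<open>The integral is a nonnegative one, so that this makes sense and is stable under approximation
  without integrability side conditions.\<close>

definition translation_continuous :: "('a::euclidean_space \<Rightarrow> real) \<Rightarrow> bool" where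
  "translation_continuous f \<longleftrightarrow>
    (\<forall>e>0. \<exists>d>0. \<forall>h. norm h < d \<longrightarrow> (\<integral>\<^sup>+x. ennreal \<bar>f (x + h) - f x\<bar> \<partial>lborel) \<le> ennreal e)"

lemma translation_continuous_approx:
  assumes [measurable]: "f \<in> borel_measurable borel"
    and approx: "\<And>e. e > 0 \<Longrightarrow> \<exists>g. g \<in> borel_measurable borel \<and> translation_continuous g \<and>
      (\<integral>\<^sup>+x. ennreal \<bar>f x - g x\<bar> \<partial>lborel) \<le> ennreal e"
  shows "translation_continuous f"
  unfolding translation_continuous_def
proof safe
  fix e :: real assume "e > 0"
  then obtain g where [measurable]: "g \<in> borel_measurable borel" and g: "translation_continuous g"
    "(\<integral>\<^sup>+x. ennreal \<bar>f x - g x\<bar> \<partial>lborel) \<le> ennreal (e/3)"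
    using approx[of "e/3"] by auto
  with \<open>e > 0\<close> obtain d where d: "d > 0"
    "\<And>h. norm h < d \<Longrightarrow> (\<integral>\<^sup>+x. ennreal \<bar>g (x + h) - g x\<bar> \<partial>lborel) \<le> ennreal (e/3)"
    unfolding translation_continuous_def by (meson divide_pos_pos zero_less_numeral)
  have "(\<integral>\<^sup>+x. ennreal \<bar>f (x + h) - f x\<bar> \<partial>lborel) \<le> ennreal e" if h: "norm h < d" for h
  proof -
    have "(\<integral>\<^sup>+x. ennreal \<bar>f (x + h) - f x\<bar> \<partial>lborel)
        \<le> (\<integral>\<^sup>+x. ennreal \<bar>f (x + h) - g (x + h)\<bar> + ennreal \<bar>g (x + h) - g x\<bar> + ennreal \<bar>f x - g x\<bar> \<partial>lborel)"
      by (intro nn_integral_mono) (auto simp flip: ennreal_plus)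
    also have "\<dots> = (\<integral>\<^sup>+x. ennreal \<bar>f (x + h) - g (x + h)\<bar> \<partial>lborel)
        + (\<integral>\<^sup>+x. ennreal \<bar>g (x + h) - g x\<bar> \<partial>lborel) + (\<integral>\<^sup>+x. ennreal \<bar>f x - g x\<bar> \<partial>lborel)"
      by (simp add: nn_integral_add)
    also have "(\<integral>\<^sup>+x. ennreal \<bar>f (x + h) - g (x + h)\<bar> \<partial>lborel) = (\<integral>\<^sup>+x. ennreal \<bar>f x - g x\<bar> \<partial>lborel)"
      by (rule nn_integral_lborel_shift) simp
    also have "\<dots> + (\<integral>\<^sup>+x. ennreal \<bar>g (x + h) - g x\<bar> \<partial>lborel) + \<dots> \<le> ennreal (e/3) + ennreal (e/3) + ennreal (e/3)"
      by (intro add_mono g d h)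
    also have "\<dots> = ennreal e" using \<open>e > 0\<close> by (simp flip: ennreal_plus)
    finally show ?thesis .
  qed
  with d show "\<exists>d>0. \<forall>h. norm h < d \<longrightarrow> (\<integral>\<^sup>+x. ennreal \<bar>f (x + h) - f x\<bar> \<partial>lborel) \<le> ennreal e"
    by blast
qed

text \<open>If \<open>x \<in> U\<close> then \<open>x + h \<in> U\<close> for all small \<open>h\<close>, so the part of \<open>U\<close> which a small translation
  moves out of \<open>U\<close> has small measure by dominated convergence. The part moved into \<open>U\<close> has the same
  measure, because translations preserve the measure of \<open>U\<close>.\<close>

lemma translation_continuous_open:
  fixes U :: "'a::euclidean_space set"
  assumes U: "open U" "emeasure lborel U < \<infinity>"
  shows "translation_continuous (\<lambda>x. indicator U x * c)"
  unfolding translation_continuous_def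
proof (rule ccontr)
  have [measurable]: "U \<in> sets borel" using U by auto
  let ?I = "\<lambda>h. (\<integral>\<^sup>+x. ennreal \<bar>indicator U (x + h) * c - indicator U x * c\<bar> \<partial>lborel)"
  assume "\<not> (\<forall>e>0. \<exists>d>0. \<forall>h. norm h < d \<longrightarrow> ?I h \<le> ennreal e)"
  then obtain e where e: "e > 0" "\<And>d. d > 0 \<Longrightarrow> \<exists>h. norm h < d \<and> ?I h > ennreal e"
    by (auto simp: not_le)
  have "\<forall>n::nat. \<exists>h. norm h < 1 / (real n + 1) \<and> ?I h > ennreal e"
    by (intro allI e) auto
  then obtain h where h: "\<And>n. norm (h n) < 1 / (real n + 1)" "\<And>n. ?I (h n) > ennreal e"
    by metis
  have h0: "h \<longlonglongrightarrow> 0"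
  proof (rule Lim_null_comparison)
    show "\<forall>\<^sub>F n in sequentially. norm (h n) \<le> 1 / (real n + 1)" by (intro always_eventually allI less_imp_le h(1))
    show "(\<lambda>n. 1 / (real n + 1)) \<longlonglongrightarrow> 0" using LIMSEQ_inverse_real_of_nat by (simp add: field_simps)
  qed
  \<comment> \<open>\<open>J n\<close> is the measure of the points of \<open>U\<close> that leave \<open>U\<close> under translation by \<open>h n\<close>\<close>
  define J where "J n = (\<integral>\<^sup>+x. indicator U x * (indicator (- U) (x + h n)) \<partial>lborel)" for n
  have "(\<lambda>n. J n) \<longlonglongrightarrow> (\<integral>\<^sup>+x. (0::ennreal) \<partial>(lborel :: 'a measure))"
    unfolding J_def
  proof (rule nn_integral_dominated_convergence[where w="indicator U"])
    show "(\<integral>\<^sup>+x. indicator U x \<partial>lborel) < \<infinity>" using U by simp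
    show "AE x in lborel. (\<lambda>n. indicator U x * indicator (- U) (x + h n)) \<longlonglongrightarrow> (0::ennreal)"
    proof (rule AE_I2)
      fix x
      show "(\<lambda>n. indicator U x * indicator (- U) (x + h n)) \<longlonglongrightarrow> (0::ennreal)"
      proof (cases "x \<in> U")
        case True
        have "(\<lambda>n. x + h n) \<longlonglongrightarrow> x + 0" by (intro tendsto_add h0 tendsto_const)
        then have "\<forall>\<^sub>F n in sequentially. x + h n \<in> U"
          using U(1) True by (auto dest: topological_tendstoD)
        then show ?thesis by (auto intro!: tendsto_eventually elim!: eventually_mono)
      qed simp
    qed
  qed (auto simp: indicator_def)
  then have J0: "(\<lambda>n. ennreal (2 * \<bar>c\<bar>) * J n) \<longlonglongrightarrow> ennreal (2 * \<bar>c\<bar>) * 0"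
    by (intro ennreal_tendsto_cmult) auto
  have IJ: "?I (h n) = ennreal (2 * \<bar>c\<bar>) * J n" for n
  proof -
    \<comment> \<open>adding the finite quantity \<open>?u\<close> on both sides replaces a subtraction in \<open>ennreal\<close>\<close>
    let ?u = "\<integral>\<^sup>+x. ennreal (\<bar>c\<bar>) * indicator U x \<partial>lborel"
    have "?I (h n) + ?u = (\<integral>\<^sup>+x. ennreal \<bar>indicator U (x + h n) * c - indicator U x * c\<bar>
         + ennreal (\<bar>c\<bar>) * indicator U x \<partial>lborel)"
      by (simp add: nn_integral_add)
    also have "\<dots> = (\<integral>\<^sup>+x. ennreal (2 * \<bar>c\<bar>) * (indicator U x * (indicator (- U) (x + h n)))
         + ennreal (\<bar>c\<bar>) * indicator U (x + h n) \<partial>lborel)"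
      by (intro nn_integral_cong) (auto simp: indicator_def simp flip: ennreal_plus)
    also have "\<dots> = ennreal (2 * \<bar>c\<bar>) * J n + (\<integral>\<^sup>+x. ennreal (\<bar>c\<bar>) * indicator U (x + h n) \<partial>lborel)"
      unfolding J_def by (subst nn_integral_add) (auto intro!: nn_integral_cmult)
    also have "(\<integral>\<^sup>+x. ennreal (\<bar>c\<bar>) * indicator U (x + h n) \<partial>lborel) = ?u"
      by (rule nn_integral_lborel_shift) simp
    finally show ?thesis
      using U by (auto simp add: nn_integral_cmult ennreal_mult_eq_top_iff)
  qed
  have "\<forall>\<^sub>F n in sequentially. ennreal (2 * \<bar>c\<bar>) * J n < ennreal e"
    using J0 e(1) by (intro order_tendstoD) auto
  then obtain n where "ennreal (2 * \<bar>c\<bar>) * J n < ennreal e"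
    by (auto simp: eventually_sequentially)
  with h(2)[of n] IJ[of n] show False by simp
qed

text \<open>Outer regularity reduces indicators of Borel sets to open sets. Sums and limits in the mean then
  give every integrable function.\<close>

theorem translation_continuous_integrable:
  fixes f :: "'a::euclidean_space \<Rightarrow> real"
  assumes "integrable lborel f"
  shows "translation_continuous f"
  using assms
proof (induction rule: integrable_induct)
  case (base A c)
  then have [measurable]: "A \<in> sets borel" by simp
  show ?case
  proof (rule translation_continuous_approx)
    fix e :: real assume e: "e > 0"
    define e' where "e' = e / (\<bar>c\<bar> + 1)"
    have e': "e' > 0" using e by (simp add: e'_def)
    obtain U where U: "open U" "A \<subseteq> U" "emeasure lborel (U - A) < ennreal e'"
      using outer_regular_lborel[of A e'] e' by auto
    then have [measurable]: "U \<in> sets borel" by auto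
    have "emeasure lborel U \<le> emeasure lborel A + emeasure lborel (U - A)"
      using U by (subst plus_emeasure) (auto intro!: emeasure_mono)
    also have "\<dots> < \<infinity>" using base U(3) by (auto simp: ennreal_add_less_top less_top intro: order.strict_trans)
    finally have fin: "emeasure lborel U < \<infinity>" .
    have "(\<integral>\<^sup>+x. ennreal \<bar>indicator A x *\<^sub>R c - indicator U x * c\<bar> \<partial>lborel)
        = (\<integral>\<^sup>+x. ennreal \<bar>c\<bar> * indicator (U - A) x \<partial>lborel)"
      using U by (intro nn_integral_cong) (auto simp: indicator_def)
    also have "\<dots> = ennreal \<bar>c\<bar> * emeasure lborel (U - A)"
      by (rule nn_integral_cmult_indicator) simp
    also have "\<dots> \<le> ennreal \<bar>c\<bar> * ennreal e'"
      using U by (intro mult_left_mono) auto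
    also have "\<dots> \<le> ennreal e"
      using e e' by (auto simp: e'_def field_simps simp flip: ennreal_mult intro!: ennreal_leI)
    finally show "\<exists>g. g \<in> borel_measurable borel \<and> translation_continuous g \<and>
        (\<integral>\<^sup>+x. ennreal \<bar>indicator A x *\<^sub>R c - g x\<bar> \<partial>lborel) \<le> ennreal e"
      using translation_continuous_open[OF U(1) fin, of c]
      by (intro exI[of _ "\<lambda>x. indicator U x * c"]) auto
  qed simp
next
  case (add f g)
  then have [measurable]: "f \<in> borel_measurable borel" "g \<in> borel_measurable borel" by auto
  show ?case
    unfolding translation_continuous_def
  proof safe
    fix e :: real assume "e > 0"
    obtain d1 where d1: "d1 > 0" "\<And>h. norm h < d1 \<Longrightarrow> (\<integral>\<^sup>+x. ennreal \<bar>f (x + h) - f x\<bar> \<partial>lborel) \<le> ennreal (e/2)"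
      using add \<open>e > 0\<close> unfolding translation_continuous_def by (meson half_gt_zero)
    obtain d2 where d2: "d2 > 0" "\<And>h. norm h < d2 \<Longrightarrow> (\<integral>\<^sup>+x. ennreal \<bar>g (x + h) - g x\<bar> \<partial>lborel) \<le> ennreal (e/2)"
      using add \<open>e > 0\<close> unfolding translation_continuous_def by (meson half_gt_zero)
    have "(\<integral>\<^sup>+x. ennreal \<bar>f (x + h) + g (x + h) - (f x + g x)\<bar> \<partial>lborel) \<le> ennreal e"
      if h: "norm h < min d1 d2" for h
    proof -
      have "(\<integral>\<^sup>+x. ennreal \<bar>f (x + h) + g (x + h) - (f x + g x)\<bar> \<partial>lborel)
        \<le> (\<integral>\<^sup>+x. ennreal \<bar>f (x + h) - f x\<bar> + ennreal \<bar>g (x + h) - g x\<bar> \<partial>lborel)"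
        by (intro nn_integral_mono) (auto simp flip: ennreal_plus)
      also have "\<dots> = (\<integral>\<^sup>+x. ennreal \<bar>f (x + h) - f x\<bar> \<partial>lborel) + (\<integral>\<^sup>+x. ennreal \<bar>g (x + h) - g x\<bar> \<partial>lborel)"
        by (simp add: nn_integral_add)
      also have "\<dots> \<le> ennreal (e/2) + ennreal (e/2)" using h by (intro add_mono d1 d2) auto
      also have "\<dots> = ennreal e" using \<open>e > 0\<close> by (simp flip: ennreal_plus)
      finally show ?thesis .
    qed
    with d1 d2 show "\<exists>d>0. \<forall>h. norm h < d \<longrightarrow>
        (\<integral>\<^sup>+x. ennreal \<bar>f (x + h) + g (x + h) - (f x + g x)\<bar> \<partial>lborel) \<le> ennreal e"
      by (intro exI[of _ "min d1 d2"]) auto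
  qed
next
  case (lim f s)
  then have [measurable]: "f \<in> borel_measurable borel" "s i \<in> borel_measurable borel" for i by auto
  show ?case
  proof (rule translation_continuous_approx)
    fix e :: real assume e: "e > 0"
    have "(\<lambda>i. (\<integral>\<^sup>+x. norm (f x - s i x) \<partial>lborel)) \<longlonglongrightarrow> 0"
    proof (rule nn_integral_dominated_convergence_norm[where w="\<lambda>x. 2 * norm (f x)"])
      show "(\<integral>\<^sup>+x. ennreal (2 * norm (f x)) \<partial>lborel) < \<infinity>"
        using \<open>integrable lborel f\<close> unfolding integrable_iff_bounded
        by (simp add: ennreal_mult nn_integral_cmult ennreal_mult_less_top)
    qed (use lim in auto)
    then have "\<forall>\<^sub>F i in sequentially. (\<integral>\<^sup>+x. norm (f x - s i x) \<partial>lborel) < ennreal e"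
      using e by (intro order_tendstoD) auto
    then obtain i where "(\<integral>\<^sup>+x. norm (f x - s i x) \<partial>lborel) < ennreal e"
      by (auto simp: eventually_sequentially)
    with lim show "\<exists>g. g \<in> borel_measurable borel \<and> translation_continuous g \<and>
        (\<integral>\<^sup>+x. ennreal \<bar>f x - g x\<bar> \<partial>lborel) \<le> ennreal e"
      by (intro exI[of _ "s i"]) auto
  qed simp
qed

section \<open>Directional derivatives\<close>

text \<open>Integration by parts and translation estimates concern one direction at a time, and directional
  derivatives of products and of truncated powers follow from the calculus of one real variable.\<close>

definition has_dir_deriv :: "('a::real_normed_vector \<Rightarrow> real) \<Rightarrow> 'a \<Rightarrow> real \<Rightarrow> 'a \<Rightarrow> bool" where
  "has_dir_deriv g e D z \<longleftrightarrow> ((\<lambda>h. g (z + h *\<^sub>R e)) has_real_derivative D) (at 0)"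

lemma has_dir_deriv_line:
  assumes "\<And>z. has_dir_deriv g e (g' z) z"
  shows "((\<lambda>h. g (z + h *\<^sub>R e)) has_real_derivative g' (z + s *\<^sub>R e)) (at s)"
proof -
  have "((\<lambda>h. g ((z + s *\<^sub>R e) + h *\<^sub>R e)) has_real_derivative g' (z + s *\<^sub>R e)) (at 0)"
    using assms by (simp add: has_dir_deriv_def)
  then have "((\<lambda>h. g (z + (h + s) *\<^sub>R e)) has_real_derivative g' (z + s *\<^sub>R e)) (at 0)"
    by (simp add: algebra_simps)
  then show ?thesis using DERIV_shift[of "\<lambda>h. g (z + h *\<^sub>R e)" "g' (z + s *\<^sub>R e)" 0 s] by simp
qed

lemma has_dir_deriv_lipschitz:
  assumes D: "\<And>z. has_dir_deriv g e (g' z) z" and B: "\<And>z. \<bar>g' z\<bar> \<le> B"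
  shows "\<bar>g (z + h *\<^sub>R e) - g z\<bar> \<le> B * \<bar>h\<bar>"
proof -
  have "norm (g (z + h *\<^sub>R e) - g (z + 0 *\<^sub>R e)) \<le> B * norm (h - 0)"
    by (rule field_differentiable_bound[where S=UNIV and f'="\<lambda>s. g' (z + s *\<^sub>R e)"])
      (auto intro: has_dir_deriv_line[OF D] B)
  then show ?thesis by simp
qed

lemma has_dir_deriv_sequence:
  assumes "has_dir_deriv g e D z" "\<And>n::nat. X n \<noteq> 0" "X \<longlonglongrightarrow> 0"
  shows "(\<lambda>n. (g (z + X n *\<^sub>R e) - g z) / X n) \<longlonglongrightarrow> D"
proof -
  have "((\<lambda>h. (g (z + h *\<^sub>R e) - g z) / h) \<longlongrightarrow> D) (at 0)"
    using assms(1) by (simp add: has_dir_deriv_def DERIV_def)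
  moreover have "filterlim X (at 0) sequentially"
    using assms(2,3) by (auto simp: filterlim_at)
  ultimately show ?thesis by (rule filterlim_compose)
qed

lemma has_dir_deriv_frechet:
  assumes "f differentiable (at z)"
  shows "has_dir_deriv f e (frechet_derivative f (at z) e) z"
proof -
  have f: "(f has_derivative frechet_derivative f (at z)) (at z)"
    using assms by (simp add: frechet_derivative_works)
  have "((\<lambda>h. z + h *\<^sub>R e) has_derivative (\<lambda>h. h *\<^sub>R e)) (at 0)"
    by (auto intro!: derivative_eq_intros)
  from has_derivative_compose[OF this, of f "frechet_derivative f (at z)"] f
  have "((\<lambda>h. f (z + h *\<^sub>R e)) has_derivative (\<lambda>h. frechet_derivative f (at z) (h *\<^sub>R e))) (at 0)"
    by simp
  moreover have "frechet_derivative f (at z) (h *\<^sub>R e) = frechet_derivative f (at z) e * h" for h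
    using linear_frechet_derivative[OF assms] by (simp add: linear_cmul)
  ultimately show ?thesis
    by (simp add: has_dir_deriv_def has_field_derivative_def)
qed

lemma inverse_real_Suc_tendsto: "(\<lambda>n. c / real (Suc n)) \<longlonglongrightarrow> 0"
  using tendsto_mult_right[OF LIMSEQ_inverse_real_of_nat, of c] by (simp add: field_simps)

lemma has_dir_deriv_measurable:
  fixes g :: "'a::euclidean_space \<Rightarrow> real"
  assumes [measurable]: "g \<in> borel_measurable borel" and D: "\<And>z. has_dir_deriv g e (g' z) z"
  shows "g' \<in> borel_measurable borel"
proof (rule borel_measurable_LIMSEQ_real)
  fix z
  show "(\<lambda>n. (g (z + (1 / real (Suc n)) *\<^sub>R e) - g z) / (1 / real (Suc n))) \<longlonglongrightarrow> g' z"
    by (rule has_dir_deriv_sequence[OF D _ inverse_real_Suc_tendsto]) simp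
qed measurable

text \<open>Difference quotients converge boundedly to the derivative. They all have integral zero because
  the Lebesgue measure is invariant under translations, and hence so has the derivative. For the
  translation estimate, \<open>N s\<close> below is subadditive in \<open>s\<close>, so that \<open>N h / \<bar>h\<bar>\<close> is at most the
  quotient for the step \<open>h / n\<close>, whose limit is the integral of the modulus of the derivative.\<close>

lemma has_dir_deriv_integral:
  fixes g :: "'a::euclidean_space \<Rightarrow> real"
  assumes [measurable]: "g \<in> borel_measurable borel"
    and D: "\<And>z. has_dir_deriv g e (g' z) z"
    and B: "\<And>z. \<bar>g' z\<bar> \<le> B" "\<And>z. \<bar>g z\<bar> \<le> B"
    and R: "\<And>z. norm z > R \<Longrightarrow> g z = 0"
  shows "integrable lborel g'"
    and "integral\<^sup>L lborel g' = 0"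
    and "(\<integral>z. \<bar>g (z + h *\<^sub>R e) - g z\<bar> \<partial>lborel) \<le> \<bar>h\<bar> * (\<integral>z. \<bar>g' z\<bar> \<partial>lborel)"
proof -
  note [measurable] = has_dir_deriv_measurable[OF assms(1) D]
  have B0: "0 \<le> B" using B(1)[of 0] by linarith
  have fin: "emeasure lborel (cball 0 r :: 'a set) < top" for r
    using emeasure_bounded_finite[of "cball 0 r :: 'a set"] by simp
  have int_g: "integrable lborel g"
    by (rule integrableI_bounded_set[of "cball 0 R" _ _ B])
      (auto simp: fin B R)
  have int_sh: "integrable lborel (\<lambda>z. g (z + a))" for a
    by (rule integrable_lborel_shift[OF int_g])
  have dom: "\<bar>(g (z + s *\<^sub>R e) - g z) / s\<bar> \<le> B * indicator (cball 0 (R + \<bar>c\<bar> * norm e)) z"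
    if "\<bar>s\<bar> \<le> \<bar>c\<bar>" for s z c
  proof (cases "z \<in> cball 0 (R + \<bar>c\<bar> * norm e)")
    case True
    have "\<bar>g (z + s *\<^sub>R e) - g z\<bar> \<le> B * \<bar>s\<bar>" by (rule has_dir_deriv_lipschitz[OF D B(1)])
    then show ?thesis using True B0 by (cases "s = 0") (auto simp: field_simps)
  next
    case False
    have nz: "norm z > R + \<bar>c\<bar> * norm e" using False by simp
    have "norm z \<le> norm (z + s *\<^sub>R e) + \<bar>s\<bar> * norm e"
      using norm_triangle_ineq4[of "z + s *\<^sub>R e" "s *\<^sub>R e"] by simp
    moreover have "\<bar>s\<bar> * norm e \<le> \<bar>c\<bar> * norm e" using that by (intro mult_right_mono) auto
    moreover have "0 \<le> \<bar>c\<bar> * norm e" by simp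
    ultimately have "norm (z + s *\<^sub>R e) > R" "norm z > R" using nz by linarith+
    then show ?thesis using False by (simp add: R)
  qed
  have int_dom: "integrable lborel (\<lambda>z. B * indicator (cball 0 r :: 'a set) z :: real)" for r
    by (intro integrable_mult_right integrable_real_indicator) (auto simp: fin)
  let ?X = "\<lambda>n. 1 / real (Suc n)"
  have lim: "(\<lambda>n. (g (z + ?X n *\<^sub>R e) - g z) / ?X n) \<longlonglongrightarrow> g' z" for z
    by (rule has_dir_deriv_sequence[OF D _ inverse_real_Suc_tendsto]) simp
  have domX: "norm ((g (z + ?X n *\<^sub>R e) - g z) / ?X n) \<le> B * indicator (cball 0 (R + \<bar>1\<bar> * norm e)) z" for z n
    unfolding real_norm_def by (rule dom) simp
  show "integrable lborel g'"
    by (rule integrable_dominated_convergence[OF _ _ int_dom AE_I2[OF lim] AE_I2[OF domX]]) measurable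
  have "(\<lambda>n. \<integral>z. (g (z + ?X n *\<^sub>R e) - g z) / ?X n \<partial>lborel) \<longlonglongrightarrow> integral\<^sup>L lborel g'"
    by (rule integral_dominated_convergence[OF _ _ int_dom AE_I2[OF lim] AE_I2[OF domX]]) measurable
  moreover have "(\<integral>z. (g (z + ?X n *\<^sub>R e) - g z) / ?X n \<partial>lborel) = 0" for n
    using int_sh int_g by (simp add: integral_lborel_shift)
  ultimately show "integral\<^sup>L lborel g' = 0" using LIMSEQ_unique[OF _ tendsto_const] by auto
  define N where "N s = (\<integral>z. \<bar>g (z + s *\<^sub>R e) - g z\<bar> \<partial>lborel)" for s
  have N_add: "N (s + t) \<le> N s + N t" for s t
  proof -
    have i2: "integrable lborel (\<lambda>z. g ((z + t *\<^sub>R e) + s *\<^sub>R e))"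
      using int_sh[of "t *\<^sub>R e + s *\<^sub>R e"] by (simp add: add.assoc)
    have i1: "integrable lborel (\<lambda>z. \<bar>g ((z + t *\<^sub>R e) + s *\<^sub>R e) - g (z + t *\<^sub>R e)\<bar>)"
      "integrable lborel (\<lambda>z. \<bar>g (z + t *\<^sub>R e) - g z\<bar>)"
      by (intro integrable_abs Bochner_Integration.integrable_diff i2 int_sh int_g)+
    have eq: "z + (s + t) *\<^sub>R e = (z + t *\<^sub>R e) + s *\<^sub>R e" for z by (simp add: algebra_simps)
    have i0: "integrable lborel (\<lambda>z. \<bar>g (z + (s + t) *\<^sub>R e) - g z\<bar>)"
      by (intro integrable_abs Bochner_Integration.integrable_diff int_sh int_g)
    have "N (s + t) \<le> (\<integral>z. \<bar>g ((z + t *\<^sub>R e) + s *\<^sub>R e) - g (z + t *\<^sub>R e)\<bar> + \<bar>g (z + t *\<^sub>R e) - g z\<bar> \<partial>lborel)"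
      unfolding N_def
      by (intro integral_mono Bochner_Integration.integrable_add i0 i1) (simp add: eq)
    also have "\<dots> = (\<integral>z. \<bar>g ((z + t *\<^sub>R e) + s *\<^sub>R e) - g (z + t *\<^sub>R e)\<bar> \<partial>lborel) + N t"
      unfolding N_def by (rule Bochner_Integration.integral_add[OF i1])
    also have "(\<integral>z. \<bar>g ((z + t *\<^sub>R e) + s *\<^sub>R e) - g (z + t *\<^sub>R e)\<bar> \<partial>lborel) = N s"
      unfolding N_def by (rule integral_lborel_shift[of "\<lambda>z. \<bar>g (z + s *\<^sub>R e) - g z\<bar>"]) simp
    finally show ?thesis .
  qed
  have N_mult: "N (real k * s) \<le> real k * N s" for k s
  proof (induction k)
    case 0 then show ?case by (simp add: N_def)
  next
    case (Suc k)
    then show ?case using N_add[of s "real k * s"] by (simp add: algebra_simps)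
  qed
  show "(\<integral>z. \<bar>g (z + h *\<^sub>R e) - g z\<bar> \<partial>lborel) \<le> \<bar>h\<bar> * (\<integral>z. \<bar>g' z\<bar> \<partial>lborel)"
  proof (cases "h = 0")
    case False
    let ?Y = "\<lambda>n. h / real (Suc n)"
    have Yh: "\<bar>?Y n\<bar> \<le> \<bar>h\<bar>" for n by (simp add: field_simps)
    have limY: "(\<lambda>n. \<bar>(g (z + ?Y n *\<^sub>R e) - g z) / ?Y n\<bar>) \<longlonglongrightarrow> \<bar>g' z\<bar>" for z
      by (intro tendsto_rabs has_dir_deriv_sequence[OF D _ inverse_real_Suc_tendsto]) (use False in simp)
    have domY: "norm \<bar>(g (z + ?Y n *\<^sub>R e) - g z) / ?Y n\<bar> \<le> B * indicator (cball 0 (R + \<bar>h\<bar> * norm e)) z" for z n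
      unfolding real_norm_def abs_abs using Yh by (rule dom)
    have "(\<lambda>n. \<integral>z. \<bar>(g (z + ?Y n *\<^sub>R e) - g z) / ?Y n\<bar> \<partial>lborel) \<longlonglongrightarrow> (\<integral>z. \<bar>g' z\<bar> \<partial>lborel)"
      by (rule integral_dominated_convergence[OF _ _ int_dom AE_I2[OF limY] AE_I2[OF domY]]) measurable
    moreover have "N h / \<bar>h\<bar> \<le> (\<integral>z. \<bar>(g (z + ?Y n *\<^sub>R e) - g z) / ?Y n\<bar> \<partial>lborel)" for n
    proof -
      have "N h \<le> real (Suc n) * N (?Y n)" using N_mult[of "Suc n" "?Y n"] by simp
      also have "\<dots> = \<bar>h\<bar> * (N (?Y n) / \<bar>?Y n\<bar>)" using False by (simp add: field_simps)
      also have "N (?Y n) / \<bar>?Y n\<bar> = (\<integral>z. \<bar>(g (z + ?Y n *\<^sub>R e) - g z) / ?Y n\<bar> \<partial>lborel)"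
        by (simp only: N_def abs_divide Bochner_Integration.integral_divide_zero)
      finally show ?thesis using False by (simp add: field_simps)
    qed
    ultimately have "N h / \<bar>h\<bar> \<le> (\<integral>z. \<bar>g' z\<bar> \<partial>lborel)"
      by (intro LIMSEQ_le_const) auto
    then show ?thesis using False by (simp add: N_def field_simps)
  qed (simp)
qed

section \<open>Mollification\<close>

definition mollifier :: "real \<Rightarrow> ('a::euclidean_space \<Rightarrow> real) \<Rightarrow> bool" where
  "mollifier \<epsilon> \<kappa> \<longleftrightarrow> smooth_on UNIV \<kappa> \<and> (\<forall>z. 0 \<le> \<kappa> z) \<and> (\<forall>z. \<epsilon> \<le> norm z \<longrightarrow> \<kappa> z = 0) \<and>
    integrable lborel \<kappa> \<and> integral\<^sup>L lborel \<kappa> = 1"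

text \<open>Here \<open>f\<close> is the datum and \<open>k\<close> the kernel. For a mollifier \<open>\<kappa>\<close>, the directional derivatives of
  \<open>convol f \<kappa>\<close> are again of this form, with kernel \<open>ddir \<kappa> e\<close>.\<close>

definition convol :: "('a::euclidean_space \<Rightarrow> real) \<Rightarrow> ('a \<Rightarrow> real) \<Rightarrow> 'a \<Rightarrow> real" where
  "convol f k z = (\<integral>y. f y * k (z - y) \<partial>lborel)"

definition ddir :: "('a::euclidean_space \<Rightarrow> real) \<Rightarrow> 'a \<Rightarrow> 'a \<Rightarrow> real" where
  "ddir f e z = frechet_derivative f (at z) e"

lemma mollifierD:
  assumes "mollifier \<epsilon> \<kappa>"
  shows "Ck_on k UNIV \<kappa>" "0 \<le> \<kappa> z" "\<epsilon> \<le> norm z \<Longrightarrow> \<kappa> z = 0"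
    "integrable lborel \<kappa>" "integral\<^sup>L lborel \<kappa> = 1" "continuous_on UNIV \<kappa>"
    "continuous_on UNIV (ddir \<kappa> e)" "has_dir_deriv \<kappa> e (ddir \<kappa> e z) z"
    "\<kappa> differentiable (at z)" "\<kappa> \<in> borel_measurable borel" "ddir \<kappa> e \<in> borel_measurable borel"
proof -
  have C: "Ck_on k UNIV \<kappa>" for k using assms by (simp add: mollifier_def smooth_on_def)
  show "Ck_on k UNIV \<kappa>" by (rule C)
  show c: "continuous_on UNIV \<kappa>" using C[of 0] by simp
  show d: "\<kappa> differentiable (at z)" using C[of "Suc 0"] by simp
  show c': "continuous_on UNIV (ddir \<kappa> e)" using C[of "Suc 0"] by (simp add: ddir_def)
  show "has_dir_deriv \<kappa> e (ddir \<kappa> e z) z"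
    unfolding ddir_def by (rule has_dir_deriv_frechet[OF d])
  show "\<kappa> \<in> borel_measurable borel" "ddir \<kappa> e \<in> borel_measurable borel"
    using c c' by (auto intro: borel_measurable_continuous_onI)
qed (use assms in \<open>auto simp: mollifier_def\<close>)

lemma continuous_support_bounded:
  fixes g :: "'a::euclidean_space \<Rightarrow> real"
  assumes "continuous_on UNIV g" "\<And>z. r < norm z \<Longrightarrow> g z = 0"
  shows "\<exists>B\<ge>0. \<forall>z. \<bar>g z\<bar> \<le> B"
proof -
  have "compact (g ` cball 0 r)"
    by (intro compact_continuous_image continuous_on_subset[OF assms(1)]) auto
  then obtain B where B: "\<forall>y\<in>g ` cball 0 r. norm y \<le> B"
    by (meson bounded_iff compact_imp_bounded)
  have "\<bar>g z\<bar> \<le> max 0 B" for z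
    using B assms(2)[of z] by (cases "norm z \<le> r") force+
  then show ?thesis by (intro exI[of _ "max 0 B"]) auto
qed

lemma mollifier_ddir_support:
  assumes "mollifier \<epsilon> \<kappa>" "\<epsilon> < norm z"
  shows "ddir \<kappa> e z = 0"
proof -
  have "(\<kappa> has_derivative (\<lambda>_. 0)) (at z)"
    by (rule has_derivative_transform_within_open[of "\<lambda>_. 0" _ _ _ "- cball 0 \<epsilon>"])
      (use assms(2) in \<open>auto simp: mollifierD(3)[OF assms(1)]\<close>)
  from frechet_derivative_at[OF this, symmetric] show ?thesis by (simp add: ddir_def)
qed

lemma mollifier_bounded:
  assumes "mollifier \<epsilon> \<kappa>"
  shows "\<exists>B\<ge>0. \<forall>z. \<bar>\<kappa> z\<bar> \<le> B" "\<exists>B\<ge>0. \<forall>z. \<bar>ddir \<kappa> e z\<bar> \<le> B"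
  by (rule continuous_support_bounded[OF mollifierD(6)[OF assms], of \<epsilon>])
    (simp add: mollifierD(3)[OF assms],
     rule continuous_support_bounded[OF mollifierD(7)[OF assms] mollifier_ddir_support[OF assms]])

lemma integrable_mult_bounded:
  fixes f k :: "'a::euclidean_space \<Rightarrow> real"
  assumes "integrable lborel f" "k \<in> borel_measurable borel" "\<And>z. \<bar>k z\<bar> \<le> B"
  shows "integrable lborel (\<lambda>y. f y * k y)"
proof (rule Bochner_Integration.integrable_bound[of lborel "\<lambda>y. B * f y"])
  have [measurable]: "f \<in> borel_measurable borel" using assms(1) by auto
  note [measurable] = assms(2)
  show "(\<lambda>y. f y * k y) \<in> borel_measurable lborel" by measurable
  have "\<bar>f y\<bar> * \<bar>k y\<bar> \<le> \<bar>f y\<bar> * \<bar>B\<bar>" for y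
    using assms(3)[of y] by (intro mult_left_mono) auto
  then show "AE y in lborel. norm (f y * k y) \<le> norm (B * f y)"
    by (auto simp: abs_mult mult.commute)
qed (use assms in simp)

lemma convol_integrand:
  fixes f k :: "'a::euclidean_space \<Rightarrow> real"
  assumes "integrable lborel f" "continuous_on UNIV k" "\<And>z. \<bar>k z\<bar> \<le> B"
  shows "integrable lborel (\<lambda>y. f y * k (z - y))"
proof -
  note [measurable] = borel_measurable_continuous_onI[OF assms(2)]
  show ?thesis by (rule integrable_mult_bounded[OF assms(1), where B=B]) (use assms(3) in auto)
qed

lemma convol_bounded:
  fixes f k :: "'a::euclidean_space \<Rightarrow> real"
  assumes "integrable lborel f" "continuous_on UNIV k" "\<And>z. \<bar>k z\<bar> \<le> B"
  shows "\<bar>convol f k z\<bar> \<le> B * (\<integral>y. \<bar>f y\<bar> \<partial>lborel)"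
proof -
  have "\<bar>convol f k z\<bar> \<le> (\<integral>y. \<bar>f y * k (z - y)\<bar> \<partial>lborel)"
    unfolding convol_def by (rule integral_abs_bound)
  also have "\<dots> \<le> (\<integral>y. B * \<bar>f y\<bar> \<partial>lborel)"
    using assms(1,3) integrable_abs[OF convol_integrand[OF assms, of z]]
    by (intro integral_mono) (auto simp: abs_mult mult.commute[of B] intro: mult_left_mono)
  finally show ?thesis by simp
qed

lemma convol_measurable:
  assumes [measurable]: "f \<in> borel_measurable borel" "k \<in> borel_measurable borel"
  shows "convol f k \<in> borel_measurable borel"
proof -
  have "(\<lambda>z. \<integral>y. f y * k (z - y) \<partial>lborel) \<in> borel_measurable borel" by measurable
  then show ?thesis by (simp add: convol_def[abs_def])
qed

lemma convol_has_dir_deriv: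
  assumes f: "integrable lborel f" and m: "mollifier \<epsilon> \<kappa>"
  shows "has_dir_deriv (convol f \<kappa>) e (convol f (ddir \<kappa> e) z) z"
proof -
  obtain B where B: "B \<ge> 0" "\<And>z. \<bar>ddir \<kappa> e z\<bar> \<le> B" using mollifier_bounded(2)[OF m] by blast
  obtain B0 where B0: "\<And>z. \<bar>\<kappa> z\<bar> \<le> B0" using mollifier_bounded(1)[OF m] by blast
  note [measurable] = mollifierD(10,11)[OF m]
  have [measurable]: "f \<in> borel_measurable borel" using f by auto
  note int = convol_integrand[OF f mollifierD(6)[OF m] B0]
  have "((\<lambda>h. (convol f \<kappa> (z + h *\<^sub>R e) - convol f \<kappa> z) / h) \<longlongrightarrow> convol f (ddir \<kappa> e) z) (at 0)"
    unfolding tendsto_at_iff_sequentially comp_def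
  proof safe
    fix X :: "nat \<Rightarrow> real" assume X: "\<forall>i. X i \<in> UNIV - {0}" "X \<longlonglongrightarrow> 0"
    then have X0: "X n \<noteq> 0" for n by auto
    have "(\<lambda>n. \<integral>y. f y * ((\<kappa> ((z - y) + X n *\<^sub>R e) - \<kappa> (z - y)) / X n) \<partial>lborel) \<longlonglongrightarrow>
        (\<integral>y. f y * ddir \<kappa> e (z - y) \<partial>lborel)"
    proof (rule integral_dominated_convergence[where w="\<lambda>y. B * \<bar>f y\<bar>"])
      show "AE y in lborel. (\<lambda>n. f y * ((\<kappa> ((z - y) + X n *\<^sub>R e) - \<kappa> (z - y)) / X n)) \<longlonglongrightarrow> f y * ddir \<kappa> e (z - y)"
        by (intro AE_I2 tendsto_mult_left has_dir_deriv_sequence[OF mollifierD(8)[OF m] X0 X(2)])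
      fix n
      have "\<bar>(\<kappa> (w + X n *\<^sub>R e) - \<kappa> w) / X n\<bar> \<le> B" for w
        using has_dir_deriv_lipschitz[OF mollifierD(8)[OF m] B(2), of w "X n"] X0[of n]
        by (simp add: field_simps)
      then have "\<bar>f y\<bar> * \<bar>(\<kappa> ((z - y) + X n *\<^sub>R e) - \<kappa> (z - y)) / X n\<bar> \<le> \<bar>f y\<bar> * B" for y
        by (intro mult_left_mono) auto
      then show "AE y in lborel. norm (f y * ((\<kappa> ((z - y) + X n *\<^sub>R e) - \<kappa> (z - y)) / X n)) \<le> B * \<bar>f y\<bar>"
        unfolding real_norm_def abs_mult[of "f _"] by (simp add: mult.commute[of B])
    qed (use f in auto)
    moreover have "(\<integral>y. f y * ((\<kappa> ((z - y) + X n *\<^sub>R e) - \<kappa> (z - y)) / X n) \<partial>lborel)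
        = (convol f \<kappa> (z + X n *\<^sub>R e) - convol f \<kappa> z) / X n" for n
    proof -
      have "(\<integral>y. f y * ((\<kappa> ((z - y) + X n *\<^sub>R e) - \<kappa> (z - y)) / X n) \<partial>lborel)
          = (\<integral>y. (f y * \<kappa> ((z + X n *\<^sub>R e) - y) - f y * \<kappa> (z - y)) / X n \<partial>lborel)"
        by (intro Bochner_Integration.integral_cong) (auto simp: algebra_simps diff_divide_distrib)
      also have "\<dots> = (convol f \<kappa> (z + X n *\<^sub>R e) - convol f \<kappa> z) / X n"
        using int by (simp add: convol_def)
      finally show ?thesis .
    qed
    ultimately show "(\<lambda>n. (convol f \<kappa> (z + X n *\<^sub>R e) - convol f \<kappa> z) / X n) \<longlonglongrightarrow> convol f (ddir \<kappa> e) z"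
      unfolding convol_def[of f "ddir \<kappa> e"] by (simp only:)
  qed
  then show ?thesis by (simp add: has_dir_deriv_def DERIV_def)
qed

lemma mollifier_reflect:
  assumes "mollifier \<epsilon> \<kappa>"
  shows "integrable lborel (\<lambda>y. \<kappa> (z - y))" "(\<integral>y. \<kappa> (z - y) \<partial>lborel) = 1"
proof -
  note [measurable] = mollifierD(10)[OF assms]
  have "integrable (distr lborel borel (\<lambda>y. z - y)) \<kappa>"
    by (simp add: distr_lborel_reflect mollifierD(4)[OF assms])
  then show "integrable lborel (\<lambda>y. \<kappa> (z - y))" by (subst (asm) integrable_distr_eq) simp_all
  show "(\<integral>y. \<kappa> (z - y) \<partial>lborel) = 1"
    using integral_lborel_reflect[of \<kappa> z] mollifierD(5)[OF assms] by simp
qed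

text \<open>A mollification is an average of translates, so by Tonelli its distance from \<open>f\<close> in the mean is
  at most the largest distance of a translate by a vector in the support of the kernel.\<close>

lemma mollify_L1_le:
  assumes f: "integrable lborel f" and m: "mollifier \<epsilon> \<kappa>"
    and e: "\<And>h. norm h < \<epsilon> \<Longrightarrow> (\<integral>\<^sup>+x. ennreal \<bar>f (x + h) - f x\<bar> \<partial>lborel) \<le> ennreal e"
  shows "(\<integral>\<^sup>+z. ennreal \<bar>convol f \<kappa> z - f z\<bar> \<partial>lborel) \<le> ennreal e"
proof -
  note [measurable] = mollifierD(10)[OF m]
  have [measurable]: "f \<in> borel_measurable borel" using f by auto
  obtain B0 where B0: "\<And>z. \<bar>\<kappa> z\<bar> \<le> B0" using mollifier_bounded(1)[OF m] by blast
  note int = convol_integrand[OF f mollifierD(6)[OF m] B0]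
  have k1: "(\<integral>\<^sup>+h. ennreal (\<kappa> h) \<partial>lborel) = 1"
    using mollifierD(2,4,5)[OF m] by (subst nn_integral_eq_integral) auto
  have pt: "ennreal \<bar>convol f \<kappa> z - f z\<bar> \<le> (\<integral>\<^sup>+h. ennreal (\<bar>f (z - h) - f z\<bar> * \<kappa> h) \<partial>lborel)" for z
  proof -
    note i1 = mollifier_reflect(1)[OF m, of z]
    have "(\<integral>y. \<kappa> (z - y) \<partial>lborel) = 1" by (rule mollifier_reflect(2)[OF m])
    then have "convol f \<kappa> z - f z = (\<integral>y. f y * \<kappa> (z - y) \<partial>lborel) - (\<integral>y. f z * \<kappa> (z - y) \<partial>lborel)"
      by (simp add: convol_def)
    also have "\<dots> = (\<integral>y. (f y - f z) * \<kappa> (z - y) \<partial>lborel)"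
      using int i1 by (subst Bochner_Integration.integral_diff[symmetric]) (auto simp: algebra_simps)
    finally have eq: "convol f \<kappa> z - f z = (\<integral>y. (f y - f z) * \<kappa> (z - y) \<partial>lborel)" .
    have "integrable lborel (\<lambda>y. (f y - f z) * \<kappa> (z - y))"
      unfolding left_diff_distrib using int i1 by (intro Bochner_Integration.integrable_diff) auto
    then have "ennreal \<bar>convol f \<kappa> z - f z\<bar> \<le> (\<integral>\<^sup>+y. ennreal \<bar>(f y - f z) * \<kappa> (z - y)\<bar> \<partial>lborel)"
      unfolding eq using integral_norm_bound_ennreal by fastforce
    also have "\<dots> = (\<integral>\<^sup>+h. ennreal \<bar>(f (z - h) - f z) * \<kappa> (z - (z - h))\<bar> \<partial>lborel)"
      by (rule nn_integral_lborel_reflect[symmetric]) simp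
    also have "\<dots> = (\<integral>\<^sup>+h. ennreal (\<bar>f (z - h) - f z\<bar> * \<kappa> h) \<partial>lborel)"
      using mollifierD(2)[OF m] by (simp add: abs_mult)
    finally show ?thesis .
  qed
  have "(\<integral>\<^sup>+z. ennreal \<bar>convol f \<kappa> z - f z\<bar> \<partial>lborel)
      \<le> (\<integral>\<^sup>+z. (\<integral>\<^sup>+h. ennreal (\<bar>f (z - h) - f z\<bar> * \<kappa> h) \<partial>lborel) \<partial>lborel)"
    by (intro nn_integral_mono pt)
  also have "\<dots> = (\<integral>\<^sup>+h. (\<integral>\<^sup>+z. ennreal (\<bar>f (z - h) - f z\<bar> * \<kappa> h) \<partial>lborel) \<partial>lborel)"
    by (rule lborel_pair.Fubini') measurable
  also have "\<dots> \<le> (\<integral>\<^sup>+h. ennreal e * ennreal (\<kappa> h) \<partial>lborel)"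
  proof (intro nn_integral_mono)
    fix h
    have "(\<integral>\<^sup>+z. ennreal (\<bar>f (z - h) - f z\<bar> * \<kappa> h) \<partial>lborel)
        = (\<integral>\<^sup>+z. ennreal \<bar>f (z + (- h)) - f z\<bar> \<partial>lborel) * ennreal (\<kappa> h)"
      using mollifierD(2)[OF m] by (simp add: ennreal_mult nn_integral_multc)
    also have "\<dots> \<le> ennreal e * ennreal (\<kappa> h)"
      using mollifierD(3)[OF m, of h] e[of "- h"]
      by (cases "norm h < \<epsilon>") (auto intro: mult_right_mono)
    finally show "(\<integral>\<^sup>+z. ennreal (\<bar>f (z - h) - f z\<bar> * \<kappa> h) \<partial>lborel) \<le> ennreal e * ennreal (\<kappa> h)" .
  qed
  also have "\<dots> = ennreal e" by (simp add: nn_integral_cmult k1)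
  finally show ?thesis .
qed

lemma mollify_L1_tendsto:
  assumes f: "integrable lborel f" and m: "\<And>n. mollifier (\<epsilon> n) (\<kappa> n)" and \<epsilon>: "\<epsilon> \<longlonglongrightarrow> 0"
  shows "(\<lambda>n. \<integral>\<^sup>+z. ennreal \<bar>convol f (\<kappa> n) z - f z\<bar> \<partial>lborel) \<longlonglongrightarrow> 0"
proof (rule order_tendstoI)
  fix a :: ennreal assume "0 < a"
  then obtain e where e: "e > 0" "ennreal e < a"
  proof (cases a)
    case (real r)
    then show ?thesis using \<open>0 < a\<close> by (intro that[of "r/2"]) (auto simp: ennreal_less_iff)
  next
    case top
    then show ?thesis by (intro that[of 1]) auto
  qed
  obtain d where d: "d > 0" "\<And>h. norm h < d \<Longrightarrow> (\<integral>\<^sup>+x. ennreal \<bar>f (x + h) - f x\<bar> \<partial>lborel) \<le> ennreal e"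
    using translation_continuous_integrable[OF f] e(1) unfolding translation_continuous_def by blast
  have "\<forall>\<^sub>F n in sequentially. \<epsilon> n < d" using \<epsilon> d by (intro order_tendstoD)
  then show "\<forall>\<^sub>F n in sequentially. (\<integral>\<^sup>+z. ennreal \<bar>convol f (\<kappa> n) z - f z\<bar> \<partial>lborel) < a"
  proof eventually_elim
    case (elim n)
    have "(\<integral>\<^sup>+z. ennreal \<bar>convol f (\<kappa> n) z - f z\<bar> \<partial>lborel) \<le> ennreal e"
      by (rule mollify_L1_le[OF f m]) (use elim d in auto)
    with e show ?case by simp
  qed
qed simp

text \<open>Dominated convergence for majorants \<open>h\<^sub>n\<close> that vary with \<open>n\<close> and converge in the mean to \<open>h\<close>.
  Clamping \<open>f\<^sub>n\<close> to the interval from \<open>- h\<close> to \<open>h\<close> reduces the assertion to the fixed majorant \<open>h\<close>;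
  the error of clamping is at most \<open>\<bar>h\<^sub>n - h\<bar>\<close> and vanishes in the limit. The
  application is to the product of a mollified flux and a mollified gradient, whose bound is itself a
  mollification.\<close>

lemma dominated_convergence_varying:
  fixes f :: "'a \<Rightarrow> real"
  assumes [measurable]: "\<And>n. f\<^sub>n n \<in> borel_measurable M" "f \<in> borel_measurable M"
    and h: "\<And>n. integrable M (h\<^sub>n n)" "integrable M h"
    and lim: "AE x in M. (\<lambda>n. f\<^sub>n n x) \<longlonglongrightarrow> f x" "AE x in M. (\<lambda>n. h\<^sub>n n x) \<longlonglongrightarrow> h x"
    and dom: "\<And>n. AE x in M. \<bar>f\<^sub>n n x\<bar> \<le> h\<^sub>n n x"
    and L1: "(\<lambda>n. \<integral>x. \<bar>h\<^sub>n n x - h x\<bar> \<partial>M) \<longlonglongrightarrow> 0"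
  shows "integrable M f" "\<And>n. integrable M (f\<^sub>n n)"
    "(\<lambda>n. \<integral>x. f\<^sub>n n x \<partial>M) \<longlonglongrightarrow> (\<integral>x. f x \<partial>M)"
proof -
  have [measurable]: "h \<in> borel_measurable M" "\<And>n. h\<^sub>n n \<in> borel_measurable M" using h by auto
  show fn: "integrable M (f\<^sub>n n)" for n
    by (rule Bochner_Integration.integrable_bound[OF h(1)[of n]]) (use dom[of n] in auto)
  define c where "c n x = max (- h x) (min (h x) (f\<^sub>n n x))" for n x
  have [measurable]: "c n \<in> borel_measurable M" for n unfolding c_def by measurable
  have "AE x in M. \<forall>n. \<bar>f\<^sub>n n x\<bar> \<le> h\<^sub>n n x" using dom by (simp add: AE_all_countable)
  with lim have fh: "AE x in M. \<bar>f x\<bar> \<le> h x"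
  proof eventually_elim
    case (elim x)
    show ?case by (rule LIMSEQ_le[OF tendsto_rabs[OF elim(1)] elim(2)]) (use elim(3) in auto)
  qed
  have clim: "AE x in M. (\<lambda>n. c n x) \<longlonglongrightarrow> f x" using lim(1) fh
  proof eventually_elim
    case (elim x)
    have "(\<lambda>n. c n x) \<longlonglongrightarrow> max (- h x) (min (h x) (f x))"
      unfolding c_def by (intro tendsto_max tendsto_min tendsto_const elim)
    then show ?case using elim(2) by (auto simp: max_def min_def abs_le_iff split: if_splits)
  qed
  have cdom: "AE x in M. norm (c n x) \<le> h x" for n
    using fh by eventually_elim (auto simp: c_def)
  show f: "integrable M f"
    by (rule integrable_dominated_convergence[OF _ _ h(2) clim cdom]) measurable
  have ci: "integrable M (c n)" for n
    by (rule Bochner_Integration.integrable_bound[OF h(2)]) (use cdom[of n] in \<open>auto\<close>)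
  have "(\<lambda>n. \<integral>x. c n x \<partial>M) \<longlonglongrightarrow> (\<integral>x. f x \<partial>M)"
    by (rule integral_dominated_convergence[OF _ _ h(2) clim cdom]) measurable
  moreover have "(\<lambda>n. (\<integral>x. f\<^sub>n n x \<partial>M) - (\<integral>x. c n x \<partial>M)) \<longlonglongrightarrow> 0"
  proof (rule Lim_null_comparison[OF _ L1], intro always_eventually allI)
    fix n
    have "\<bar>(\<integral>x. f\<^sub>n n x \<partial>M) - (\<integral>x. c n x \<partial>M)\<bar> = \<bar>\<integral>x. f\<^sub>n n x - c n x \<partial>M\<bar>"
      using fn ci by simp
    also have "\<dots> \<le> (\<integral>x. \<bar>f\<^sub>n n x - c n x\<bar> \<partial>M)" by (rule integral_abs_bound)
    also have "\<dots> \<le> (\<integral>x. \<bar>h\<^sub>n n x - h x\<bar> \<partial>M)"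
    proof (rule integral_mono_AE)
      show "AE x in M. \<bar>f\<^sub>n n x - c n x\<bar> \<le> \<bar>h\<^sub>n n x - h x\<bar>"
        using dom[of n] fh by eventually_elim (auto simp: c_def max_def min_def abs_le_iff)
    qed (use fn ci h in auto)
    finally show "norm ((\<integral>x. f\<^sub>n n x \<partial>M) - (\<integral>x. c n x \<partial>M)) \<le> (\<integral>x. \<bar>h\<^sub>n n x - h x\<bar> \<partial>M)" by simp
  qed
  ultimately have "(\<lambda>n. ((\<integral>x. f\<^sub>n n x \<partial>M) - (\<integral>x. c n x \<partial>M)) + (\<integral>x. c n x \<partial>M)) \<longlonglongrightarrow> 0 + (\<integral>x. f x \<partial>M)"
    by (intro tendsto_add)
  then show "(\<lambda>n. \<integral>x. f\<^sub>n n x \<partial>M) \<longlonglongrightarrow> (\<integral>x. f x \<partial>M)" by simp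
qed

section \<open>The equation tested with mollifiers\<close>

abbreviation space_dir :: "'n::finite \<Rightarrow> (real^'n) \<times> real" where "space_dir i \<equiv> (axis i 1, 0)"
abbreviation time_dir :: "(real^'n::finite) \<times> real" where "time_dir \<equiv> (0, 1)"

definition flux :: "real \<Rightarrow> real \<Rightarrow> real" where "flux q d = \<bar>d\<bar> powr (q - 2) * d"

text \<open>The weak formulation, tested only with the functions \<open>y \<mapsto> \<kappa> (z - y)\<close> for a mollifier \<open>\<kappa>\<close>. In this
  form it is a pointwise differential inequality for the space-time mollification of \<open>u\<close>, in which the
  flux is mollified as well, together with the statement that \<open>Du\<close> mollified is the gradient of \<open>u\<close>
  mollified. Borel functions on the whole space make all convolutions and
  slices measurable.\<close>

definition kernel_supersolution ::
  "((real^'n::finite) \<times> real) set \<Rightarrow> ('n \<Rightarrow> real) \<Rightarrow> ((real^'n) \<times> real \<Rightarrow> real) \<Rightarrow> ('n \<Rightarrow> (real^'n) \<times> real \<Rightarrow> real) \<Rightarrow> bool"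
where
  "kernel_supersolution U p u Du \<longleftrightarrow>
    u \<in> borel_measurable borel \<and> (\<forall>i. Du i \<in> borel_measurable borel) \<and>
    (\<forall>C. compact C \<and> C \<subseteq> U \<longrightarrow> integrable lborel (\<lambda>z. indicator C z * u z) \<and>
      (\<forall>i. integrable lborel (\<lambda>z. indicator C z * \<bar>Du i z\<bar> powr p i))) \<and>
    (\<forall>\<epsilon> \<kappa> z. \<epsilon> > 0 \<and> mollifier \<epsilon> \<kappa> \<and> cball z \<epsilon> \<subseteq> U \<longrightarrow>
      0 \<le> convol u (ddir \<kappa> time_dir) z - (\<Sum>i\<in>UNIV. convol (\<lambda>y. flux (p i) (Du i y)) (ddir \<kappa> (space_dir i)) z) \<and>
      (\<forall>i. convol (Du i) \<kappa> z = convol u (ddir \<kappa> (space_dir i)) z))"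

lemma compact_in_cylinder:
  assumes "compact C" "C \<subseteq> cylinder \<Omega> T" "T > 0"
  shows "\<exists>K s. compact K \<and> K \<subseteq> \<Omega> \<and> 0 < s \<and> s < T \<and> C \<subseteq> K \<times> {-s..s}"
proof -
  have c: "compact ((\<lambda>z. \<bar>snd z\<bar>) ` C)"
    by (intro compact_continuous_image continuous_intros assms)
  have "\<exists>s. 0 < s \<and> s < T \<and> (\<forall>z\<in>C. \<bar>snd z\<bar> \<le> s)"
  proof (cases "C = {}")
    case True then show ?thesis using assms(3) dense by auto
  next
    case False
    then obtain z0 where z0: "z0 \<in> C" "\<forall>z\<in>C. \<bar>snd z\<bar> \<le> \<bar>snd z0\<bar>"
      using compact_attains_sup[OF c] by auto
    from z0(1) assms(2) have "\<bar>snd z0\<bar> < T" by (cases z0) (fastforce simp: cylinder_def abs_less_iff)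
    with z0 assms(3) show ?thesis
      by (intro exI[of _ "max (\<bar>snd z0\<bar>) (T/2)"]) (auto intro: order_trans)
  qed
  then obtain s where s: "0 < s" "s < T" "\<forall>z\<in>C. \<bar>snd z\<bar> \<le> s" by blast
  show ?thesis
  proof (intro exI[of _ "fst ` C"] exI[of _ s] conjI s)
    show "compact (fst ` C)" by (intro compact_continuous_image continuous_intros assms)
    show "fst ` C \<subseteq> \<Omega>" using assms(2) by (auto simp: cylinder_def)
    show "C \<subseteq> fst ` C \<times> {-s..s}"
    proof
      fix z assume "z \<in> C"
      moreover from this s have "\<bar>snd z\<bar> \<le> s" by blast
      ultimately show "z \<in> fst ` C \<times> {-s..s}" by (cases z) (force simp: abs_le_iff)
    qed
  qed
qed

lemma open_cylinder: "open \<Omega> \<Longrightarrow> open (cylinder \<Omega> T)"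
  unfolding cylinder_def by (intro open_Times) auto

lemma Lp_Lp_loc_on_compact:
  assumes "Lp_Lp_loc q \<Omega> T f" "compact C" "C \<subseteq> cylinder \<Omega> T" "T > 0"
  shows "f \<in> borel_measurable (lebesgue_on C)"
    "integrable lebesgue (\<lambda>z. indicator C z * \<bar>f z\<bar> powr q)"
proof -
  obtain K s where K: "compact K" "K \<subseteq> \<Omega>" "0 < s" "s < T" "C \<subseteq> K \<times> {-s..s}"
    using compact_in_cylinder[OF assms(2-4)] by blast
  then have L: "Lp_on q (K \<times> {-s..s}) f"
    using assms(1) unfolding Lp_Lp_loc_def by auto
  then show "f \<in> borel_measurable (lebesgue_on C)"
    unfolding Lp_on_def using K(5) measurable_restrict_mono by blast
  have "compact (K \<times> {-s..s})" using K by (intro compact_Times) auto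
  then have m: "K \<times> {-s..s} \<in> sets lebesgue" by (intro sets_completionI_sets) (simp add: borel_compact)
  have mC: "C \<in> sets lebesgue" using assms(2) by (intro sets_completionI_sets) (simp add: borel_compact)
  have "integrable lebesgue (\<lambda>z. indicator (K \<times> {-s..s}) z *\<^sub>R \<bar>f z\<bar> powr q)"
    using L m unfolding Lp_on_def by (subst (asm) integrable_restrict_space) auto
  from integrable_mult_indicator[OF mC this]
  have "integrable lebesgue (\<lambda>z. indicator C z *\<^sub>R (indicator (K \<times> {-s..s}) z *\<^sub>R \<bar>f z\<bar> powr q))" .
  moreover have "indicator C z *\<^sub>R (indicator (K \<times> {-s..s}) z *\<^sub>R \<bar>f z\<bar> powr q) = indicator C z * \<bar>f z\<bar> powr q" for z
    using K(5) by (auto simp: indicator_def)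
  ultimately show "integrable lebesgue (\<lambda>z. indicator C z * \<bar>f z\<bar> powr q)" by (simp only:)
qed

text \<open>An exhaustion of \<open>U\<close> by compact sets makes \<open>f\<close>, extended by zero, Lebesgue measurable, and a
  Lebesgue measurable function has a Borel version.\<close>

lemma borel_representative:
  assumes U: "open U" and f: "\<And>C. compact C \<Longrightarrow> C \<subseteq> U \<Longrightarrow> f \<in> borel_measurable (lebesgue_on C)"
  shows "\<exists>g :: 'a::euclidean_space \<Rightarrow> real. g \<in> borel_measurable borel \<and> (AE z in lborel. z \<in> U \<longrightarrow> g z = f z)"
proof -
  obtain C where C: "\<And>n::nat. compact (C n)" "\<And>n. C n \<subseteq> U" "\<Union>(range C) = U"
      "\<And>K. \<lbrakk>compact K; K \<subseteq> U\<rbrakk> \<Longrightarrow> \<exists>N. \<forall>n\<ge>N. K \<subseteq> C n"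
    using open_Union_compact_subsets[OF U] by metis
  have "(\<lambda>z. if z \<in> U then f z else 0) \<in> borel_measurable lebesgue"
  proof (rule borel_measurable_LIMSEQ_real)
    show "(\<lambda>z. if z \<in> C n then f z else 0) \<in> borel_measurable lebesgue" for n
    proof (subst borel_measurable_if)
      show "C n \<in> sets lebesgue" using C(1)[of n] by (intro sets_completionI_sets) (simp add: borel_compact)
    qed (rule f[OF C(1,2)])
    fix z
    show "(\<lambda>n. if z \<in> C n then f z else 0) \<longlonglongrightarrow> (if z \<in> U then f z else 0)"
    proof (cases "z \<in> U")
      case True
      then obtain N where "\<forall>n\<ge>N. {z} \<subseteq> C n" using C(4)[of "{z}"] by auto
      then show ?thesis using True
        by (intro tendsto_eventually) (auto simp: eventually_sequentially)
    qed (use C(2)[THEN subsetD] in \<open>auto intro!: tendsto_eventually always_eventually\<close>)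
  qed
  from completion_ex_borel_measurable_real[OF this]
  obtain g where g: "g \<in> borel_measurable lborel" "AE z in lborel. (if z \<in> U then f z else 0) = g z" by blast
  from g(2) have "AE z in lborel. z \<in> U \<longrightarrow> g z = f z" by eventually_elim auto
  with g(1) show ?thesis by auto
qed

text \<open>Integrals over completed measures become integrals of Borel functions, to which Fubini's theorem
  for products of Borel spaces applies.\<close>

lemma lebesgue_integral_representative:
  fixes f g :: "'a::euclidean_space \<Rightarrow> real"
  assumes g: "g \<in> borel_measurable borel" and ae: "AE x in lborel. f x = g x"
  shows "integral\<^sup>L lebesgue f = integral\<^sup>L lborel g"
proof -
  have gl: "g \<in> borel_measurable lebesgue" using g by (simp add: measurable_completion)
  have ae': "AE x in lebesgue. f x = g x" using ae by (rule AE_completion)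
  then have "AE x in lebesgue. g x = f x" by eventually_elim simp
  then have fl: "f \<in> borel_measurable lebesgue" by (rule borel_measurable_AE[OF gl])
  have "integral\<^sup>L lebesgue f = integral\<^sup>L lebesgue g" by (rule integral_cong_AE[OF fl gl ae'])
  also have "\<dots> = integral\<^sup>L lborel g" using g by (intro integral_completion) simp
  finally show ?thesis .
qed

lemma AE_lborel_slices:
  fixes P :: "'a::euclidean_space \<times> 'b::euclidean_space \<Rightarrow> bool"
  assumes "AE z in lborel. P z"
  shows "AE s in lborel. AE x in lborel. P (x, s)"
proof -
  obtain N where N: "N \<in> null_sets lborel" "{z \<in> space lborel. \<not> P z} \<subseteq> N"
    using assms unfolding eventually_ae_filter by auto
  have NM: "N \<in> sets (lborel \<Otimes>\<^sub>M lborel)" using N(1) by (simp add: lborel_prod null_setsD2 del: sets_lborel)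
  have "AE z in lborel \<Otimes>\<^sub>M lborel. z \<notin> N"
    using AE_not_in[OF N(1)] by (simp only: lborel_prod)
  then have "AE x in lborel. AE s in lborel. (x, s) \<notin> N" by (rule lborel_pair.AE_pair)
  moreover have "{z \<in> space (lborel \<Otimes>\<^sub>M lborel). (fst z, snd z) \<notin> N} = space (lborel \<Otimes>\<^sub>M lborel) - N"
    by auto
  with NM have "{z \<in> space (lborel \<Otimes>\<^sub>M lborel). (fst z, snd z) \<notin> N} \<in> sets (lborel \<Otimes>\<^sub>M lborel)"
    by (simp only: sets.compl_sets)
  ultimately have "AE s in lborel. AE x in lborel. (x, s) \<notin> N"
    by (subst (asm) lborel_pair.AE_commute)
  then show ?thesis
  proof eventually_elim
    case (elim s)
    then show ?case by eventually_elim (use N(2) in auto)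
  qed
qed

lemma mollifier_affine:
  assumes m: "mollifier \<epsilon> \<kappa>" and L: "bounded_linear L"
  shows "smooth_on S (\<lambda>y. \<kappa> (a + L y))"
    "frechet_derivative (\<lambda>y. \<kappa> (a + L y)) (at y) v = ddir \<kappa> (L v) (a + L y)"
proof -
  show "smooth_on S (\<lambda>y. \<kappa> (a + L y))"
    by (rule smooth_on_subset) (auto simp: smooth_on_def intro: Ck_on_affine[OF L] mollifierD(1)[OF m])
  have k: "(\<kappa> has_derivative frechet_derivative \<kappa> (at z)) (at z)" for z
    using mollifierD(9)[OF m] by (simp add: frechet_derivative_works)
  have "((\<lambda>y. a + L y) has_derivative (\<lambda>v. L v)) (at y)"
    by (auto intro!: derivative_eq_intros bounded_linear_imp_has_derivative[OF L])
  from has_derivative_compose[OF this k]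
  have "((\<lambda>y. \<kappa> (a + L y)) has_derivative (\<lambda>v. frechet_derivative \<kappa> (at (a + L y)) (L v))) (at y)" .
  from frechet_derivative_at[OF this, symmetric]
  show "frechet_derivative (\<lambda>y. \<kappa> (a + L y)) (at y) v = ddir \<kappa> (L v) (a + L y)"
    by (simp add: ddir_def)
qed

lemma ddir_minus:
  assumes "mollifier \<epsilon> \<kappa>" shows "ddir \<kappa> (- v) z = - ddir \<kappa> v z"
  unfolding ddir_def
  by (rule linear_neg[OF linear_frechet_derivative[OF mollifierD(9)[OF assms]]])

lemma abs_flux: "q > 2 \<Longrightarrow> \<bar>flux q d\<bar> = \<bar>d\<bar> powr (q - 1)"
proof (cases "d = 0")
  case False
  then have "\<bar>d\<bar> powr (q - 2) * \<bar>d\<bar> powr 1 = \<bar>d\<bar> powr (q - 1)" by (subst powr_add[symmetric]) simp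
  then show ?thesis by (simp add: flux_def abs_mult)
qed (simp add: flux_def)

lemma flux_bound:
  assumes q: "q > 2" shows "\<bar>flux q d\<bar> \<le> 1 + \<bar>d\<bar> powr q"
proof (cases "\<bar>d\<bar> \<le> 1")
  case True
  have "\<bar>d\<bar> powr (q - 1) \<le> 1 powr (q - 1)" using True q by (intro powr_mono2) auto
  then show ?thesis unfolding abs_flux[OF q] by (simp add: add_increasing2)
next
  case False
  then have "\<bar>d\<bar> powr (q - 1) \<le> \<bar>d\<bar> powr q" by (intro powr_mono) auto
  then show ?thesis unfolding abs_flux[OF q] by simp
qed

lemma abs_le_one_plus_powr: "q \<ge> 1 \<Longrightarrow> \<bar>d::real\<bar> \<le> 1 + \<bar>d\<bar> powr q"
proof (cases "\<bar>d\<bar> \<le> 1")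
  case False
  assume "q \<ge> 1"
  with False have "\<bar>d\<bar> powr 1 \<le> \<bar>d\<bar> powr q" by (intro powr_mono) linarith+
  then show ?thesis by simp
qed (simp add: add_increasing2)

lemma integrable_dominated_on_compact:
  fixes f g :: "'a::euclidean_space \<Rightarrow> real"
  assumes [measurable]: "f \<in> borel_measurable borel" and "compact C"
    and g: "integrable lborel (\<lambda>z. indicator C z * g z)" and fg: "\<And>z. \<bar>f z\<bar> \<le> 1 + g z"
  shows "integrable lborel (\<lambda>z. indicator C z * f z)"
proof -
  have [measurable]: "C \<in> sets borel" using \<open>compact C\<close> by (rule borel_compact)
  have "emeasure lborel C < \<infinity>" using \<open>compact C\<close> by (intro emeasure_bounded_finite compact_imp_bounded)
  then have "integrable lborel (indicator C :: 'a \<Rightarrow> real)" by (intro integrable_real_indicator) auto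
  from Bochner_Integration.integrable_add[OF this g]
  show ?thesis
    by (rule Bochner_Integration.integrable_bound)
      (use fg in \<open>auto simp: indicator_def intro: order_trans[OF _ abs_ge_self]\<close>)
qed

lemma integrable_times_compact_support:
  fixes f k :: "'a::euclidean_space \<Rightarrow> real"
  assumes "integrable lborel (\<lambda>z. indicator C z * f z)" "k \<in> borel_measurable borel"
    "\<And>z. \<bar>k z\<bar> \<le> B" "\<And>z. z \<notin> C \<Longrightarrow> k z = 0"
  shows "integrable lborel (\<lambda>z. f z * k z)"
proof -
  have "integrable lborel (\<lambda>z. (indicator C z * f z) * k z)"
    by (rule integrable_mult_bounded[OF assms(1,2,3)])
  moreover have "(indicator C z * f z) * k z = f z * k z" for z
    using assms(4)[of z] by (auto simp: indicator_def)
  ultimately show ?thesis by simp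
qed

text \<open>If the ball of radius \<open>\<epsilon>\<close> about \<open>z = (x\<^sub>0, t\<^sub>0)\<close> lies in the cylinder, then \<open>y \<mapsto> \<kappa> (z - y)\<close> is an
  admissible test function between the times \<open>t\<^sub>0 - \<epsilon>\<close> and \<open>t\<^sub>0 + \<epsilon>\<close>. It vanishes at both times, so
  the two boundary terms disappear, and Fubini's theorem turns the iterated integral into the
  convolution. The weak spatial derivatives of the slices are integrated in time in the same way.\<close>

theorem kernel_supersolution_representative:
  assumes ls: "local_weak_supersolution p \<Omega> T u" and \<Omega>: "open \<Omega>" and T: "T > 0" and p: "\<And>i. p i > 2"
  shows "\<exists>u' Du. kernel_supersolution (cylinder \<Omega> T) p u' Du \<and>
    (AE z in lborel. z \<in> cylinder \<Omega> T \<longrightarrow> u' z = u z)"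
proof -
  let ?U = "cylinder \<Omega> T"
  have U: "open ?U" by (rule open_cylinder[OF \<Omega>])
  from ls obtain D where D0: "L1_W11_loc_grad \<Omega> T u D" and D1: "\<forall>i. Lp_Lp_loc (p i) \<Omega> T (D i)"
    and ineq0: "\<forall>t\<^sub>1 t\<^sub>2 K. \<forall>\<phi>.
           -T < t\<^sub>1 \<and> t\<^sub>1 < t\<^sub>2 \<and> t\<^sub>2 < T \<and> compact K \<and> K \<subseteq> \<Omega> \<and>
           smooth_on ?U \<phi> \<and> (\<forall>z\<in>?U. 0 \<le> \<phi> z) \<and>
           (\<forall>t\<in>{-T<..<T}. closure {x\<in>\<Omega>. \<phi> (x, t) \<noteq> 0} \<subseteq> K) \<longrightarrow>
           0 \<le> (LINT x:K|lebesgue. u (x, t\<^sub>2) * \<phi> (x, t\<^sub>2)) - (LINT x:K|lebesgue. u (x, t\<^sub>1) * \<phi> (x, t\<^sub>1)) +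
               (LINT t:{t\<^sub>1..t\<^sub>2}|lebesgue. LINT x:K|lebesgue.
                  - u (x, t) * frechet_derivative \<phi> (at (x, t)) (0, 1) +
                  (\<Sum>i\<in>UNIV. \<bar>D i (x, t)\<bar> powr (p i - 2) * D i (x, t) *
                     frechet_derivative \<phi> (at (x, t)) (axis i 1, 0)))"
    unfolding local_weak_supersolution_def by (elim conjE exE) (rule that)
  note ineq = ineq0[rule_format, OF conjI[OF _ conjI[OF _ conjI[OF _ conjI[OF _ conjI[OF _ conjI[OF _ conjI]]]]]]]
  have L1: "Lp_Lp_loc 1 \<Omega> T u" and D: "\<And>i. Lp_Lp_loc (p i) \<Omega> T (D i)"
    and wp: "AE t in lebesgue. t \<in> {-T<..<T} \<longrightarrow> (\<forall>i. weak_partial \<Omega> i (\<lambda>x. u (x, t)) (\<lambda>x. D i (x, t)))"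
    using D0 D1 unfolding L1_W11_loc_grad_def by auto
  obtain u' where u'm[measurable]: "u' \<in> borel_measurable borel" and u': "AE z in lborel. z \<in> ?U \<longrightarrow> u' z = u z"
    using borel_representative[OF U, of u] Lp_Lp_loc_on_compact(1)[OF L1 _ _ T] by blast
  have "\<forall>i. \<exists>g. g \<in> borel_measurable borel \<and> (AE z in lborel. z \<in> ?U \<longrightarrow> g z = D i z)"
    by (intro allI borel_representative[OF U] Lp_Lp_loc_on_compact(1)[OF D _ _ T])
  from choice[OF this] obtain D' where D'm[measurable]: "\<And>i. D' i \<in> borel_measurable borel"
    and D': "\<And>i. AE z in lborel. z \<in> ?U \<longrightarrow> D' i z = D i z" by blast
  have int: "integrable lborel (\<lambda>z. indicator C z * \<bar>g z\<bar> powr q)"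
    if C: "compact C" "C \<subseteq> ?U" and f: "Lp_Lp_loc q \<Omega> T f"
      and gm[measurable]: "g \<in> borel_measurable borel" and g: "AE z in lborel. z \<in> ?U \<longrightarrow> g z = f z"
    for C f g q
  proof -
    have [measurable]: "C \<in> sets borel" using C(1) by (rule borel_compact)
    have 1: "integrable lebesgue (\<lambda>z. indicator C z * \<bar>f z\<bar> powr q)"
      by (rule Lp_Lp_loc_on_compact(2)[OF f C T])
    have "AE z in lborel. indicator C z * \<bar>f z\<bar> powr q = indicator C z * \<bar>g z\<bar> powr q"
      using g by eventually_elim (use C(2) in \<open>auto simp: indicator_def\<close>)
    then have "AE z in lebesgue. indicator C z * \<bar>f z\<bar> powr q = indicator C z * \<bar>g z\<bar> powr q"
      by (rule AE_completion)
    moreover have m: "(\<lambda>z. indicator C z * \<bar>g z\<bar> powr q) \<in> borel_measurable lborel" by measurable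
    ultimately have "integrable lebesgue (\<lambda>z. indicator C z * \<bar>g z\<bar> powr q)"
      using 1 by (elim integrable_cong_AE_imp) (auto intro: measurable_completion)
    then show ?thesis using integrable_completion[OF m] by simp
  qed
  have int_u: "integrable lborel (\<lambda>z. indicator C z * u' z)" if C: "compact C" "C \<subseteq> ?U" for C
    by (rule integrable_dominated_on_compact[OF u'm C(1) int[OF C L1 u'm u']]) simp
  have int_D: "integrable lborel (\<lambda>z. indicator C z * \<bar>D' i z\<bar> powr p i)" if C: "compact C" "C \<subseteq> ?U" for C i
    by (rule int[OF C D D'm D'])
  have Fm[measurable]: "(\<lambda>z. flux (p i) (D' i z)) \<in> borel_measurable borel" for i
    unfolding flux_def by measurable
  have int_F: "integrable lborel (\<lambda>z. indicator C z * flux (p i) (D' i z))"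
    if C: "compact C" "C \<subseteq> ?U" for C i
    by (rule integrable_dominated_on_compact[OF Fm C(1) int_D[OF C]]) (rule flux_bound[OF p])
  have int_D1: "integrable lborel (\<lambda>z. indicator C z * D' i z)" if C: "compact C" "C \<subseteq> ?U" for C i
  proof (rule integrable_dominated_on_compact[OF D'm C(1) int_D[OF C]])
    show "\<bar>D' i z\<bar> \<le> 1 + \<bar>D' i z\<bar> powr p i" for z
      using p[of i] by (intro abs_le_one_plus_powr) simp
  qed
  have ker: "0 \<le> convol u' (ddir \<kappa> time_dir) z - (\<Sum>i\<in>UNIV. convol (\<lambda>y. flux (p i) (D' i y)) (ddir \<kappa> (space_dir i)) z) \<and>
      (\<forall>i. convol (D' i) \<kappa> z = convol u' (ddir \<kappa> (space_dir i)) z)"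
    if \<epsilon>: "\<epsilon> > 0" and m: "mollifier \<epsilon> \<kappa>" and ball: "cball z \<epsilon> \<subseteq> ?U" for \<epsilon> \<kappa> z
  proof -
    obtain x0 t0 where z: "z = (x0, t0)" by (cases z)
    note [measurable] = mollifierD(10,11)[OF m]
    have cb: "compact (cball z \<epsilon>)" by simp
    have out: "\<kappa> (z - y) = 0" "ddir \<kappa> v (z - y) = 0" if "y \<notin> cball z \<epsilon>" for y v
      using that by (auto intro!: mollifierD(3)[OF m] mollifier_ddir_support[OF m] simp: dist_norm)
    have mk: "(\<lambda>y. k (z - y)) \<in> borel_measurable borel" if "k \<in> borel_measurable borel" for k :: "_ \<Rightarrow> real"
      using that by measurable
    obtain B0 where B0: "\<And>w. \<bar>\<kappa> w\<bar> \<le> B0" using mollifier_bounded(1)[OF m] by blast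
    have iprod: "integrable lborel (\<lambda>y. f y * \<kappa> (z - y))" "integrable lborel (\<lambda>y. f y * ddir \<kappa> v (z - y))"
      if "integrable lborel (\<lambda>y. indicator (cball z \<epsilon>) y * f y)" for f v
    proof -
      obtain B1 where B1: "\<And>w. \<bar>ddir \<kappa> v w\<bar> \<le> B1" using mollifier_bounded(2)[OF m] by blast
      show "integrable lborel (\<lambda>y. f y * \<kappa> (z - y))"
        by (rule integrable_times_compact_support[OF that mk, of _ B0]) (auto simp: B0 out)
      show "integrable lborel (\<lambda>y. f y * ddir \<kappa> v (z - y))"
        by (rule integrable_times_compact_support[OF that mk, of _ B1]) (auto simp: B1 out)
    qed
    define K where "K = fst ` cball z \<epsilon>"
    have K: "compact K" unfolding K_def by (intro compact_continuous_image continuous_intros cb)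
    have K\<Omega>: "K \<subseteq> \<Omega>" using ball by (auto simp: K_def cylinder_def)
    have outK: "\<kappa> (z - (x, s)) = 0" "ddir \<kappa> v (z - (x, s)) = 0" if "x \<notin> K" for x s v
    proof -
      have "(x, s) \<notin> cball z \<epsilon>" using that unfolding K_def by (metis fst_conv image_eqI)
      then show "\<kappa> (z - (x, s)) = 0" "ddir \<kappa> v (z - (x, s)) = 0" by (rule out)+
    qed
    have dz: "dist z (x, s) \<ge> \<bar>t0 - s\<bar>" for x s
      using dist_snd_le[of z "(x, s)"] by (simp add: z dist_real_def)
    have outT: "\<kappa> (z - (x, s)) = 0" if "\<bar>t0 - s\<bar> \<ge> \<epsilon>" for x s
      using dz[of s x] that by (intro mollifierD(3)[OF m]) (simp add: dist_norm)
    have outT': "ddir \<kappa> v (z - (x, s)) = 0" if "s \<notin> {t0 - \<epsilon>..t0 + \<epsilon>}" for x s v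
      using dz[of s x] that by (intro mollifier_ddir_support[OF m]) (auto simp: dist_norm)
    have closK: "closure {x\<in>\<Omega>. \<kappa> (z - (x, s)) \<noteq> 0} \<subseteq> K" for s
      by (rule closure_minimal) (use outK(1) in \<open>auto intro: compact_imp_closed[OF K]\<close>)
    have tb: "-T < t0 - \<epsilon>" "t0 + \<epsilon> < T"
    proof -
      have "(x0, t0 - \<epsilon>) \<in> cball z \<epsilon>" "(x0, t0 + \<epsilon>) \<in> cball z \<epsilon>"
        using \<epsilon> by (auto simp: z dist_Pair_Pair dist_real_def)
      then show "-T < t0 - \<epsilon>" "t0 + \<epsilon> < T" using ball by (auto simp: cylinder_def)
    qed
    have Uiff: "(x, s) \<in> ?U \<longleftrightarrow> x \<in> \<Omega> \<and> s \<in> {-T<..<T}" for x s by (auto simp: cylinder_def)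
    have fr: "frechet_derivative (\<lambda>y. \<kappa> (z - y)) (at y) v = - ddir \<kappa> v (z - y)" for y v
      using mollifier_affine(2)[OF m bounded_linear_minus[OF bounded_linear_ident], of z y v]
      by (simp add: ddir_minus[OF m])
    have sm: "smooth_on S (\<lambda>y. \<kappa> (z - y))" for S
      using mollifier_affine(1)[OF m bounded_linear_minus[OF bounded_linear_ident], of S z] by simp
    have blx: "bounded_linear (\<lambda>x::real^_. - (x, 0::real))"
      by (intro bounded_linear_minus bounded_linear_Pair bounded_linear_ident bounded_linear_zero)
    have eqs: "z - (0, s) + - (x, 0::real) = z - (x, s)" for x s by (simp add: z)
    have frs: "frechet_derivative (\<lambda>x. \<kappa> (z - (x, s))) (at x) v = - ddir \<kappa> (v, 0) (z - (x, s))" for x s v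
      using mollifier_affine(2)[OF m blx, of "z - (0, s)" x v] unfolding eqs using ddir_minus[OF m, of "(v, 0)"] by simp
    have sms: "smooth_on S (\<lambda>x. \<kappa> (z - (x, s)))" for S s
      using mollifier_affine(1)[OF m blx, of S "z - (0, s)"] unfolding eqs .
    have aeu: "AE s in lborel. AE x in lborel. (x, s) \<in> ?U \<longrightarrow> u' (x, s) = u (x, s)"
      by (rule AE_lborel_slices[OF u'])
    have aeD: "AE s in lborel. AE x in lborel. \<forall>i. (x, s) \<in> ?U \<longrightarrow> D' i (x, s) = D i (x, s)"
    proof (rule AE_lborel_slices)
      have "AE y in lborel. \<forall>i\<in>UNIV. y \<in> ?U \<longrightarrow> D' i y = D i y"
        using D' by (intro AE_finite_allI) auto
      then show "AE y in lborel. \<forall>i. y \<in> ?U \<longrightarrow> D' i y = D i y" by simp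
    qed
    \<comment> \<open>\<open>X\<close> is the integrand of the weak formulation for this test function, \<open>X'\<close> its Borel version;
      the reflection in \<open>\<kappa> (z - y)\<close> accounts for the signs\<close>
    define X' where "X' y = u' y * ddir \<kappa> time_dir (z - y) - (\<Sum>i\<in>UNIV. flux (p i) (D' i y) * ddir \<kappa> (space_dir i) (z - y))" for y
    have X'i: "integrable lborel X'"
      unfolding X'_def
      using iprod(2)[OF int_u[OF cb ball]] iprod(2)[OF int_F[OF cb ball]]
      by (intro Bochner_Integration.integrable_diff Bochner_Integration.integrable_sum)
    have [measurable]: "X' \<in> borel_measurable borel" using X'i by auto
    define X where "X x s = - u (x, s) * frechet_derivative (\<lambda>y. \<kappa> (z - y)) (at (x, s)) (0, 1) +
                  (\<Sum>i\<in>UNIV. \<bar>D i (x, s)\<bar> powr (p i - 2) * D i (x, s) *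
                     frechet_derivative (\<lambda>y. \<kappa> (z - y)) (at (x, s)) (axis i 1, 0))" for x s
    have "0 \<le> (LINT s:{t0 - \<epsilon>..t0 + \<epsilon>}|lebesgue. LINT x:K|lebesgue. X x s)"
      using ineq[of "t0 - \<epsilon>" "t0 + \<epsilon>" K "\<lambda>y. \<kappa> (z - y)"] tb \<epsilon> K K\<Omega> sm mollifierD(2)[OF m] closK
      by (simp add: outT X_def)
    also have "(LINT s:{t0 - \<epsilon>..t0 + \<epsilon>}|lebesgue. LINT x:K|lebesgue. X x s)
        = (\<integral>s. (\<integral>x. X' (x, s) \<partial>lborel) \<partial>lborel)"
      unfolding set_lebesgue_integral_def
    proof (rule lebesgue_integral_representative)
      show "(\<lambda>s. \<integral>x. X' (x, s) \<partial>lborel) \<in> borel_measurable borel" by measurable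
      show "AE s in lborel. indicator {t0 - \<epsilon>..t0 + \<epsilon>} s *\<^sub>R (\<integral>x. indicator K x *\<^sub>R X x s \<partial>lebesgue)
          = (\<integral>x. X' (x, s) \<partial>lborel)"
        using aeu aeD
      proof eventually_elim
        case (elim s)
        show ?case
        proof (cases "s \<in> {t0 - \<epsilon>..t0 + \<epsilon>}")
          case True
          have "(\<integral>x. indicator K x *\<^sub>R X x s \<partial>lebesgue) = (\<integral>x. X' (x, s) \<partial>lborel)"
          proof (rule lebesgue_integral_representative)
            show "(\<lambda>x. X' (x, s)) \<in> borel_measurable borel" by measurable
            show "AE x in lborel. indicator K x *\<^sub>R X x s = X' (x, s)"
              using elim(1) elim(2)
            proof eventually_elim
              case (elim x)
              show ?case
              proof (cases "x \<in> K")
                case False then show ?thesis by (simp add: X'_def outK)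
              next
                case xK: True
                then have "(x, s) \<in> ?U" using K\<Omega> True tb by (auto simp: Uiff)
                with elim xK show ?thesis
                  by (simp add: X'_def X_def fr flux_def sum_negf)
              qed
            qed
          qed
          then show ?thesis using True by simp
        next
          case False
          then show ?thesis by (simp add: X'_def outT')
        qed
      qed
    qed
    also have "\<dots> = integral\<^sup>L lborel X'"
      using lborel_pair.integral_snd[of "\<lambda>x s. X' (x, s)"] X'i by (simp add: lborel_prod case_prod_unfold)
    also have "\<dots> = convol u' (ddir \<kappa> time_dir) z - (\<Sum>i\<in>UNIV. convol (\<lambda>y. flux (p i) (D' i y)) (ddir \<kappa> (space_dir i)) z)"
      unfolding X'_def convol_def
      using iprod(2)[OF int_u[OF cb ball]] iprod(2)[OF int_F[OF cb ball]]
      by (subst Bochner_Integration.integral_diff) (auto simp: Bochner_Integration.integral_sum)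
    finally have 1: "0 \<le> convol u' (ddir \<kappa> time_dir) z - (\<Sum>i\<in>UNIV. convol (\<lambda>y. flux (p i) (D' i y)) (ddir \<kappa> (space_dir i)) z)" .
    have 2: "convol (D' i) \<kappa> z = convol u' (ddir \<kappa> (space_dir i)) z" for i
    proof -
      note iu = iprod(2)[OF int_u[OF cb ball], of "space_dir i"]
      note iD = iprod(1)[OF int_D1[OF cb ball], of i]
      have wp': "AE s in lborel. s \<in> {-T<..<T} \<longrightarrow> weak_partial \<Omega> i (\<lambda>x. u (x, s)) (\<lambda>x. D i (x, s))"
        using wp by (auto simp: AE_completion_iff)
      have "AE s in lborel. (\<integral>x. u' (x, s) * ddir \<kappa> (space_dir i) (z - (x, s)) \<partial>lborel)
          = (\<integral>x. D' i (x, s) * \<kappa> (z - (x, s)) \<partial>lborel)"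
        using aeu aeD wp'
      proof eventually_elim
        case (elim s)
        show ?case
        proof (cases "s \<in> {t0 - \<epsilon>..t0 + \<epsilon>}")
          case True
          then have sT: "s \<in> {-T<..<T}" using tb by auto
          have "(LINT x:\<Omega>|lebesgue. u (x, s) * frechet_derivative (\<lambda>x. \<kappa> (z - (x, s))) (at x) (axis i 1)) =
              - (LINT x:\<Omega>|lebesgue. D i (x, s) * \<kappa> (z - (x, s)))"
            using elim(3) sT sms K K\<Omega> closK unfolding weak_partial_def by blast
          then have *: "(LINT x:\<Omega>|lebesgue. u (x, s) * - ddir \<kappa> (space_dir i) (z - (x, s))) =
              - (LINT x:\<Omega>|lebesgue. D i (x, s) * \<kappa> (z - (x, s)))"
            unfolding frs .
          have "(LINT x:\<Omega>|lebesgue. u (x, s) * - ddir \<kappa> (space_dir i) (z - (x, s)))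
              = (\<integral>x. - (u' (x, s) * ddir \<kappa> (space_dir i) (z - (x, s))) \<partial>lborel)"
            unfolding set_lebesgue_integral_def
          proof (rule lebesgue_integral_representative)
            show "AE x in lborel. indicator \<Omega> x *\<^sub>R (u (x, s) * - ddir \<kappa> (space_dir i) (z - (x, s)))
                = - (u' (x, s) * ddir \<kappa> (space_dir i) (z - (x, s)))"
              using elim(1)
            proof eventually_elim
              case (elim x)
              show ?case using elim sT outK(2)[of x "space_dir i" s] K\<Omega> by (cases "x \<in> \<Omega>") (auto simp: Uiff)
            qed
          qed measurable
          moreover have "(LINT x:\<Omega>|lebesgue. D i (x, s) * \<kappa> (z - (x, s)))
              = (\<integral>x. D' i (x, s) * \<kappa> (z - (x, s)) \<partial>lborel)"
            unfolding set_lebesgue_integral_def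
          proof (rule lebesgue_integral_representative)
            show "AE x in lborel. indicator \<Omega> x *\<^sub>R (D i (x, s) * \<kappa> (z - (x, s)))
                = D' i (x, s) * \<kappa> (z - (x, s))"
              using elim(2)
            proof eventually_elim
              case (elim x)
              show ?case using elim sT outK(1)[of x s] K\<Omega> by (cases "x \<in> \<Omega>") (auto simp: Uiff)
            qed
          qed measurable
          ultimately show ?thesis using * by simp
        next
          case False
          then have "\<bar>t0 - s\<bar> \<ge> \<epsilon>" by auto
          with False show ?thesis by (simp add: outT outT')
        qed
      qed
      then have "(\<integral>s. (\<integral>x. u' (x, s) * ddir \<kappa> (space_dir i) (z - (x, s)) \<partial>lborel) \<partial>lborel)
          = (\<integral>s. (\<integral>x. D' i (x, s) * \<kappa> (z - (x, s)) \<partial>lborel) \<partial>lborel)"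
        by (intro integral_cong_AE) measurable
      moreover have "(\<integral>s. (\<integral>x. u' (x, s) * ddir \<kappa> (space_dir i) (z - (x, s)) \<partial>lborel) \<partial>lborel)
          = convol u' (ddir \<kappa> (space_dir i)) z"
        using lborel_pair.integral_snd[of "\<lambda>x s. u' (x, s) * ddir \<kappa> (space_dir i) (z - (x, s))"] iu
        by (simp add: lborel_prod case_prod_unfold convol_def)
      moreover have "(\<integral>s. (\<integral>x. D' i (x, s) * \<kappa> (z - (x, s)) \<partial>lborel) \<partial>lborel) = convol (D' i) \<kappa> z"
        using lborel_pair.integral_snd[of "\<lambda>x s. D' i (x, s) * \<kappa> (z - (x, s))"] iD
        by (simp add: lborel_prod case_prod_unfold convol_def)
      ultimately show ?thesis by simp
    qed
    show ?thesis using 1 2 by blast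
  qed
  have "kernel_supersolution ?U p u' D'"
    unfolding kernel_supersolution_def using int_u int_D ker by (auto simp: D'm)
  with u' show ?thesis by blast
qed

section \<open>Estimates for the mollified supersolution\<close>

lemma compact_neighbourhood:
  fixes C U :: "'a::euclidean_space set"
  assumes C: "compact C" and U: "open U" "C \<subseteq> U"
  obtains d C' where "d > 0" "compact C'" "C' \<subseteq> U" "\<And>z. z \<in> C \<Longrightarrow> cball z d \<subseteq> C'"
proof -
  obtain d where d: "d > 0" "(\<Union>x\<in>C. cball x d) \<subseteq> U"
    using compact_subset_open_imp_cball_epsilon_subset[OF C U] by blast
  define C' where "C' = {x + y | x y. x \<in> C \<and> y \<in> cball 0 d}"
  show thesis
  proof (rule that[OF d(1)])
    show "compact C'" unfolding C'_def by (rule compact_sums[OF C]) auto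
    show "cball z d \<subseteq> C'" if "z \<in> C" for z
    proof
      fix y assume "y \<in> cball z d"
      then have "y = z + (y - z)" "y - z \<in> cball 0 d" by (auto simp: dist_norm norm_minus_commute)
      then show "y \<in> C'" using that unfolding C'_def by blast
    qed
    show "C' \<subseteq> U"
    proof
      fix y assume "y \<in> C'"
      then obtain a b where ab: "y = a + b" "a \<in> C" "b \<in> cball 0 d" by (auto simp: C'_def)
      then have "y \<in> cball a d" by (auto simp: dist_norm)
      with ab d(2) show "y \<in> U" by blast
    qed
  qed
qed

text \<open>The exponent is at least two, so the kink of the positive part at zero is smoothed out.\<close>

lemma DERIV_pospart_power:
  "((\<lambda>s. (max 0 s) ^ (n + 2)) has_real_derivative real (n + 2) * (max 0 s) ^ (n + 1)) (at s)"
proof -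
  consider "s > 0" | "s < 0" | "s = 0" by linarith
  then show ?thesis
  proof cases
    case 1
    have "\<forall>\<^sub>F y in nhds s. (max 0 y) ^ (n + 2) = y ^ (n + 2)"
      using eventually_nhds_in_open[of "{0<..}" s] 1 by (auto elim!: eventually_mono)
    moreover have "((\<lambda>y. y ^ (n + 2)) has_real_derivative real (n + 2) * (max 0 s) ^ (n + 1)) (at s)"
      using 1 DERIV_pow[of "n + 2" s] by simp
    ultimately show ?thesis by (subst DERIV_cong_ev[OF refl _ refl])
  next
    case 2
    have ev: "\<forall>\<^sub>F y in nhds s. (max 0 y) ^ (n + 2) = 0"
      using eventually_nhds_in_open[of "{..<0}" s] 2 by (auto elim!: eventually_mono)
    show ?thesis by (subst DERIV_cong_ev[OF refl ev refl]) (use 2 in auto)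
  next
    case 3
    have "((\<lambda>h::real. max 0 h ^ (n + 2) / h) \<longlongrightarrow> 0) (at 0)"
    proof (rule Lim_null_comparison)
      have "\<bar>max 0 h ^ (n + 2) / h\<bar> \<le> \<bar>h\<bar> ^ (n + 1)" for h :: real
      proof (cases "h > 0")
        case False
        then have "max 0 h ^ (n + 2) / h = 0" by simp
        then show ?thesis by (simp only: abs_zero zero_le_power abs_ge_zero)
      qed simp
      then show "\<forall>\<^sub>F h::real in at 0. norm (max 0 h ^ (n + 2) / h) \<le> \<bar>h\<bar> ^ (n + 1)" by simp
      have "((\<lambda>h::real. \<bar>h\<bar> ^ (n + 1)) \<longlongrightarrow> \<bar>0\<bar> ^ (n + 1)) (at 0)"
        by (intro tendsto_intros)
      then show "((\<lambda>h::real. \<bar>h\<bar> ^ (n + 1)) \<longlongrightarrow> 0) (at 0)" by simp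
    qed
    then show ?thesis using 3 by (simp add: DERIV_def)
  qed
qed

lemma has_dir_deriv_mult:
  assumes "has_dir_deriv f e f' z" "has_dir_deriv g e g' z"
  shows "has_dir_deriv (\<lambda>z. f z * g z) e (f' * g z + g' * f z) z"
  using DERIV_mult[OF assms[unfolded has_dir_deriv_def]] by (simp add: has_dir_deriv_def)

lemma has_dir_deriv_compose:
  assumes "(\<phi> has_real_derivative \<phi>') (at (f z))" "has_dir_deriv f e f' z"
  shows "has_dir_deriv (\<lambda>z. \<phi> (f z)) e (\<phi>' * f') z"
proof -
  have "(\<phi> has_real_derivative \<phi>') (at (f (z + 0 *\<^sub>R e)))" using assms(1) by simp
  from DERIV_chain2[OF this assms(2)[unfolded has_dir_deriv_def]]
  show ?thesis by (simp add: has_dir_deriv_def)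
qed

text \<open>The bound is existential, so that boundedness of composite expressions follows by introduction rules.\<close>

definition bounded_fun :: "('a \<Rightarrow> real) \<Rightarrow> bool" where
  "bounded_fun f \<longleftrightarrow> (\<exists>B. \<forall>z. \<bar>f z\<bar> \<le> B)"

lemma bounded_funI: "(\<And>z. \<bar>f z\<bar> \<le> B) \<Longrightarrow> bounded_fun f" by (auto simp: bounded_fun_def)

lemma bounded_fun_const: "bounded_fun (\<lambda>_. c)" by (auto simp: bounded_fun_def)

lemma bounded_fun_add: "bounded_fun f \<Longrightarrow> bounded_fun g \<Longrightarrow> bounded_fun (\<lambda>z. f z + g z)"
  unfolding bounded_fun_def by (meson abs_triangle_ineq add_mono order_trans)

lemma bounded_fun_uminus: "bounded_fun f \<Longrightarrow> bounded_fun (\<lambda>z. - f z)"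
  unfolding bounded_fun_def by simp

lemma bounded_fun_mult: "bounded_fun f \<Longrightarrow> bounded_fun g \<Longrightarrow> bounded_fun (\<lambda>z. f z * g z)"
  unfolding bounded_fun_def abs_mult by (meson abs_ge_zero mult_mono order_trans)

lemma bounded_fun_power: "bounded_fun f \<Longrightarrow> bounded_fun (\<lambda>z. f z ^ n)"
  by (induction n) (auto intro: bounded_fun_const bounded_fun_mult)

lemma bounded_fun_truncation: "bounded_fun f \<Longrightarrow> bounded_fun (\<lambda>z. max 0 (k - f z))"
proof -
  assume "bounded_fun f"
  then obtain B where "\<And>z. \<bar>f z\<bar> \<le> B" by (auto simp: bounded_fun_def)
  then have B: "\<bar>f z\<bar> \<le> B" for z by blast
  have "\<bar>max 0 (k - f z)\<bar> \<le> \<bar>k\<bar> + B" for z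
  proof -
    have "\<bar>max 0 (k - f z)\<bar> \<le> \<bar>k - f z\<bar>" by (simp add: max_def)
    also have "\<dots> \<le> \<bar>k\<bar> + \<bar>f z\<bar>" by (rule abs_triangle_ineq4)
    finally show ?thesis using B[of z] by simp
  qed
  then show ?thesis by (rule bounded_funI)
qed

lemmas bounded_fun_intros = bounded_fun_const bounded_fun_add bounded_fun_uminus bounded_fun_mult
  bounded_fun_power bounded_fun_truncation

lemma has_dir_deriv_integral_bounded:
  fixes g :: "'a::euclidean_space \<Rightarrow> real"
  assumes "g \<in> borel_measurable borel" and D: "\<And>z. has_dir_deriv g e (g' z) z"
    and "bounded_fun g" "bounded_fun g'" and C: "compact C" "\<And>z. z \<notin> C \<Longrightarrow> g z = 0"
  shows "integrable lborel g'" "integral\<^sup>L lborel g' = 0"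
    "(\<integral>z. \<bar>g (z + h *\<^sub>R e) - g z\<bar> \<partial>lborel) \<le> \<bar>h\<bar> * (\<integral>z. \<bar>g' z\<bar> \<partial>lborel)"
proof -
  obtain B1 B2 where B: "\<And>z. \<bar>g z\<bar> \<le> B1" "\<And>z. \<bar>g' z\<bar> \<le> B2"
    using assms(3,4) by (auto simp: bounded_fun_def)
  obtain R where "\<forall>z\<in>C. norm z \<le> R" using compact_imp_bounded[OF C(1)] by (auto simp: bounded_iff)
  then have R: "g z = 0" if "norm z > R" for z using C(2)[of z] that by force
  have B': "\<bar>g' z\<bar> \<le> max B1 B2" "\<bar>g z\<bar> \<le> max B1 B2" for z using B(1)[of z] B(2)[of z] by auto
  from has_dir_deriv_integral[OF assms(1) D B' R]
  show "integrable lborel g'" "integral\<^sup>L lborel g' = 0"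
    "(\<integral>z. \<bar>g (z + h *\<^sub>R e) - g z\<bar> \<partial>lborel) \<le> \<bar>h\<bar> * (\<integral>z. \<bar>g' z\<bar> \<partial>lborel)" by auto
qed

text \<open>The second function returns, for each coordinate direction, the derivative of \<open>\<zeta>\<close> in that
  direction. Carrying it along as an argument keeps the estimates below explicit.\<close>

definition cutoff :: "'a::euclidean_space set \<Rightarrow> ('a \<Rightarrow> real) \<Rightarrow> ('a \<Rightarrow> 'a \<Rightarrow> real) \<Rightarrow> bool" where
  "cutoff C \<zeta> \<zeta>' \<longleftrightarrow> compact C \<and> \<zeta> \<in> borel_measurable borel \<and> (\<forall>z. 0 \<le> \<zeta> z) \<and> (\<forall>z. z \<notin> C \<longrightarrow> \<zeta> z = 0) \<and>
    (\<forall>e\<in>Basis. \<forall>z. has_dir_deriv \<zeta> e (\<zeta>' e z) z) \<and> bounded_fun \<zeta> \<and> (\<forall>e\<in>Basis. bounded_fun (\<zeta>' e))"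

lemma cutoffD:
  assumes "cutoff C \<zeta> \<zeta>'"
  shows "compact C" "\<zeta> \<in> borel_measurable borel" "0 \<le> \<zeta> z" "z \<notin> C \<Longrightarrow> \<zeta> z = 0" "bounded_fun \<zeta>"
    "e \<in> Basis \<Longrightarrow> has_dir_deriv \<zeta> e (\<zeta>' e z) z" "e \<in> Basis \<Longrightarrow> bounded_fun (\<zeta>' e)"
    "e \<in> Basis \<Longrightarrow> \<zeta>' e \<in> borel_measurable borel"
    "e \<in> Basis \<Longrightarrow> z \<notin> C \<Longrightarrow> \<zeta>' e z = 0"
proof -
  show m: "\<zeta> \<in> borel_measurable borel" and C: "compact C"
    and d: "e \<in> Basis \<Longrightarrow> has_dir_deriv \<zeta> e (\<zeta>' e z) z" for z using assms by (auto simp: cutoff_def)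
  show "e \<in> Basis \<Longrightarrow> \<zeta>' e \<in> borel_measurable borel" by (rule has_dir_deriv_measurable[OF m d])
  show "\<zeta>' e z = 0" if e: "e \<in> Basis" and z: "z \<notin> C"
  proof -
    have "open (- C)" using compact_imp_closed[OF C] by auto
    then obtain r where r: "r > 0" "ball z r \<subseteq> - C" using z by (auto simp: open_contains_ball)
    have "\<forall>\<^sub>F h in nhds 0. \<zeta> (z + h *\<^sub>R e) = 0"
      using eventually_nhds_in_open[of "ball 0 r" "0::real"] r(1)
    proof (auto elim!: eventually_mono)
      fix h :: real assume "\<bar>h\<bar> < r"
      then have "z + h *\<^sub>R e \<in> ball z r" using e by (simp add: dist_norm)
      then show "\<zeta> (z + h *\<^sub>R e) = 0" using r assms by (auto simp: cutoff_def)
    qed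
    then have "((\<lambda>h. \<zeta> (z + h *\<^sub>R e)) has_real_derivative 0) (at 0)"
      by (subst DERIV_cong_ev[OF refl _ refl]) auto
    then show ?thesis using d[OF e, of z] DERIV_unique by (auto simp: has_dir_deriv_def)
  qed
qed (use assms in \<open>auto simp: cutoff_def\<close>)

text \<open>The pointwise inequality \<open>sup\<close> is multiplied by \<open>w = V\<^sup>2 * \<zeta> \<ge> 0\<close> and integrated by parts. With
  \<open>f\<^sub>\<epsilon>\<close> for the mollification, \<open>V\<^sup>2\<close> times the derivative of \<open>f\<^sub>\<epsilon>\<close> is minus the derivative of
  \<open>V ^ 3 / 3\<close>. Concretely, \<open>E\<close> exceeds a sum of directional derivatives of compactly supported
  functions, which has integral zero, by \<open>w\<close> times the right-hand side of \<open>sup\<close>. The square in \<open>w\<close>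
  makes \<open>w\<close> differentiable; the second estimate is the translation estimate for \<open>w\<close>.\<close>

lemma mollified_estimates:
  fixes f :: "'a::euclidean_space \<Rightarrow> real" and F :: "'i::finite \<Rightarrow> 'a \<Rightarrow> real" and k :: real
  assumes f: "integrable lborel f" and F: "\<And>i. integrable lborel (F i)"
    and m: "mollifier \<epsilon> \<kappa>" and c: "cutoff C \<zeta> \<zeta>'" and \<tau>: "\<tau> \<in> Basis" and e: "\<And>i. e i \<in> Basis"
    and sup: "\<And>z. z \<in> C \<Longrightarrow> 0 \<le> convol f (ddir \<kappa> \<tau>) z - (\<Sum>i\<in>UNIV. convol (F i) (ddir \<kappa> (e i)) z)"
  defines "V z \<equiv> max 0 (k - convol f \<kappa> z)"
  defines "E z \<equiv> V z ^ 3 / 3 * \<zeta>' \<tau> z +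
    (\<Sum>i\<in>UNIV. convol (F i) \<kappa> z * (V z ^ 2 * \<zeta>' (e i) z - 2 * V z * convol f (ddir \<kappa> (e i)) z * \<zeta> z))"
  shows "integrable lborel E \<Longrightarrow> 0 \<le> integral\<^sup>L lborel E"
    "(\<integral>z. \<bar>V (z + h *\<^sub>R e i) ^ 2 * \<zeta> (z + h *\<^sub>R e i) - V z ^ 2 * \<zeta> z\<bar> \<partial>lborel)
      \<le> \<bar>h\<bar> * (\<integral>z. \<bar>V z ^ 2 * \<zeta>' (e i) z - 2 * V z * convol f (ddir \<kappa> (e i)) z * \<zeta> z\<bar> \<partial>lborel)"
proof -
  obtain B where B: "\<And>w. \<bar>\<kappa> w\<bar> \<le> B" using mollifier_bounded(1)[OF m] by blast
  have bd: "bounded_fun (convol g \<kappa>)" "bounded_fun (convol g (ddir \<kappa> d))"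
    if "integrable lborel g" for g d
  proof -
    obtain B1 where B1: "\<And>w. \<bar>ddir \<kappa> d w\<bar> \<le> B1" using mollifier_bounded(2)[OF m] by blast
    show "bounded_fun (convol g \<kappa>)" "bounded_fun (convol g (ddir \<kappa> d))"
      using convol_bounded[OF that mollifierD(6)[OF m] B] convol_bounded[OF that mollifierD(7)[OF m] B1]
      by (auto intro: bounded_funI)
  qed
  have [measurable]: "convol g \<kappa> \<in> borel_measurable borel" if "integrable lborel g" for g
    using that by (intro convol_measurable mollifierD(10)[OF m]) auto
  note [measurable] = cutoffD(2)[OF c] this[OF f] this[OF F]
  note dd = convol_has_dir_deriv[OF _ m]
  have DV: "has_dir_deriv (\<lambda>z. V z ^ (n + 2)) d (- (real (n + 2) * V z ^ (n + 1) * convol f (ddir \<kappa> d) z)) z"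
    for n d z
  proof -
    have "((\<lambda>s. max 0 (k - s) ^ (n + 2)) has_real_derivative
        (real (n + 2) * max 0 (k - s) ^ (n + 1)) * (- 1)) (at s)" for s
      by (rule DERIV_chain2[OF DERIV_pospart_power]) (auto intro!: derivative_eq_intros)
    from has_dir_deriv_compose[OF this dd[OF f]] show ?thesis by (simp add: V_def)
  qed
  have DV2: "has_dir_deriv (\<lambda>z. V z ^ 2) d (- (2 * V z * convol f (ddir \<kappa> d) z)) z" for d z
    using DV[of 0] by (simp add: power2_eq_square)
  have DV3: "has_dir_deriv (\<lambda>z. V z ^ 3 / 3) d (- (V z ^ 2 * convol f (ddir \<kappa> d) z)) z" for d z
    using DERIV_cmult[OF DV[of 1, unfolded has_dir_deriv_def], of "1/3"]
    by (simp add: has_dir_deriv_def numeral_3_eq_3 numeral_2_eq_2 mult.assoc)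
  have bV: "bounded_fun V" unfolding V_def[abs_def] by (intro bounded_fun_intros bd f)
  note bi = bounded_fun_intros bV bd(1)[OF f] bd(2)[OF f] bd(1)[OF F] bd(2)[OF F] cutoffD(5)[OF c] cutoffD(7)[OF c]
  have [measurable]: "V \<in> borel_measurable borel" unfolding V_def[abs_def] by measurable
  \<comment> \<open>\<open>w\<close> is both the test function and the function whose translations are estimated\<close>
  define w where "w z = V z ^ 2 * \<zeta> z" for z
  define w' where "w' d z = - (2 * V z * convol f (ddir \<kappa> d) z) * \<zeta> z + \<zeta>' d z * V z ^ 2" for d z
  have Dw: "has_dir_deriv w d (w' d z) z" if "d \<in> Basis" for d z
    unfolding w_def w'_def by (rule has_dir_deriv_mult[OF DV2 cutoffD(6)[OF c that]])
  have bw: "bounded_fun w" "d \<in> Basis \<Longrightarrow> bounded_fun (w' d)" for d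
    unfolding w_def[abs_def] w'_def by (intro bi; assumption)+
  have mw[measurable]: "w \<in> borel_measurable borel" unfolding w_def[abs_def] by measurable
  have w0: "w z = 0" if "z \<notin> C" for z using cutoffD(4)[OF c that] by (simp add: w_def)
  show "(\<integral>z. \<bar>V (z + h *\<^sub>R e i) ^ 2 * \<zeta> (z + h *\<^sub>R e i) - V z ^ 2 * \<zeta> z\<bar> \<partial>lborel)
      \<le> \<bar>h\<bar> * (\<integral>z. \<bar>V z ^ 2 * \<zeta>' (e i) z - 2 * V z * convol f (ddir \<kappa> (e i)) z * \<zeta> z\<bar> \<partial>lborel)"
    using has_dir_deriv_integral_bounded(3)[OF mw Dw[OF e] bw(1) bw(2)[OF e] cutoffD(1)[OF c] w0, of h i]
    by (simp add: w_def w'_def algebra_simps)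
  \<comment> \<open>\<open>a'\<close> and \<open>b'\<close> are full derivatives and integrate to zero; \<open>E\<close> collects what remains after
    subtracting \<open>w\<close> times the differential inequality\<close>
  define a where "a z = V z ^ 3 / 3 * \<zeta> z" for z
  define a' where "a' z = - (V z ^ 2 * convol f (ddir \<kappa> \<tau>) z) * \<zeta> z + \<zeta>' \<tau> z * (V z ^ 3 / 3)" for z
  define b where "b i z = convol (F i) \<kappa> z * w z" for i z
  define b' where "b' i z = convol (F i) (ddir \<kappa> (e i)) z * w z + w' (e i) z * convol (F i) \<kappa> z" for i z
  have mab: "a \<in> borel_measurable borel" "b i \<in> borel_measurable borel" for i
    unfolding a_def[abs_def] b_def[abs_def] by measurable
  have b3: "bounded_fun (\<lambda>z. V z ^ 3 / 3)"
    using bounded_fun_mult[OF bounded_fun_power[OF bV, of 3] bounded_fun_const[of "1/3"]] by simp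
  have Da: "has_dir_deriv a \<tau> (a' z) z" for z
    unfolding a_def a'_def by (rule has_dir_deriv_mult[OF DV3 cutoffD(6)[OF c \<tau>]])
  have Db: "has_dir_deriv (b i) (e i) (b' i z) z" for i z
    unfolding b_def b'_def by (rule has_dir_deriv_mult[OF dd[OF F] Dw[OF e]])
  have ba: "bounded_fun a" "bounded_fun a'"
    unfolding a_def[abs_def] a'_def[abs_def] by (intro bi b3 \<tau>)+
  have bb: "bounded_fun (b i)" "bounded_fun (b' i)" for i
    unfolding b_def b'_def by (intro bi bw e)+
  have a0: "z \<notin> C \<Longrightarrow> a z = 0" "z \<notin> C \<Longrightarrow> b i z = 0" for z i
    using cutoffD(4)[OF c] w0 by (auto simp: a_def b_def)
  note Ia = has_dir_deriv_integral_bounded(1,2)[OF mab(1) Da ba cutoffD(1)[OF c] a0(1)]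
  note Ib = has_dir_deriv_integral_bounded(1,2)[OF mab(2) Db bb cutoffD(1)[OF c] a0(2)]
  have "(\<integral>z. a' z + (\<Sum>i\<in>UNIV. b' i z) \<partial>lborel) = 0"
    using Ia Ib by (subst Bochner_Integration.integral_add) (auto simp: Bochner_Integration.integral_sum)
  moreover have "a' z + (\<Sum>i\<in>UNIV. b' i z) \<le> E z" for z
  proof (cases "z \<in> C")
    case False
    then show ?thesis
      using cutoffD(4)[OF c False] cutoffD(9)[OF c \<tau> False] cutoffD(9)[OF c e False]
      by (simp add: a'_def b'_def w'_def w_def E_def)
  next
    case True
    have "E z - (a' z + (\<Sum>i\<in>UNIV. b' i z)) = w z * convol f (ddir \<kappa> \<tau>) z - (\<Sum>i\<in>UNIV. convol (F i) (ddir \<kappa> (e i)) z * w z)"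
      unfolding E_def a'_def b'_def w'_def w_def
      by (simp add: sum.distrib sum_subtractf algebra_simps)
    also have "\<dots> = w z * (convol f (ddir \<kappa> \<tau>) z - (\<Sum>i\<in>UNIV. convol (F i) (ddir \<kappa> (e i)) z))"
      by (simp add: algebra_simps sum_distrib_left)
    also have "\<dots> \<ge> 0"
      using sup[OF True] cutoffD(3)[OF c, of z] by (intro mult_nonneg_nonneg) (auto simp: w_def)
    finally show ?thesis by simp
  qed
  ultimately show "0 \<le> integral\<^sup>L lborel E" if "integrable lborel E"
    using integral_mono[of lborel "\<lambda>z. a' z + (\<Sum>i\<in>UNIV. b' i z)" E] that Ia Ib
    by (auto simp: Bochner_Integration.integrable_sum)
qed

lemma convol_integrable:
  assumes f: "integrable lborel f" and m: "mollifier \<epsilon> \<kappa>"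
  shows "integrable lborel (convol f \<kappa>)"
proof -
  have [measurable]: "f \<in> borel_measurable borel" using f by auto
  have [measurable]: "convol f \<kappa> \<in> borel_measurable borel"
    by (intro convol_measurable mollifierD(10)[OF m]) auto
  have nf: "(\<integral>\<^sup>+x. ennreal \<bar>f x\<bar> \<partial>lborel) = ennreal (\<integral>x. \<bar>f x\<bar> \<partial>lborel)"
    using f by (intro nn_integral_eq_integral) auto
  have "(\<integral>\<^sup>+x. ennreal \<bar>f (x + h) - f x\<bar> \<partial>lborel) \<le> ennreal (2 * (\<integral>x. \<bar>f x\<bar> \<partial>lborel))" for h
  proof -
    have "(\<integral>\<^sup>+x. ennreal \<bar>f (x + h) - f x\<bar> \<partial>lborel) \<le> (\<integral>\<^sup>+x. ennreal \<bar>f (x + h)\<bar> + ennreal \<bar>f x\<bar> \<partial>lborel)"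
      by (intro nn_integral_mono) (auto simp flip: ennreal_plus)
    also have "\<dots> = (\<integral>\<^sup>+x. ennreal \<bar>f (x + h)\<bar> \<partial>lborel) + (\<integral>\<^sup>+x. ennreal \<bar>f x\<bar> \<partial>lborel)"
      by (rule nn_integral_add) auto
    also have "(\<integral>\<^sup>+x. ennreal \<bar>f (x + h)\<bar> \<partial>lborel) = (\<integral>\<^sup>+x. ennreal \<bar>f x\<bar> \<partial>lborel)"
      by (rule nn_integral_lborel_shift) simp
    finally show ?thesis by (simp add: nf flip: ennreal_plus)
  qed
  from mollify_L1_le[OF f m this]
  have "(\<integral>\<^sup>+z. ennreal (norm (convol f \<kappa> z - f z)) \<partial>lborel) < \<infinity>"
    by (auto intro: le_less_trans)
  then have "integrable lborel (\<lambda>z. convol f \<kappa> z - f z)" by (intro integrableI_bounded) auto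
  from Bochner_Integration.integrable_add[OF this f] show ?thesis by simp
qed

lemma convol_L1_tendsto:
  assumes f: "integrable lborel f" and m: "\<And>n. mollifier (\<epsilon> n) (\<kappa> n)" and \<epsilon>: "\<epsilon> \<longlonglongrightarrow> 0"
  shows "(\<lambda>n. \<integral>z. \<bar>convol f (\<kappa> n) z - f z\<bar> \<partial>lborel) \<longlonglongrightarrow> 0"
proof -
  have "(\<integral>\<^sup>+z. ennreal \<bar>convol f (\<kappa> n) z - f z\<bar> \<partial>lborel) = ennreal (\<integral>z. \<bar>convol f (\<kappa> n) z - f z\<bar> \<partial>lborel)" for n
    using f convol_integrable[OF f m] by (intro nn_integral_eq_integral) auto
  with mollify_L1_tendsto[OF f m \<epsilon>]
  have "(\<lambda>n. ennreal (\<integral>z. \<bar>convol f (\<kappa> n) z - f z\<bar> \<partial>lborel)) \<longlonglongrightarrow> ennreal 0" by simp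
  then show ?thesis by (subst (asm) tendsto_ennreal_iff) auto
qed

lemma convol_mono_AE:
  assumes fg: "AE y in lborel. f y \<le> g y" and m: "mollifier \<epsilon> \<kappa>"
    and f: "integrable lborel f" and g: "integrable lborel g"
  shows "convol f \<kappa> z \<le> convol g \<kappa> z"
proof -
  obtain B where B: "\<And>w. \<bar>\<kappa> w\<bar> \<le> B" using mollifier_bounded(1)[OF m] by blast
  show ?thesis
    unfolding convol_def
  proof (rule integral_mono_AE)
    show "AE y in lborel. f y * \<kappa> (z - y) \<le> g y * \<kappa> (z - y)"
      using fg by eventually_elim (rule mult_right_mono, auto intro: mollifierD(2)[OF m])
  qed (intro convol_integrand[OF f mollifierD(6)[OF m] B] convol_integrand[OF g mollifierD(6)[OF m] B])+
qed

lemma convol_indicator_cong: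
  assumes "\<And>y. y \<notin> C \<Longrightarrow> k (z - y) = 0"
  shows "convol (\<lambda>y. indicator C y * f y) k z = convol f k z"
  unfolding convol_def
  by (rule Bochner_Integration.integral_cong) (use assms in \<open>auto simp: indicator_def\<close>)

text \<open>Young's inequality without sharp constants: both factors are at most the maximum of \<open>a\<close> and \<open>b\<close>.\<close>

lemma powr_young: "q \<ge> 1 \<Longrightarrow> a \<ge> 0 \<Longrightarrow> b \<ge> 0 \<Longrightarrow> a powr (q - 1) * b \<le> a powr q + (b::real) powr q"
proof -
  assume q: "q \<ge> 1" and ab: "a \<ge> 0" "b \<ge> 0"
  define c where "c = max a b"
  have c: "c \<ge> 0" "a \<le> c" "b \<le> c" using ab by (auto simp: c_def)
  have "a powr (q - 1) * b \<le> c powr (q - 1) * c"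
    using ab c q by (intro mult_mono powr_mono2) auto
  also have "\<dots> = c powr q"
  proof (cases "c = 0")
    case False
    then have "c powr (q - 1) * c powr 1 = c powr q" using c by (subst powr_add[symmetric]) simp
    then show ?thesis using False c by simp
  qed (use q in simp)
  also have "\<dots> \<le> a powr q + b powr q" by (cases "a \<le> b") (auto simp: c_def max_def)
  finally show ?thesis .
qed

lemma flux_mult: "q > 2 \<Longrightarrow> flux q d * d = \<bar>d\<bar> powr q"
proof (cases "d = 0")
  case False
  assume "q > 2"
  have "\<bar>d\<bar> powr (q - 2) * \<bar>d\<bar> powr 2 = \<bar>d\<bar> powr q" by (subst powr_add[symmetric]) simp
  moreover have "\<bar>d\<bar> powr 2 = d * d" using False by (simp add: powr_numeral power2_eq_square)
  ultimately show ?thesis by (simp add: flux_def mult.assoc)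
qed (simp add: flux_def)

text \<open>The product is a double integral of the flux at \<open>y\<close> times the gradient at \<open>y'\<close>. Young's inequality at
  the pair \<open>(y, y')\<close> separates the two points, and each of the two resulting terms depends on one point
  only, so that the other integration contributes the factor one. The right-hand side converges in the
  mean when the mollifier shrinks, which is what the passage to the limit requires.\<close>

lemma convol_flux_bound:
  assumes q: "q > 2" and m: "mollifier \<epsilon> \<kappa>"
    and g: "integrable lborel g" and P: "integrable lborel (\<lambda>y. \<bar>g y\<bar> powr q)"
    and F: "integrable lborel (\<lambda>y. flux q (g y))"
  shows "\<bar>convol (\<lambda>y. flux q (g y)) \<kappa> z * convol g \<kappa> z\<bar> \<le> 2 * convol (\<lambda>y. \<bar>g y\<bar> powr q) \<kappa> z"
proof -
  obtain B where B: "\<And>w. \<bar>\<kappa> w\<bar> \<le> B" using mollifier_bounded(1)[OF m] by blast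
  note ci = convol_integrand[OF _ mollifierD(6)[OF m] B, of _ z]
  let ?P = "convol (\<lambda>y. \<bar>g y\<bar> powr q) \<kappa> z"
  have k0: "0 \<le> \<kappa> w" for w by (rule mollifierD(2)[OF m])
  note ik = mollifier_reflect(1)[OF m, of z] and k1 = mollifier_reflect(2)[OF m, of z]
  have abs_le: "\<bar>convol h \<kappa> z\<bar> \<le> convol (\<lambda>y. \<bar>h y\<bar>) \<kappa> z" for h
    unfolding convol_def
    using integral_abs_bound[of lborel "\<lambda>y. h y * \<kappa> (z - y)"] by (simp add: abs_mult k0)
  have step: "c * convol (\<lambda>y. \<bar>h y\<bar>) \<kappa> z \<le> ?P + r"
    if h: "integrable lborel h" and hc: "\<And>y. c * \<bar>h y\<bar> \<le> \<bar>g y\<bar> powr q + r" for c r h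
  proof -
    have "c * convol (\<lambda>y. \<bar>h y\<bar>) \<kappa> z = (\<integral>y. c * (\<bar>h y\<bar> * \<kappa> (z - y)) \<partial>lborel)"
      by (simp add: convol_def)
    also have "\<dots> \<le> (\<integral>y. \<bar>g y\<bar> powr q * \<kappa> (z - y) + r * \<kappa> (z - y) \<partial>lborel)"
    proof (rule integral_mono)
      show "integrable lborel (\<lambda>y. c * (\<bar>h y\<bar> * \<kappa> (z - y)))"
        using ci[of "\<lambda>y. \<bar>h y\<bar>"] h by auto
      show "integrable lborel (\<lambda>y. \<bar>g y\<bar> powr q * \<kappa> (z - y) + r * \<kappa> (z - y))"
        using ci[OF P] ik by auto
      show "c * (\<bar>h y\<bar> * \<kappa> (z - y)) \<le> \<bar>g y\<bar> powr q * \<kappa> (z - y) + r * \<kappa> (z - y)" for y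
        using mult_right_mono[OF hc[of y] k0[of "z - y"]] by (simp add: algebra_simps)
    qed
    also have "\<dots> = ?P + r" using ci[OF P] ik k1 by (simp add: convol_def)
    finally show ?thesis .
  qed
  have "\<bar>convol g \<kappa> z\<bar> * convol (\<lambda>y. \<bar>flux q (g y)\<bar>) \<kappa> z \<le> ?P + ?P"
  proof (rule step[OF F])
    fix y
    have "\<bar>flux q (g y)\<bar> * \<bar>convol g \<kappa> z\<bar> \<le> \<bar>flux q (g y)\<bar> * convol (\<lambda>y. \<bar>g y\<bar>) \<kappa> z"
      by (intro mult_left_mono abs_le) auto
    also have "\<dots> \<le> ?P + \<bar>g y\<bar> powr q"
    proof (rule step[OF g])
      fix y'
      show "\<bar>flux q (g y)\<bar> * \<bar>g y'\<bar> \<le> \<bar>g y'\<bar> powr q + \<bar>g y\<bar> powr q"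
        unfolding abs_flux[OF q] using powr_young[of q "\<bar>g y\<bar>" "\<bar>g y'\<bar>"] q by simp
    qed
    finally show "\<bar>convol g \<kappa> z\<bar> * \<bar>flux q (g y)\<bar> \<le> \<bar>g y\<bar> powr q + ?P" by (simp add: mult.commute)
  qed
  moreover have "\<bar>convol g \<kappa> z\<bar> * \<bar>convol (\<lambda>y. flux q (g y)) \<kappa> z\<bar> \<le> \<bar>convol g \<kappa> z\<bar> * convol (\<lambda>y. \<bar>flux q (g y)\<bar>) \<kappa> z"
    by (intro mult_left_mono abs_le) auto
  ultimately show ?thesis by (simp add: abs_mult mult.commute)
qed

lemma convol_bound_one_plus:
  assumes m: "mollifier \<epsilon> \<kappa>" and h: "integrable lborel h" and P: "integrable lborel P"
    and hP: "\<And>y. \<bar>h y\<bar> \<le> 1 + P y"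
  shows "\<bar>convol h \<kappa> z\<bar> \<le> 1 + convol P \<kappa> z"
proof -
  obtain B where B: "\<And>w. \<bar>\<kappa> w\<bar> \<le> B" using mollifier_bounded(1)[OF m] by blast
  note ci = convol_integrand[OF _ mollifierD(6)[OF m] B, of _ z]
  have k0: "0 \<le> \<kappa> w" for w by (rule mollifierD(2)[OF m])
  note ik = mollifier_reflect(1)[OF m, of z] and k1 = mollifier_reflect(2)[OF m, of z]
  have "\<bar>convol h \<kappa> z\<bar> \<le> (\<integral>y. \<bar>h y * \<kappa> (z - y)\<bar> \<partial>lborel)"
    unfolding convol_def by (rule integral_abs_bound)
  also have "\<dots> \<le> (\<integral>y. \<kappa> (z - y) + P y * \<kappa> (z - y) \<partial>lborel)"
  proof (rule integral_mono)
    show "integrable lborel (\<lambda>y. \<bar>h y * \<kappa> (z - y)\<bar>)" using ci[OF h] by (rule integrable_abs)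
    show "integrable lborel (\<lambda>y. \<kappa> (z - y) + P y * \<kappa> (z - y))" using ci[OF P] ik by auto
    show "\<bar>h y * \<kappa> (z - y)\<bar> \<le> \<kappa> (z - y) + P y * \<kappa> (z - y)" for y
      using mult_right_mono[OF hP[of y] k0[of "z - y"]] by (simp add: abs_mult k0 algebra_simps)
  qed
  also have "\<dots> = 1 + convol P \<kappa> z" using ci[OF P] ik k1 by (simp add: convol_def)
  finally show ?thesis .
qed

section \<open>Energy and translation estimates for truncations\<close>

definition truncation :: "real \<Rightarrow> real \<Rightarrow> real" where
  "truncation k s = max 0 (k - s)"

text \<open>Its integral is the weak formulation with test function \<open>v\<^sup>2 * \<zeta>\<close>, where \<open>v = truncation k u\<close>, after
  all derivatives of \<open>v\<close> have been integrated by parts or expressed by \<open>Du\<close>.\<close>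

definition energy_density where
  "energy_density p k u Du \<zeta> \<zeta>' z =
    truncation k (u z) ^ 3 / 3 * \<zeta>' time_dir z +
    (\<Sum>i\<in>UNIV. truncation k (u z) ^ 2 * flux (p i) (Du i z) * \<zeta>' (space_dir i) z
      - 2 * truncation k (u z) * \<bar>Du i z\<bar> powr p i * \<zeta> z)"

text \<open>All that is kept of the equation: the energy inequality for the truncations \<open>v = truncation k u\<close>,
  and a translation estimate for \<open>v\<^sup>2 * \<zeta>\<close>, in which \<open>Du\<close> appears as the gradient of \<open>u\<close>. Both are
  integral inequalities for the pair of \<open>u\<close> and \<open>Du\<close>, so they transform under changes of variables by
  the substitution rule alone.\<close>

definition truncation_estimates ::
  "((real^'n::finite) \<times> real) set \<Rightarrow> ('n \<Rightarrow> real) \<Rightarrow> ((real^'n) \<times> real \<Rightarrow> real) \<Rightarrow> ('n \<Rightarrow> (real^'n) \<times> real \<Rightarrow> real) \<Rightarrow> bool"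
where
  "truncation_estimates U p u Du \<longleftrightarrow>
    u \<in> borel_measurable borel \<and> (\<forall>i. Du i \<in> borel_measurable borel) \<and>
    (\<forall>C i. compact C \<and> C \<subseteq> U \<longrightarrow> integrable lborel (\<lambda>z. indicator C z * \<bar>Du i z\<bar> powr p i)) \<and>
    (\<forall>C k \<zeta> \<zeta>'. C \<subseteq> U \<and> cutoff C \<zeta> \<zeta>' \<longrightarrow>
      integrable lborel (energy_density p k u Du \<zeta> \<zeta>') \<and>
      0 \<le> integral\<^sup>L lborel (energy_density p k u Du \<zeta> \<zeta>') \<and>
      (\<forall>i h. (\<integral>z. \<bar>truncation k (u (z + h *\<^sub>R space_dir i)) ^ 2 * \<zeta> (z + h *\<^sub>R space_dir i)
            - truncation k (u z) ^ 2 * \<zeta> z\<bar> \<partial>lborel)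
          \<le> \<bar>h\<bar> * (\<integral>z. \<bar>truncation k (u z) ^ 2 * \<zeta>' (space_dir i) z
            - 2 * truncation k (u z) * Du i z * \<zeta> z\<bar> \<partial>lborel)))"

lemma space_dir_Basis: "space_dir i \<in> Basis" "time_dir \<in> Basis"
  by (auto simp: Basis_prod_def Basis_vec_def)

text \<open>The limit of the estimates for mollified data. The lower bound of \<open>u\<close> makes the truncations of the
  mollifications uniformly bounded, so the only unbounded factors are the mollified flux \<open>Fn\<close> and
  gradient \<open>gn\<close>. Each of them and their product are bounded by a multiple of one plus the mollification
  \<open>Pn\<close> of \<open>\<bar>Du\<bar> powr p\<close>, which converges in the mean. Along a subsequence everything converges almost
  everywhere, and dominated convergence with varying majorants applies.\<close>

theorem truncation_estimates_supersolution:
  fixes p :: "'n::finite \<Rightarrow> real"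
  assumes ks: "kernel_supersolution U p u Du" and U: "open U" and p: "\<And>i. p i > 2"
    and below: "\<And>C. compact C \<Longrightarrow> C \<subseteq> U \<Longrightarrow> \<exists>m. AE z in lborel. z \<in> C \<longrightarrow> m \<le> u z"
  shows "truncation_estimates U p u Du"
proof -
  have um[measurable]: "u \<in> borel_measurable borel" and Dm[measurable]: "\<And>i. Du i \<in> borel_measurable borel"
    and iu: "\<And>C. compact C \<Longrightarrow> C \<subseteq> U \<Longrightarrow> integrable lborel (\<lambda>z. indicator C z * u z)"
    and iP: "\<And>C i. compact C \<Longrightarrow> C \<subseteq> U \<Longrightarrow> integrable lborel (\<lambda>z. indicator C z * \<bar>Du i z\<bar> powr p i)"
    and ker: "\<And>\<epsilon> \<kappa> z. \<epsilon> > 0 \<Longrightarrow> mollifier \<epsilon> \<kappa> \<Longrightarrow> cball z \<epsilon> \<subseteq> U \<Longrightarrow>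
      0 \<le> convol u (ddir \<kappa> time_dir) z - (\<Sum>i\<in>UNIV. convol (\<lambda>y. flux (p i) (Du i y)) (ddir \<kappa> (space_dir i)) z)"
    and kerD: "\<And>\<epsilon> \<kappa> z i. \<epsilon> > 0 \<Longrightarrow> mollifier \<epsilon> \<kappa> \<Longrightarrow> cball z \<epsilon> \<subseteq> U \<Longrightarrow>
      convol (Du i) \<kappa> z = convol u (ddir \<kappa> (space_dir i)) z"
    using ks unfolding kernel_supersolution_def by auto
  have fm[measurable]: "flux q \<in> borel_measurable borel" for q unfolding flux_def[abs_def] by measurable
  have "integrable lborel (energy_density p k u Du \<zeta> \<zeta>') \<and>
      0 \<le> integral\<^sup>L lborel (energy_density p k u Du \<zeta> \<zeta>') \<and>
      (\<forall>i h. (\<integral>z. \<bar>truncation k (u (z + h *\<^sub>R space_dir i)) ^ 2 * \<zeta> (z + h *\<^sub>R space_dir i)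
            - truncation k (u z) ^ 2 * \<zeta> z\<bar> \<partial>lborel)
          \<le> \<bar>h\<bar> * (\<integral>z. \<bar>truncation k (u z) ^ 2 * \<zeta>' (space_dir i) z
            - 2 * truncation k (u z) * Du i z * \<zeta> z\<bar> \<partial>lborel))"
    if CU: "C \<subseteq> U" and c: "cutoff C \<zeta> \<zeta>'" for C k \<zeta> \<zeta>'
  proof -
    note C = cutoffD(1)[OF c]
    note [measurable] = cutoffD(2)[OF c] cutoffD(8)[OF c space_dir_Basis(1)] cutoffD(8)[OF c space_dir_Basis(2)]
    have [measurable]: "C \<in> sets borel" using C by (rule borel_compact)
    obtain d C' where d: "d > 0" and C': "compact C'" and C'U: "C' \<subseteq> U"
      and ballC': "\<And>z. z \<in> C \<Longrightarrow> cball z d \<subseteq> C'"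
      using compact_neighbourhood[OF C U CU] by blast
    have [measurable]: "C' \<in> sets borel" using C' by (rule borel_compact)
    have CC': "C \<subseteq> C'"
    proof
      fix z assume z: "z \<in> C"
      have "z \<in> cball z d" using d by simp
      then show "z \<in> C'" using ballC'[OF z] by blast
    qed
    obtain m where m: "AE z in lborel. z \<in> C' \<longrightarrow> m \<le> u z" using below[OF C' C'U] by blast
    \<comment> \<open>outside the compact neighbourhood \<open>C'\<close> of \<open>C\<close> the data are replaced by zero, which changes no
      mollification at points of \<open>C\<close>\<close>
    define f where "f z = indicator C' z * u z" for z
    define g where "g i z = indicator C' z * Du i z" for i z
    define F where "F i z = flux (p i) (g i z)" for i z
    define P where "P i z = \<bar>g i z\<bar> powr p i" for i z
    have P_eq: "P i = (\<lambda>z. indicator C' z * \<bar>Du i z\<bar> powr p i)" for i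
      by (auto simp: P_def g_def indicator_def)
    have F_eq: "F i = (\<lambda>z. indicator C' z * flux (p i) (Du i z))" for i
      by (auto simp: F_def g_def indicator_def flux_def)
    have f: "integrable lborel f" unfolding f_def[abs_def] by (rule iu[OF C' C'U])
    have P: "integrable lborel (P i)" for i unfolding P_eq by (rule iP[OF C' C'U])
    have g: "integrable lborel (g i)" for i
      unfolding g_def[abs_def]
      by (rule integrable_dominated_on_compact[OF _ C' iP[OF C' C'U, of i]])
        (use p[of i] in \<open>auto intro!: abs_le_one_plus_powr\<close>)
    have F: "integrable lborel (F i)" for i
      unfolding F_eq
      by (rule integrable_dominated_on_compact[OF _ C' iP[OF C' C'U, of i]])
        (use p[of i] in \<open>auto intro!: flux_bound\<close>)
    note [measurable] = borel_measurable_integrable[OF f] borel_measurable_integrable[OF g]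
      borel_measurable_integrable[OF F] borel_measurable_integrable[OF P]
    have I: "integrable lborel (indicator C' :: _ \<Rightarrow> real)"
      using emeasure_bounded_finite[OF compact_imp_bounded[OF C']] by (intro integrable_real_indicator) auto
    \<comment> \<open>radii at most \<open>d\<close>, so that the kernels centred in \<open>C\<close> are supported in \<open>C'\<close>\<close>
    define \<epsilon> where "\<epsilon> n = d / real (Suc n)" for n
    have \<epsilon>: "0 < \<epsilon> n" "\<epsilon> n \<le> d" for n using d by (auto simp: \<epsilon>_def field_simps)
    have \<epsilon>0: "\<epsilon> \<longlonglongrightarrow> 0" unfolding \<epsilon>_def by (rule inverse_real_Suc_tendsto)
    obtain \<kappa> :: "nat \<Rightarrow> (real^'n) \<times> real \<Rightarrow> real" where \<kappa>: "\<And>n. mollifier (\<epsilon> n) (\<kappa> n)"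
      using smooth_mollifier_exists[OF \<epsilon>(1), where 'a="(real^'n) \<times> real"] unfolding mollifier_def by metis
    have out: "\<kappa> n (z - y) = 0" "ddir (\<kappa> n) e (z - y) = 0" if "z \<in> C" "y \<notin> C'" for n z y e
    proof -
      have "y \<notin> cball z d" using ballC'[OF that(1)] that(2) by blast
      then have "norm (z - y) > \<epsilon> n" using \<epsilon>(2)[of n] by (simp add: dist_norm)
      then show "\<kappa> n (z - y) = 0" "ddir (\<kappa> n) e (z - y) = 0"
        using mollifierD(3)[OF \<kappa>, of n] mollifier_ddir_support[OF \<kappa>, of n] by auto
    qed
    have cb: "cball z (\<epsilon> n) \<subseteq> U" if "z \<in> C" for z n
    proof -
      have "cball z (\<epsilon> n) \<subseteq> cball z d" using \<epsilon>(2)[of n] by (intro subset_cball)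
      then show ?thesis using ballC'[OF that] C'U by blast
    qed
    define fn where "fn n = convol f (\<kappa> n)" for n
    define gn where "gn n i = convol (g i) (\<kappa> n)" for n i
    define Fn where "Fn n i = convol (F i) (\<kappa> n)" for n i
    define Pn where "Pn n i = convol (P i) (\<kappa> n)" for n i
    have mm[measurable]: "fn n \<in> borel_measurable borel" "gn n i \<in> borel_measurable borel"
      "Fn n i \<in> borel_measurable borel" "Pn n i \<in> borel_measurable borel" for n i
      unfolding fn_def gn_def Fn_def Pn_def
      by (auto intro!: convol_measurable mollifierD(10)[OF \<kappa>] simp: borel_measurable_integrable[OF f, simplified]
          borel_measurable_integrable[OF g, simplified] borel_measurable_integrable[OF F, simplified]
          borel_measurable_integrable[OF P, simplified])
    have cong: "convol (\<lambda>y. indicator C' y * w y) (ddir (\<kappa> n) e) z = convol w (ddir (\<kappa> n) e) z"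
      "convol (\<lambda>y. indicator C' y * w y) (\<kappa> n) z = convol w (\<kappa> n) z" if "z \<in> C" for w n e z
      by (rule convol_indicator_cong, rule out, rule that, assumption)+
    have sup: "0 \<le> convol f (ddir (\<kappa> n) time_dir) z - (\<Sum>i\<in>UNIV. convol (F i) (ddir (\<kappa> n) (space_dir i)) z)"
      if z: "z \<in> C" for n z
      using ker[OF \<epsilon>(1)[of n] \<kappa>[of n] cb[OF z]] by (simp add: f_def[abs_def] F_eq cong[OF z])
    have gn_eq: "convol f (ddir (\<kappa> n) (space_dir i)) z = gn n i z" if z: "z \<in> C" for n z i
      using kerD[OF \<epsilon>(1)[of n] \<kappa>[of n] cb[OF z], of i]
      by (simp add: f_def[abs_def] g_def[abs_def] gn_def cong[OF z])
    have fn_ge: "m \<le> fn n z" if z: "z \<in> C" for n z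
    proof -
      have "m = convol (\<lambda>y. indicator C' y * m) (\<kappa> n) z"
      proof -
        have "convol (\<lambda>y. indicator C' y * m) (\<kappa> n) z = convol (\<lambda>_. m) (\<kappa> n) z"
          by (rule cong[OF z])
        also have "\<dots> = m * (\<integral>y. \<kappa> n (z - y) \<partial>lborel)" by (simp add: convol_def)
        also have "(\<integral>y. \<kappa> n (z - y) \<partial>lborel) = 1" by (rule mollifier_reflect(2)[OF \<kappa>])
        finally show ?thesis by simp
      qed
      also have "\<dots> \<le> fn n z"
        unfolding fn_def
      proof (rule convol_mono_AE[OF _ \<kappa> _ f])
        show "AE y in lborel. indicator C' y * m \<le> f y"
          using m by eventually_elim (auto simp: f_def indicator_def)
      qed (use I in simp)
      finally show ?thesis .
    qed
    \<comment> \<open>one sequence \<open>s\<close> bounding all the errors gives a common subsequence\<close>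
    define s where "s n z = \<bar>fn n z - f z\<bar> + (\<Sum>i\<in>UNIV. \<bar>gn n i z - g i z\<bar> + \<bar>Fn n i z - F i z\<bar> + \<bar>Pn n i z - P i z\<bar>)" for n z
    have ci: "integrable lborel (\<lambda>z. \<bar>fn n z - f z\<bar>)" "integrable lborel (\<lambda>z. \<bar>gn n i z - g i z\<bar>)"
      "integrable lborel (\<lambda>z. \<bar>Fn n i z - F i z\<bar>)" "integrable lborel (\<lambda>z. \<bar>Pn n i z - P i z\<bar>)"
      "integrable lborel (Pn n i)" for n i
      unfolding fn_def gn_def Fn_def Pn_def
      by (intro integrable_abs Bochner_Integration.integrable_diff convol_integrable[OF _ \<kappa>] f g F P)+
    have si: "integrable lborel (s n)" for n
      unfolding s_def
      by (intro Bochner_Integration.integrable_add Bochner_Integration.integrable_sum ci)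
    have cl: "(\<lambda>n. \<integral>z. \<bar>fn n z - f z\<bar> \<partial>lborel) \<longlonglongrightarrow> 0" "(\<lambda>n. \<integral>z. \<bar>gn n i z - g i z\<bar> \<partial>lborel) \<longlonglongrightarrow> 0"
      "(\<lambda>n. \<integral>z. \<bar>Fn n i z - F i z\<bar> \<partial>lborel) \<longlonglongrightarrow> 0" "(\<lambda>n. \<integral>z. \<bar>Pn n i z - P i z\<bar> \<partial>lborel) \<longlonglongrightarrow> 0" for i
      unfolding fn_def gn_def Fn_def Pn_def by (intro convol_L1_tendsto[OF _ \<kappa> \<epsilon>0] f g F P)+
    have s_int: "(\<integral>z. norm (s n z) \<partial>lborel) = (\<integral>z. \<bar>fn n z - f z\<bar> \<partial>lborel) +
        (\<Sum>i\<in>UNIV. (\<integral>z. \<bar>gn n i z - g i z\<bar> \<partial>lborel) + (\<integral>z. \<bar>Fn n i z - F i z\<bar> \<partial>lborel) + (\<integral>z. \<bar>Pn n i z - P i z\<bar> \<partial>lborel))" for n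
    proof -
      have "norm (s n z) = s n z" for z unfolding s_def real_norm_def by (intro abs_of_nonneg add_nonneg_nonneg sum_nonneg) auto
      then show ?thesis
        using ci by (simp add: s_def Bochner_Integration.integral_add Bochner_Integration.integral_sum)
    qed
    have "(\<lambda>n. \<integral>z. norm (s n z) \<partial>lborel) \<longlonglongrightarrow> 0 + (\<Sum>i\<in>(UNIV::'n set). 0 + 0 + 0)"
      unfolding s_int by (intro tendsto_add tendsto_sum cl)
    then have "(\<lambda>n. \<integral>z. norm (s n z) \<partial>lborel) \<longlonglongrightarrow> 0" by simp
    from tendsto_L1_AE_subseq[OF si this]
    obtain r :: "nat \<Rightarrow> nat" where r: "strict_mono r" "AE z in lborel. (\<lambda>n. s (r n) z) \<longlonglongrightarrow> 0" by blast
    have s_ge: "\<bar>fn n z - f z\<bar> \<le> s n z" "\<bar>gn n i z - g i z\<bar> \<le> s n z" "\<bar>Fn n i z - F i z\<bar> \<le> s n z" "\<bar>Pn n i z - P i z\<bar> \<le> s n z" for n i z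
    proof -
      have "\<bar>gn n i z - g i z\<bar> + \<bar>Fn n i z - F i z\<bar> + \<bar>Pn n i z - P i z\<bar>
        \<le> (\<Sum>i\<in>UNIV. \<bar>gn n i z - g i z\<bar> + \<bar>Fn n i z - F i z\<bar> + \<bar>Pn n i z - P i z\<bar>)"
        by (rule member_le_sum) auto
      then show "\<bar>fn n z - f z\<bar> \<le> s n z" "\<bar>gn n i z - g i z\<bar> \<le> s n z" "\<bar>Fn n i z - F i z\<bar> \<le> s n z" "\<bar>Pn n i z - P i z\<bar> \<le> s n z"
        unfolding s_def by (auto simp: abs_if split: if_splits)
    qed
    have lims: "AE z in lborel. (\<lambda>n. fn (r n) z) \<longlonglongrightarrow> f z \<and> (\<forall>i. (\<lambda>n. gn (r n) i z) \<longlonglongrightarrow> g i z \<and>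
        (\<lambda>n. Fn (r n) i z) \<longlonglongrightarrow> F i z \<and> (\<lambda>n. Pn (r n) i z) \<longlonglongrightarrow> P i z)"
      using r(2)
    proof eventually_elim
      case (elim z)
      have seq: "(\<lambda>n. x (r n)) \<longlonglongrightarrow> l" if "\<And>n. \<bar>x n - l\<bar> \<le> s n z" for x l
        by (rule LIM_zero_cancel, rule Lim_null_comparison[OF _ elim]) (use that in auto)
      show ?case by (intro conjI allI; rule seq; rule s_ge)
    qed
    \<comment> \<open>\<open>B\<close> bounds the cutoff function and its derivatives, \<open>M\<close> the truncations on \<open>C\<close>\<close>
    obtain B where B: "B \<ge> 0" "\<And>z. \<zeta> z \<le> B" "\<And>z. \<bar>\<zeta>' time_dir z\<bar> \<le> B" "\<And>i z. \<bar>\<zeta>' (space_dir i) z\<bar> \<le> B"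
    proof -
      obtain B0 where B0: "\<And>z. \<bar>\<zeta> z\<bar> \<le> B0" using cutoffD(5)[OF c] by (auto simp: bounded_fun_def)
      obtain B1 where B1: "\<And>z. \<bar>\<zeta>' time_dir z\<bar> \<le> B1" using cutoffD(7)[OF c space_dir_Basis(2)] by (auto simp: bounded_fun_def)
      have "\<forall>i. \<exists>B. \<forall>z. \<bar>\<zeta>' (space_dir i) z\<bar> \<le> B"
        using cutoffD(7)[OF c space_dir_Basis(1)] by (auto simp: bounded_fun_def)
      then obtain B2 where B2: "\<And>i z. \<bar>\<zeta>' (space_dir i) z\<bar> \<le> B2 i" by metis
      have B2': "B2 i \<le> (\<Sum>i\<in>UNIV. \<bar>B2 i\<bar>)" for i
        using member_le_sum[of i UNIV "\<lambda>i. \<bar>B2 i\<bar>"] by simp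
      have S0: "0 \<le> (\<Sum>i\<in>UNIV. \<bar>B2 i\<bar>)" by (intro sum_nonneg) auto
      show thesis
      proof (rule that[of "\<bar>B0\<bar> + \<bar>B1\<bar> + (\<Sum>i\<in>UNIV. \<bar>B2 i\<bar>)"])
        show "\<zeta> z \<le> \<bar>B0\<bar> + \<bar>B1\<bar> + (\<Sum>i\<in>UNIV. \<bar>B2 i\<bar>)" for z using B0[of z] S0 by linarith
        show "\<bar>\<zeta>' time_dir z\<bar> \<le> \<bar>B0\<bar> + \<bar>B1\<bar> + (\<Sum>i\<in>UNIV. \<bar>B2 i\<bar>)" for z using B1[of z] S0 by linarith
        show "\<bar>\<zeta>' (space_dir i) z\<bar> \<le> \<bar>B0\<bar> + \<bar>B1\<bar> + (\<Sum>i\<in>UNIV. \<bar>B2 i\<bar>)" for i z using B2[of i z] B2'[of i] by linarith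
      qed (use S0 in linarith)
    qed
    define M where "M = max 0 (k - m)"
    have M0: "0 \<le> M" by (simp add: M_def)
    define V where "V n z = truncation k (fn n z)" for n z
    define v where "v z = truncation k (f z)" for z
    have V0: "0 \<le> V n z" for n z by (simp add: V_def truncation_def)
    have VM: "V n z \<le> M" if "z \<in> C" for n z
      using fn_ge[OF that, of n] by (auto simp: V_def M_def truncation_def)
    have vM: "AE z in lborel. z \<in> C' \<longrightarrow> v z \<le> M"
      using m by eventually_elim (auto simp: v_def M_def truncation_def f_def)
    have v0: "0 \<le> v z" for z by (simp add: v_def truncation_def)
    have tm[measurable]: "truncation k \<in> borel_measurable borel" unfolding truncation_def[abs_def] by measurable
    have [measurable]: "V n \<in> borel_measurable borel" "v \<in> borel_measurable borel" for n
      unfolding V_def[abs_def] v_def[abs_def] by measurable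
    have Vlim: "(\<lambda>n. V (r n) z) \<longlonglongrightarrow> v z" if "(\<lambda>n. fn (r n) z) \<longlonglongrightarrow> f z" for z
      unfolding V_def v_def truncation_def by (intro tendsto_intros that)
    define N where "N = real CARD('n)"
    \<comment> \<open>large enough for the integrands of the energy and of the translation inequality alike\<close>
    define K where "K = M^3 * B + (4 * M * B + M^2 * B) + N * (2 * M * B + M^2 * B)"
    define Hn where "Hn n z = K * (indicator C' z + (\<Sum>i\<in>UNIV. Pn n i z))" for n z
    define H where "H z = K * (indicator C' z + (\<Sum>i\<in>UNIV. P i z))" for z
    have K0: "0 \<le> K" using M0 B(1) by (auto simp: K_def N_def)
    have Hi: "integrable lborel (Hn n)" "integrable lborel H" for n
      unfolding Hn_def H_def
      by (intro integrable_mult_right Bochner_Integration.integrable_add Bochner_Integration.integrable_sum I ci P)+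
    have Hlim: "AE z in lborel. (\<lambda>n. Hn (r n) z) \<longlonglongrightarrow> H z"
      using lims by eventually_elim (unfold Hn_def H_def, intro tendsto_intros, auto)
    have HL1: "(\<lambda>n. \<integral>z. \<bar>Hn (r n) z - H z\<bar> \<partial>lborel) \<longlonglongrightarrow> 0"
    proof -
      have "(\<lambda>n. \<integral>z. \<bar>Hn n z - H z\<bar> \<partial>lborel) \<longlonglongrightarrow> 0"
      proof (rule Lim_null_comparison[OF always_eventually, rule_format])
        fix n
        have "(\<integral>z. \<bar>Hn n z - H z\<bar> \<partial>lborel) \<le> (\<integral>z. K * (\<Sum>i\<in>UNIV. \<bar>Pn n i z - P i z\<bar>) \<partial>lborel)"
        proof (rule integral_mono)
          show "integrable lborel (\<lambda>z. \<bar>Hn n z - H z\<bar>)" using Hi by auto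
          show "integrable lborel (\<lambda>z. K * (\<Sum>i\<in>UNIV. \<bar>Pn n i z - P i z\<bar>))"
            by (intro integrable_mult_right Bochner_Integration.integrable_sum ci)
          fix z
          have "\<bar>Hn n z - H z\<bar> = K * \<bar>\<Sum>i\<in>UNIV. Pn n i z - P i z\<bar>"
            using K0 by (simp add: Hn_def H_def abs_mult sum_subtractf flip: right_diff_distrib)
          also have "\<dots> \<le> K * (\<Sum>i\<in>UNIV. \<bar>Pn n i z - P i z\<bar>)"
            by (intro mult_left_mono K0 sum_abs)
          finally show "\<bar>Hn n z - H z\<bar> \<le> K * (\<Sum>i\<in>UNIV. \<bar>Pn n i z - P i z\<bar>)" .
        qed
        also have "\<dots> = K * (\<Sum>i\<in>UNIV. \<integral>z. \<bar>Pn n i z - P i z\<bar> \<partial>lborel)"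
          using ci by (simp add: Bochner_Integration.integral_sum)
        finally show "norm (\<integral>z. \<bar>Hn n z - H z\<bar> \<partial>lborel) \<le> K * (\<Sum>i\<in>UNIV. \<integral>z. \<bar>Pn n i z - P i z\<bar> \<partial>lborel)"
          by simp
      next
        have "(\<lambda>n. K * (\<Sum>i\<in>UNIV. \<integral>z. \<bar>Pn n i z - P i z\<bar> \<partial>lborel)) \<longlonglongrightarrow> K * (\<Sum>i\<in>(UNIV::'n set). 0)"
          by (intro tendsto_mult tendsto_const tendsto_sum cl)
        then show "(\<lambda>n. K * (\<Sum>i\<in>UNIV. \<integral>z. \<bar>Pn n i z - P i z\<bar> \<partial>lborel)) \<longlonglongrightarrow> 0" by simp
      qed
      from LIMSEQ_subseq_LIMSEQ[OF this r(1)] show ?thesis by (simp add: comp_def)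
    qed
    have Fg: "\<bar>Fn n i z * gn n i z\<bar> \<le> 2 * Pn n i z" for n i z
      unfolding Fn_def gn_def Pn_def F_def[abs_def] P_def[abs_def]
      by (rule convol_flux_bound[OF p \<kappa> g P[unfolded P_def[abs_def]] F[unfolded F_def[abs_def]]])
    have F1: "\<bar>Fn n i z\<bar> \<le> 1 + Pn n i z" for n i z
      unfolding Fn_def Pn_def
      by (rule convol_bound_one_plus[OF \<kappa> F P]) (auto simp: F_def P_def intro!: flux_bound[OF p])
    have g1: "\<bar>gn n i z\<bar> \<le> 1 + Pn n i z" for n i z
      unfolding gn_def Pn_def
      by (rule convol_bound_one_plus[OF \<kappa> g P]) (use p[of i] in \<open>auto simp: P_def intro!: abs_le_one_plus_powr\<close>)
    have Pn0: "0 \<le> Pn n i z" for n i z using Fg[of n i z] by linarith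
    have V_le: "V n z ^ 3 \<le> M ^ 3" "V n z ^ 2 \<le> M ^ 2" if "z \<in> C" for n z
      using V0[of n z] VM[OF that, of n] by (auto intro: power_mono)
    \<comment> \<open>\<open>X n\<close> is the integrand of the energy inequality for the mollified data; on \<open>C\<close> the product
      \<open>Fn * gn\<close> is controlled by \<open>convol_flux_bound\<close>\<close>
    define X where "X n z = V n z ^ 3 / 3 * \<zeta>' time_dir z +
      (\<Sum>i\<in>UNIV. Fn n i z * (V n z ^ 2 * \<zeta>' (space_dir i) z - 2 * V n z * gn n i z * \<zeta> z))" for n z
    define X0 where "X0 z = v z ^ 3 / 3 * \<zeta>' time_dir z +
      (\<Sum>i\<in>UNIV. F i z * (v z ^ 2 * \<zeta>' (space_dir i) z - 2 * v z * g i z * \<zeta> z))" for z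
    have X_eq: "X n = (\<lambda>z. max 0 (k - convol f (\<kappa> n) z) ^ 3 / 3 * \<zeta>' time_dir z +
      (\<Sum>i\<in>UNIV. convol (F i) (\<kappa> n) z * (max 0 (k - convol f (\<kappa> n) z) ^ 2 * \<zeta>' (space_dir i) z
        - 2 * max 0 (k - convol f (\<kappa> n) z) * convol f (ddir (\<kappa> n) (space_dir i)) z * \<zeta> z)))" for n
    proof
      fix z
      show "X n z = max 0 (k - convol f (\<kappa> n) z) ^ 3 / 3 * \<zeta>' time_dir z +
      (\<Sum>i\<in>UNIV. convol (F i) (\<kappa> n) z * (max 0 (k - convol f (\<kappa> n) z) ^ 2 * \<zeta>' (space_dir i) z
        - 2 * max 0 (k - convol f (\<kappa> n) z) * convol f (ddir (\<kappa> n) (space_dir i)) z * \<zeta> z))"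
        using gn_eq[of z n] cutoffD(4)[OF c, of z] by (cases "z \<in> C") (auto simp: X_def V_def truncation_def fn_def Fn_def)
    qed
    have Xdom: "\<bar>X n z\<bar> \<le> Hn n z" for n z
    proof (cases "z \<in> C")
      case False
      then have "X n z = 0" using cutoffD(4)[OF c False] cutoffD(9)[OF c space_dir_Basis(1) False] cutoffD(9)[OF c space_dir_Basis(2) False]
        by (simp add: X_def)
      then show ?thesis using K0 Pn0 by (auto simp: Hn_def intro!: mult_nonneg_nonneg add_nonneg_nonneg sum_nonneg Pn0)
    next
      case True
      have V30: "0 \<le> V n z ^ 3" using V0 by simp
      have "\<bar>V n z ^ 3 / 3 * \<zeta>' time_dir z\<bar> = V n z ^ 3 / 3 * \<bar>\<zeta>' time_dir z\<bar>"
        using V30 by (simp add: abs_mult)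
      also have "\<dots> \<le> M ^ 3 * B"
      proof (rule mult_mono)
        show "V n z ^ 3 / 3 \<le> M ^ 3" using V_le(1)[OF True, of n] V30 by linarith
      qed (use M0 B in auto)
      finally have t1: "\<bar>V n z ^ 3 / 3 * \<zeta>' time_dir z\<bar> \<le> M ^ 3 * B" .
      have t2: "\<bar>Fn n i z * (V n z ^ 2 * \<zeta>' (space_dir i) z - 2 * V n z * gn n i z * \<zeta> z)\<bar>
          \<le> M^2 * B + (4 * M * B + M^2 * B) * Pn n i z" for i
      proof -
        have "\<bar>Fn n i z * (V n z ^ 2 * \<zeta>' (space_dir i) z - 2 * V n z * gn n i z * \<zeta> z)\<bar>
          = \<bar>Fn n i z * (V n z ^ 2 * \<zeta>' (space_dir i) z) - (Fn n i z * gn n i z) * (2 * V n z * \<zeta> z)\<bar>"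
          by (simp add: algebra_simps)
        also have "\<dots> \<le> \<bar>Fn n i z\<bar> * (V n z ^ 2 * \<bar>\<zeta>' (space_dir i) z\<bar>) + \<bar>Fn n i z * gn n i z\<bar> * (2 * V n z * \<zeta> z)"
          using V0[of n z] cutoffD(3)[OF c, of z]
          by (intro order_trans[OF abs_triangle_ineq4]) (simp add: abs_mult)
        also have "\<dots> \<le> (1 + Pn n i z) * (M^2 * B) + (2 * Pn n i z) * (2 * M * B)"
          using V0[of n z] cutoffD(3)[OF c, of z] V_le(2)[OF True, of n] VM[OF True, of n] B M0 Pn0[of n i z]
          by (intro add_mono mult_mono F1 Fg) auto
        finally show ?thesis by (simp add: algebra_simps)
      qed
      have "\<bar>X n z\<bar> \<le> M ^ 3 * B + (\<Sum>i\<in>(UNIV::'n set). M^2 * B + (4 * M * B + M^2 * B) * Pn n i z)"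
        unfolding X_def
        by (intro order_trans[OF abs_triangle_ineq] add_mono t1 order_trans[OF sum_abs] sum_mono t2)
      also have "\<dots> = M ^ 3 * B + N * (M^2 * B) + (4 * M * B + M^2 * B) * (\<Sum>i\<in>UNIV. Pn n i z)"
        by (simp add: sum.distrib N_def sum_distrib_left)
      also have "\<dots> \<le> K * 1 + K * (\<Sum>i\<in>UNIV. Pn n i z)"
        using M0 B(1) Pn0 by (intro add_mono mult_right_mono sum_nonneg) (auto simp: K_def N_def algebra_simps)
      also have "\<dots> = Hn n z" using True CC' by (auto simp: Hn_def algebra_simps)
      finally show ?thesis .
    qed
    have Xlim: "AE z in lborel. (\<lambda>n. X (r n) z) \<longlonglongrightarrow> X0 z"
      using lims
    proof eventually_elim
      case (elim z)
      show ?case unfolding X_def X0_def by (intro tendsto_intros Vlim) (use elim in auto)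
    qed
    have Xm: "X n \<in> borel_measurable lborel" "X0 \<in> borel_measurable lborel" for n
      unfolding X_def[abs_def] X0_def[abs_def] by measurable
    note DX = dominated_convergence_varying[OF Xm Hi Xlim Hlim AE_I2[OF Xdom] HL1]
    have "0 \<le> (\<integral>z. X (r n) z \<partial>lborel)" for n
      using mollified_estimates(1)[OF f F \<kappa>[of "r n"] c space_dir_Basis(2) space_dir_Basis(1) sup[where n="r n"], where k=k]
        DX(2)[of n] unfolding X_eq by blast
    then have E2: "0 \<le> integral\<^sup>L lborel X0" by (intro LIMSEQ_le_const[OF DX(3)]) auto
    have X0_eq: "X0 = energy_density p k u Du \<zeta> \<zeta>'"
    proof
      fix z
      show "X0 z = energy_density p k u Du \<zeta> \<zeta>' z"
      proof (cases "z \<in> C")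
        case False
        then show ?thesis
          using cutoffD(4)[OF c False] cutoffD(9)[OF c space_dir_Basis(1) False] cutoffD(9)[OF c space_dir_Basis(2) False]
          by (simp add: X0_def energy_density_def)
      next
        case True
        then have zC': "z \<in> C'" using CC' by auto
        have "F i z * (v z ^ 2 * \<zeta>' (space_dir i) z - 2 * v z * g i z * \<zeta> z)
          = v z ^ 2 * F i z * \<zeta>' (space_dir i) z - 2 * v z * (F i z * g i z) * \<zeta> z" for i
          by (simp add: algebra_simps)
        then show ?thesis
          using zC' by (simp add: X0_def energy_density_def v_def f_def F_def g_def flux_mult[OF p])
      qed
    qed
    \<comment> \<open>the left-hand side of the translation inequality passes to the limit because \<open>w n\<close> is uniformly
      bounded with support in \<open>C\<close>\<close>
    have tr: "(\<integral>z. \<bar>truncation k (u (z + h *\<^sub>R space_dir i)) ^ 2 * \<zeta> (z + h *\<^sub>R space_dir i)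
            - truncation k (u z) ^ 2 * \<zeta> z\<bar> \<partial>lborel)
          \<le> \<bar>h\<bar> * (\<integral>z. \<bar>truncation k (u z) ^ 2 * \<zeta>' (space_dir i) z
            - 2 * truncation k (u z) * Du i z * \<zeta> z\<bar> \<partial>lborel)" for i h
    proof -
      define w where "w n z = V n z ^ 2 * \<zeta> z" for n z
      define w0 where "w0 z = v z ^ 2 * \<zeta> z" for z
      have w0_eq: "w0 z = truncation k (u z) ^ 2 * \<zeta> z" for z
        using cutoffD(4)[OF c, of z] CC' by (cases "z \<in> C") (auto simp: w0_def v_def f_def)
      have [measurable]: "w n \<in> borel_measurable borel" "w0 \<in> borel_measurable borel" for n
        unfolding w_def[abs_def] w0_def[abs_def] by measurable
      define Q where "Q n z = \<bar>V n z ^ 2 * \<zeta>' (space_dir i) z - 2 * V n z * gn n i z * \<zeta> z\<bar>" for n z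
      define Q0 where "Q0 z = \<bar>v z ^ 2 * \<zeta>' (space_dir i) z - 2 * v z * g i z * \<zeta> z\<bar>" for z
      have Q_eq: "Q n z = \<bar>max 0 (k - convol f (\<kappa> n) z) ^ 2 * \<zeta>' (space_dir i) z
          - 2 * max 0 (k - convol f (\<kappa> n) z) * convol f (ddir (\<kappa> n) (space_dir i)) z * \<zeta> z\<bar>" for n z
        using gn_eq[of z n] cutoffD(4)[OF c, of z] by (cases "z \<in> C") (auto simp: Q_def V_def truncation_def fn_def)
      have Q0_eq: "Q0 z = \<bar>truncation k (u z) ^ 2 * \<zeta>' (space_dir i) z
            - 2 * truncation k (u z) * Du i z * \<zeta> z\<bar>" for z
        using cutoffD(4)[OF c, of z] cutoffD(9)[OF c space_dir_Basis(1), of z i] CC'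
        by (cases "z \<in> C") (auto simp: Q0_def v_def f_def g_def)
      have Qdom: "\<bar>Q n z\<bar> \<le> Hn n z" for n z
      proof (cases "z \<in> C")
        case False
        then have "Q n z = 0" using cutoffD(4)[OF c False] cutoffD(9)[OF c space_dir_Basis(1) False]
          by (simp add: Q_def)
        then show ?thesis using K0 Pn0 by (auto simp: Hn_def intro!: mult_nonneg_nonneg add_nonneg_nonneg sum_nonneg Pn0)
      next
        case True
        have "\<bar>Q n z\<bar> \<le> V n z ^ 2 * \<bar>\<zeta>' (space_dir i) z\<bar> + \<bar>gn n i z\<bar> * (2 * V n z * \<zeta> z)"
          unfolding Q_def abs_abs using V0[of n z] cutoffD(3)[OF c, of z]
          by (intro order_trans[OF abs_triangle_ineq4]) (simp add: abs_mult)
        also have "\<dots> \<le> M^2 * B + (1 + Pn n i z) * (2 * M * B)"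
          using V0[of n z] cutoffD(3)[OF c, of z] V_le(2)[OF True, of n] VM[OF True, of n] B M0 Pn0[of n i z]
          by (intro add_mono mult_mono g1) auto
        also have "\<dots> = (2 * M * B + M^2 * B) + 2 * M * B * Pn n i z" by (simp add: algebra_simps)
        also have "\<dots> \<le> K * 1 + K * (\<Sum>i\<in>UNIV. Pn n i z)"
        proof (intro add_mono mult_mono)
          define t where "t = N * (2 * M * B + M^2 * B)"
          have "K = M^3 * B + (4 * (M * B) + M^2 * B) + t" by (simp add: K_def t_def mult.assoc)
          moreover have "0 \<le> t" "0 \<le> M^3 * B" "0 \<le> M * B" "0 \<le> M^2 * B"
            using M0 B(1) by (auto simp: t_def N_def)
          moreover have "2 * M * B = 2 * (M * B)" by simp
          ultimately have "2 * M * B + M^2 * B \<le> K" "2 * M * B \<le> K" by linarith+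
          then show "2 * M * B + M^2 * B \<le> K * 1" "2 * M * B \<le> K" by auto
          show "Pn n i z \<le> (\<Sum>i\<in>UNIV. Pn n i z)" by (rule member_le_sum) (auto simp: Pn0)
        qed (use K0 Pn0 in auto)
        also have "\<dots> = Hn n z" using True CC' by (auto simp: Hn_def algebra_simps)
        finally show ?thesis .
      qed
      have Qlim: "AE z in lborel. (\<lambda>n. Q (r n) z) \<longlonglongrightarrow> Q0 z"
        using lims
      proof eventually_elim
        case (elim z)
        show ?case unfolding Q_def Q0_def by (intro tendsto_intros Vlim) (use elim in auto)
      qed
      have Qm: "Q n \<in> borel_measurable lborel" "Q0 \<in> borel_measurable lborel" for n
        unfolding Q_def[abs_def] Q0_def[abs_def] by measurable
      note DQ = dominated_convergence_varying[OF Qm Hi Qlim Hlim AE_I2[OF Qdom] HL1]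
      have ID: "integrable lborel (\<lambda>z. M\<^sup>2 * B * indicator C' z :: real)" using I by simp
      have wdom: "\<bar>w n z\<bar> \<le> M\<^sup>2 * B * indicator C' z" for n z
      proof (cases "z \<in> C")
        case True
        then show ?thesis
          using mult_mono[OF V_le(2)[OF True, of n] B(2)[of z]] cutoffD(3)[OF c, of z] CC'
          by (auto simp: w_def abs_mult)
      qed (use cutoffD(4)[OF c, of z] B(1) in \<open>auto simp: w_def\<close>)
      have w0dom: "AE z in lborel. \<bar>w0 z\<bar> \<le> M\<^sup>2 * B * indicator C' z"
        using vM
      proof eventually_elim
        case (elim z)
        show ?case
        proof (cases "z \<in> C")
          case True
          then have "v z \<le> M" using elim CC' by auto
          then have "v z ^ 2 \<le> M ^ 2" using v0 by (intro power_mono)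
          then have "v z ^ 2 * \<zeta> z \<le> M ^ 2 * B" using B(1) B(2)[of z] cutoffD(3)[OF c, of z] by (intro mult_mono) auto
          then show ?thesis using cutoffD(3)[OF c, of z] CC' True by (auto simp: w0_def abs_mult)
        qed (use cutoffD(4)[OF c, of z] B(1) in \<open>auto simp: w0_def\<close>)
      qed
      have wi: "integrable lborel (w n)" for n
        by (rule Bochner_Integration.integrable_bound[OF ID]) (auto intro!: AE_I2 order_trans[OF wdom abs_ge_self])
      have w0i: "integrable lborel w0"
        by (rule Bochner_Integration.integrable_bound[OF ID])
          (use w0dom in \<open>auto elim!: eventually_mono intro: order_trans[OF _ abs_ge_self]\<close>)
      have "(\<lambda>n. \<integral>z. \<bar>w (r n) z - w0 z\<bar> \<partial>lborel) \<longlonglongrightarrow> (\<integral>z. 0 \<partial>(lborel::((real^'n)\<times>real) measure))"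
      proof (rule integral_dominated_convergence[where w="\<lambda>z. 2 * (M\<^sup>2 * B * indicator C' z)"])
        show "AE z in lborel. (\<lambda>n. \<bar>w (r n) z - w0 z\<bar>) \<longlonglongrightarrow> 0"
          using lims
        proof eventually_elim
          case (elim z)
          have "(\<lambda>n. \<bar>w (r n) z - w0 z\<bar>) \<longlonglongrightarrow> \<bar>w0 z - w0 z\<bar>"
            unfolding w_def w0_def by (intro tendsto_intros Vlim) (use elim in auto)
          then show ?case by simp
        qed
        show "AE z in lborel. norm \<bar>w (r n) z - w0 z\<bar> \<le> 2 * (M\<^sup>2 * B * indicator C' z)" for n
          using w0dom
        proof eventually_elim
          case (elim z)
          then show ?case using wdom[of "r n" z] by (simp add: abs_le_iff)
        qed
      qed (use ID in auto)
      then have w_lim: "(\<lambda>n. \<integral>z. \<bar>w (r n) z - w0 z\<bar> \<partial>lborel) \<longlonglongrightarrow> 0" by simp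
      let ?e = "h *\<^sub>R space_dir i :: (real^'n) \<times> real"
      have le: "(\<integral>z. \<bar>w0 (z + ?e) - w0 z\<bar> \<partial>lborel)
        \<le> 2 * (\<integral>z. \<bar>w (r n) z - w0 z\<bar> \<partial>lborel) + \<bar>h\<bar> * (\<integral>z. Q (r n) z \<partial>lborel)" for n
      proof -
        note sh = integrable_lborel_shift[OF wi, of "r n" ?e] integrable_lborel_shift[OF w0i, of ?e] wi[of "r n"] w0i
        have "(\<integral>z. \<bar>w0 (z + ?e) - w0 z\<bar> \<partial>lborel)
          \<le> (\<integral>z. \<bar>w (r n) (z + ?e) - w0 (z + ?e)\<bar> + \<bar>w (r n) z - w0 z\<bar> + \<bar>w (r n) (z + ?e) - w (r n) z\<bar> \<partial>lborel)"
        proof (rule integral_mono)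
          show "integrable lborel (\<lambda>z. \<bar>w0 (z + ?e) - w0 z\<bar>)"
            by (intro integrable_abs Bochner_Integration.integrable_diff sh)
          show "integrable lborel (\<lambda>z. \<bar>w (r n) (z + ?e) - w0 (z + ?e)\<bar> + \<bar>w (r n) z - w0 z\<bar> + \<bar>w (r n) (z + ?e) - w (r n) z\<bar>)"
            by (intro Bochner_Integration.integrable_add integrable_abs Bochner_Integration.integrable_diff sh)
        qed linarith
        also have "\<dots> = (\<integral>z. \<bar>w (r n) (z + ?e) - w0 (z + ?e)\<bar> \<partial>lborel) + (\<integral>z. \<bar>w (r n) z - w0 z\<bar> \<partial>lborel)
            + (\<integral>z. \<bar>w (r n) (z + ?e) - w (r n) z\<bar> \<partial>lborel)"
          using sh by simp
        also have "(\<integral>z. \<bar>w (r n) (z + ?e) - w0 (z + ?e)\<bar> \<partial>lborel) = (\<integral>z. \<bar>w (r n) z - w0 z\<bar> \<partial>lborel)"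
          by (rule integral_lborel_shift) measurable
        also have "(\<integral>z. \<bar>w (r n) (z + ?e) - w (r n) z\<bar> \<partial>lborel) \<le> \<bar>h\<bar> * (\<integral>z. Q (r n) z \<partial>lborel)"
          using mollified_estimates(2)[OF f F \<kappa>[of "r n"] c space_dir_Basis(2) space_dir_Basis(1) sup[where n="r n"], where k=k and h=h and i=i]
          unfolding Q_eq w_def V_def truncation_def fn_def .
        finally show ?thesis by simp
      qed
      have "(\<lambda>n. 2 * (\<integral>z. \<bar>w (r n) z - w0 z\<bar> \<partial>lborel) + \<bar>h\<bar> * (\<integral>z. Q (r n) z \<partial>lborel))
          \<longlonglongrightarrow> 2 * 0 + \<bar>h\<bar> * (\<integral>z. Q0 z \<partial>lborel)"
        by (intro tendsto_intros w_lim DQ(3))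
      then have "(\<integral>z. \<bar>w0 (z + ?e) - w0 z\<bar> \<partial>lborel) \<le> 2 * 0 + \<bar>h\<bar> * (\<integral>z. Q0 z \<partial>lborel)"
        by (rule LIMSEQ_le_const) (use le in auto)
      then show ?thesis by (simp add: w0_eq Q0_eq)
    qed
    show ?thesis using DX(1) E2 tr unfolding X0_eq by blast
  qed
  then show ?thesis
    unfolding truncation_estimates_def using um Dm iP by blast
qed

section \<open>Anisotropic scaling\<close>

definition diag :: "('a::euclidean_space \<Rightarrow> real) \<Rightarrow> 'a \<Rightarrow> 'a" where
  "diag c z = (\<Sum>b\<in>Basis. (c b * (z \<bullet> b)) *\<^sub>R b)"

lemma diag_add: "diag c (x + y) = diag c x + diag c y"
  by (simp add: diag_def inner_add_left distrib_left scaleR_add_left sum.distrib)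

lemma diag_minus: "diag c (- x) = - diag c x"
  by (simp add: diag_def sum_negf)

lemma diag_inner: "b \<in> Basis \<Longrightarrow> diag c z \<bullet> b = c b * (z \<bullet> b)"
  unfolding diag_def by (simp add: inner_sum_left inner_Basis if_distrib[of "\<lambda>x. _ * x"] cong: if_cong)

lemma diag_Basis: "b \<in> Basis \<Longrightarrow> diag c (h *\<^sub>R b) = (c b * h) *\<^sub>R b"
  by (rule euclidean_eqI) (auto simp: diag_inner inner_Basis)

lemma diag_diag: "(\<And>b. b \<in> Basis \<Longrightarrow> c b * d b = 1) \<Longrightarrow> diag c (diag d z) = z"
  by (rule euclidean_eqI) (simp add: diag_inner flip: mult.assoc)

lemma continuous_on_diag: "continuous_on S (\<lambda>z. a + diag c z)"
  unfolding diag_def by (intro continuous_intros)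

lemma diag_measurable[measurable]: "diag c \<in> borel_measurable borel"
  unfolding diag_def[abs_def] by measurable

lemma
  fixes f :: "'a::euclidean_space \<Rightarrow> real" and a :: 'a
  assumes c: "\<And>b. b \<in> Basis \<Longrightarrow> c b > 0" and [measurable]: "f \<in> borel_measurable borel"
  defines "J \<equiv> \<Prod>b\<in>Basis. c b"
  shows integral_diag: "integral\<^sup>L lborel f = J * (\<integral>z. f (a + diag c z) \<partial>lborel)"
    and integrable_diag: "integrable lborel f \<longleftrightarrow> integrable lborel (\<lambda>z. f (a + diag c z))"
    and nn_integral_diag: "\<And>g. g \<in> borel_measurable borel \<Longrightarrow>
      (\<integral>\<^sup>+z. g z \<partial>lborel) = ennreal J * (\<integral>\<^sup>+z. g (a + diag c z) \<partial>lborel)"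
proof -
  have J: "J > 0" unfolding J_def using c by (intro prod_pos) auto
  have J': "(\<Prod>b\<in>Basis. \<bar>c b\<bar>) = J"
    unfolding J_def using c by (intro prod.cong) (auto intro: abs_of_pos)
  have ne: "\<And>b. b \<in> Basis \<Longrightarrow> c b \<noteq> 0" using c by force
  have L: "lborel = density (distr lborel borel (\<lambda>z. a + diag c z)) (\<lambda>_. ennreal J)"
    using lborel_affine_euclidean[of c a, OF ne] unfolding diag_def J' .
  show "integral\<^sup>L lborel f = J * (\<integral>z. f (a + diag c z) \<partial>lborel)"
    by (subst L) (use J in \<open>simp add: integral_density integral_distr\<close>)
  have "integrable lborel f \<longleftrightarrow> integrable (density (distr lborel borel (\<lambda>z. a + diag c z)) (\<lambda>_. ennreal J)) f"
    by (subst L) simp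
  also have "\<dots> \<longleftrightarrow> integrable lborel (\<lambda>z. f (a + diag c z))"
    using J by (simp add: integrable_density integrable_distr_eq)
  finally show "integrable lborel f \<longleftrightarrow> integrable lborel (\<lambda>z. f (a + diag c z))" .
  show "(\<integral>\<^sup>+z. g z \<partial>lborel) = ennreal J * (\<integral>\<^sup>+z. g (a + diag c z) \<partial>lborel)"
    if [measurable]: "g \<in> borel_measurable borel" for g
    by (subst L) (simp add: nn_integral_density nn_integral_distr nn_integral_cmult)
qed

lemma cutoff_diag:
  fixes a :: "'a::euclidean_space"
  assumes z: "cutoff C \<zeta> \<zeta>'" and c: "\<And>b. b \<in> Basis \<Longrightarrow> c b > 0"
  shows "cutoff ((\<lambda>z. a + diag c z) ` C) (\<lambda>w. \<zeta> (diag (\<lambda>b. 1 / c b) (w - a)))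
    (\<lambda>b w. \<zeta>' b (diag (\<lambda>b. 1 / c b) (w - a)) / c b)"
  unfolding cutoff_def
proof (intro conjI allI ballI impI)
  let ?i = "\<lambda>w. diag (\<lambda>b. 1 / c b) (w - a)"
  have ne: "\<And>b. b \<in> Basis \<Longrightarrow> c b \<noteq> 0" using c by force
  have inv: "a + diag c (?i w) = w" for w
    using diag_diag[of c "\<lambda>b. 1 / c b" "w - a"] ne by simp
  show "compact ((\<lambda>z. a + diag c z) ` C)"
    by (intro compact_continuous_image continuous_on_diag cutoffD(1)[OF z])
  note [measurable] = cutoffD(2)[OF z]
  show "(\<lambda>w. \<zeta> (?i w)) \<in> borel_measurable borel" by measurable
  show "0 \<le> \<zeta> (?i w)" for w by (rule cutoffD(3)[OF z])
  show "\<zeta> (?i w) = 0" if "w \<notin> (\<lambda>z. a + diag c z) ` C" for w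
  proof (rule cutoffD(4)[OF z])
    show "?i w \<notin> C" using that inv[of w] by (metis imageI)
  qed
  show "bounded_fun (\<lambda>w. \<zeta> (?i w))" using cutoffD(5)[OF z] by (auto simp: bounded_fun_def)
  fix b :: 'a assume b: "b \<in> Basis"
  have "bounded_fun (\<lambda>w. \<zeta>' b (?i w))" using cutoffD(7)[OF z b] by (auto simp: bounded_fun_def)
  from bounded_fun_mult[OF this bounded_fun_const[of "1 / c b"]]
  show "bounded_fun (\<lambda>w. \<zeta>' b (?i w) / c b)" by simp
  fix w
  have D: "((\<lambda>h. \<zeta> (?i w + h *\<^sub>R b)) has_real_derivative \<zeta>' b (?i w)) (at (0 / c b))"
    using cutoffD(6)[OF z b, of "?i w"] by (simp add: has_dir_deriv_def)
  have "((\<lambda>h. h / c b) has_real_derivative 1 / c b) (at 0)"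
    using ne[OF b] by (auto intro!: derivative_eq_intros)
  from DERIV_chain2[OF D this]
  have "((\<lambda>h. \<zeta> (?i w + (h / c b) *\<^sub>R b)) has_real_derivative \<zeta>' b (?i w) * (1 / c b)) (at 0)" .
  moreover have "?i (w + h *\<^sub>R b) = ?i w + (h / c b) *\<^sub>R b" for h
  proof -
    have "?i (w + h *\<^sub>R b) = diag (\<lambda>b. 1 / c b) ((w - a) + h *\<^sub>R b)" by (simp add: algebra_simps)
    then show ?thesis by (simp add: diag_add diag_Basis[OF b])
  qed
  ultimately show "has_dir_deriv (\<lambda>w. \<zeta> (?i w)) b (\<zeta>' b (?i w) / c b) w"
    by (simp add: has_dir_deriv_def)
qed

lemma energy_density_measurable:
  assumes [measurable]: "u \<in> borel_measurable borel" "\<And>i. Du i \<in> borel_measurable borel" "\<zeta> \<in> borel_measurable borel"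
    "\<And>i. \<zeta>' (space_dir i) \<in> borel_measurable borel" "\<zeta>' time_dir \<in> borel_measurable borel"
  shows "energy_density p k u Du \<zeta> \<zeta>' \<in> borel_measurable borel"
  unfolding energy_density_def[abs_def] truncation_def flux_def by measurable

lemma truncation_estimatesD:
  assumes "truncation_estimates U p u Du"
  shows "u \<in> borel_measurable borel" "Du i \<in> borel_measurable borel"
    "compact C \<Longrightarrow> C \<subseteq> U \<Longrightarrow> integrable lborel (\<lambda>z. indicator C z * \<bar>Du i z\<bar> powr p i)"
    "C \<subseteq> U \<Longrightarrow> cutoff C \<zeta> \<zeta>' \<Longrightarrow> integrable lborel (energy_density p k u Du \<zeta> \<zeta>')"
    "C \<subseteq> U \<Longrightarrow> cutoff C \<zeta> \<zeta>' \<Longrightarrow> 0 \<le> integral\<^sup>L lborel (energy_density p k u Du \<zeta> \<zeta>')"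
    "C \<subseteq> U \<Longrightarrow> cutoff C \<zeta> \<zeta>' \<Longrightarrow>
      (\<integral>z. \<bar>truncation k (u (z + h *\<^sub>R space_dir i)) ^ 2 * \<zeta> (z + h *\<^sub>R space_dir i)
            - truncation k (u z) ^ 2 * \<zeta> z\<bar> \<partial>lborel)
          \<le> \<bar>h\<bar> * (\<integral>z. \<bar>truncation k (u z) ^ 2 * \<zeta>' (space_dir i) z
            - 2 * truncation k (u z) * Du i z * \<zeta> z\<bar> \<partial>lborel)"
proof -
  note D = assms[unfolded truncation_estimates_def]
  note E = D[THEN conjunct2, THEN conjunct2, THEN conjunct2, rule_format, OF conjI]
  show "u \<in> borel_measurable borel" by (rule D[THEN conjunct1])
  show "Du i \<in> borel_measurable borel" by (rule D[THEN conjunct2, THEN conjunct1, rule_format])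
  show "compact C \<Longrightarrow> C \<subseteq> U \<Longrightarrow> integrable lborel (\<lambda>z. indicator C z * \<bar>Du i z\<bar> powr p i)"
    by (rule D[THEN conjunct2, THEN conjunct2, THEN conjunct1, rule_format, OF conjI])
  show "C \<subseteq> U \<Longrightarrow> cutoff C \<zeta> \<zeta>' \<Longrightarrow> integrable lborel (energy_density p k u Du \<zeta> \<zeta>')"
    by (rule E[THEN conjunct1])
  show "C \<subseteq> U \<Longrightarrow> cutoff C \<zeta> \<zeta>' \<Longrightarrow> 0 \<le> integral\<^sup>L lborel (energy_density p k u Du \<zeta> \<zeta>')"
    by (rule E[THEN conjunct2, THEN conjunct1])
  show "C \<subseteq> U \<Longrightarrow> cutoff C \<zeta> \<zeta>' \<Longrightarrow>
      (\<integral>z. \<bar>truncation k (u (z + h *\<^sub>R space_dir i)) ^ 2 * \<zeta> (z + h *\<^sub>R space_dir i)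
            - truncation k (u z) ^ 2 * \<zeta> z\<bar> \<partial>lborel)
          \<le> \<bar>h\<bar> * (\<integral>z. \<bar>truncation k (u z) ^ 2 * \<zeta>' (space_dir i) z
            - 2 * truncation k (u z) * Du i z * \<zeta> z\<bar> \<partial>lborel)"
    by (rule E[THEN conjunct2, THEN conjunct2, rule_format])
qed

text \<open>When \<open>c (space_dir i) powr p i = c time_dir\<close>, the change of variables multiplies every term of the
  energy density by the same factor \<open>c time_dir\<close>: the time derivative by \<open>c time_dir\<close>, the energy by
  \<open>c (space_dir i) powr p i\<close>, and the flux times the derivative of the cutoff by
  \<open>c (space_dir i) powr (p i - 1) * c (space_dir i)\<close>. The values of \<open>u\<close> are not rescaled, so bounds
  for the truncations are the same at all scales.\<close>

theorem truncation_estimates_scale: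
  fixes a :: "(real^'n::finite) \<times> real"
  assumes TE: "truncation_estimates U p u Du" and p: "\<And>i. p i > 2"
    and c: "\<And>b. b \<in> Basis \<Longrightarrow> c b > 0" and cp: "\<And>i. c (space_dir i) powr p i = c time_dir"
  shows "truncation_estimates ((\<lambda>z. a + diag c z) -` U) p (\<lambda>z. u (a + diag c z))
    (\<lambda>i z. c (space_dir i) * Du i (a + diag c z))"
proof -
  let ?S = "\<lambda>z. a + diag c z"
  let ?i = "\<lambda>w. diag (\<lambda>b. 1 / c b) (w - a)"
  let ?Dh = "\<lambda>i z. c (space_dir i) * Du i (?S z)"
  let ?r = "c time_dir"
  note D = truncation_estimatesD[OF TE]
  note [measurable] = D(1,2)
  have ne: "\<And>b. b \<in> Basis \<Longrightarrow> c b \<noteq> 0" using c by force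
  have c0: "c (space_dir i) > 0" "?r > 0" for i using c space_dir_Basis by auto
  have inv: "?i (?S z) = z" for z
    using diag_diag[of "\<lambda>b. 1 / c b" c z] ne by simp
  have inj: "inj ?S" by (rule inj_on_inverseI[of _ ?i]) (rule inv)
  have tm[measurable]: "truncation k \<in> borel_measurable borel" for k unfolding truncation_def[abs_def] by measurable
  define J where "J = (\<Prod>b\<in>Basis. c b)"
  note chg = integral_diag[where a=a and c=c, OF c, folded J_def] and chi = integrable_diag[where a=a and c=c, OF c]
  have J: "J > 0" unfolding J_def using c by (intro prod_pos) auto
  have 1: "integrable lborel (\<lambda>z. indicator C z * \<bar>?Dh i z\<bar> powr p i)"
    if C: "compact C" "C \<subseteq> ?S -` U" for C i
  proof -
    have SC: "compact (?S ` C)" by (intro compact_continuous_image continuous_on_diag C)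
    then have [measurable]: "?S ` C \<in> sets borel" by (rule borel_compact)
    have "integrable lborel (\<lambda>z. indicator (?S ` C) z * \<bar>Du i z\<bar> powr p i)"
      using C by (intro D(3) SC) auto
    then have "integrable lborel (\<lambda>z. indicator (?S ` C) (?S z) * \<bar>Du i (?S z)\<bar> powr p i)"
      by (subst (asm) chi) simp_all
    then have "integrable lborel (\<lambda>z. ?r * (indicator (?S ` C) (?S z) * \<bar>Du i (?S z)\<bar> powr p i))"
      by (rule integrable_mult_right)
    moreover have mem: "(?S z \<in> ?S ` C) = (z \<in> C)" for z by (rule inj_image_mem_iff[OF inj])
    have "?r * (indicator (?S ` C) (?S z) * \<bar>Du i (?S z)\<bar> powr p i) = indicator C z * \<bar>?Dh i z\<bar> powr p i" for z
      using c0(1)[of i] mem[of z] by (simp add: abs_mult powr_mult cp indicator_def)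
    ultimately show ?thesis by (simp only:)
  qed
  have 2: "integrable lborel (energy_density p k (\<lambda>z. u (?S z)) ?Dh \<zeta> \<zeta>') \<and>
      0 \<le> integral\<^sup>L lborel (energy_density p k (\<lambda>z. u (?S z)) ?Dh \<zeta> \<zeta>') \<and>
      (\<forall>i h. (\<integral>z. \<bar>truncation k (u (?S (z + h *\<^sub>R space_dir i))) ^ 2 * \<zeta> (z + h *\<^sub>R space_dir i)
            - truncation k (u (?S z)) ^ 2 * \<zeta> z\<bar> \<partial>lborel)
          \<le> \<bar>h\<bar> * (\<integral>z. \<bar>truncation k (u (?S z)) ^ 2 * \<zeta>' (space_dir i) z
            - 2 * truncation k (u (?S z)) * ?Dh i z * \<zeta> z\<bar> \<partial>lborel))"
    if CU: "C \<subseteq> ?S -` U" and ct: "cutoff C \<zeta> \<zeta>'" for C k \<zeta> \<zeta>'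
  proof -
    let ?z = "\<lambda>w. \<zeta> (?i w)" and ?z' = "\<lambda>b w. \<zeta>' b (?i w) / c b"
    have SU: "?S ` C \<subseteq> U" using CU by auto
    note ct2 = cutoff_diag[OF ct c, where a=a]
    note [measurable] = cutoffD(2)[OF ct] cutoffD(8)[OF ct space_dir_Basis(1)] cutoffD(8)[OF ct space_dir_Basis(2)]
    define E where "E = energy_density p k u Du ?z ?z'"
    have Em[measurable]: "E \<in> borel_measurable borel"
      unfolding E_def by (intro energy_density_measurable) measurable
    have fl: "flux (p i) (c (space_dir i) * d) = ?r * (flux (p i) d / c (space_dir i))" for i d
    proof -
      let ?c = "c (space_dir i)"
      have "?c powr (p i - 2) * ?c * ?c = ?c powr (p i - 2) * ?c powr 2"
        using c0(1)[of i] by (simp add: powr_numeral power2_eq_square)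
      also have "\<dots> = ?r" unfolding cp[of i, symmetric] by (subst powr_add[symmetric]) simp
      finally have r: "?c powr (p i - 2) * ?c = ?r / ?c" using c0(1)[of i] by (simp add: field_simps)
      have "flux (p i) (?c * d) = (?c powr (p i - 2) * ?c) * flux (p i) d"
        using c0(1)[of i] by (simp add: flux_def abs_mult powr_mult algebra_simps)
      then show ?thesis unfolding r by simp
    qed
    have Eeq: "energy_density p k (\<lambda>z. u (?S z)) ?Dh \<zeta> \<zeta>' = (\<lambda>z. ?r * E (?S z))"
    proof
      fix z
      have pw: "\<bar>c (space_dir i) * d\<bar> powr p i = ?r * \<bar>d\<bar> powr p i" for i d
        using c0(1)[of i] by (simp add: abs_mult powr_mult cp)
      show "energy_density p k (\<lambda>z. u (?S z)) ?Dh \<zeta> \<zeta>' z = ?r * E (?S z)"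
        unfolding E_def energy_density_def inv fl pw distrib_left sum_distrib_left
        using c0 by (intro arg_cong2[where f="(+)"] sum.cong refl) (auto simp: field_simps)
    qed
    have E1: "integrable lborel E" "0 \<le> integral\<^sup>L lborel E"
      using D(4,5)[OF SU ct2] unfolding E_def by auto
    have "integrable lborel (\<lambda>z. E (?S z))" using E1(1) by (subst (asm) chi) simp_all
    moreover have "0 \<le> (\<integral>z. E (?S z) \<partial>lborel)"
      using E1(2) J by (subst (asm) chg) (simp_all add: zero_le_mult_iff)
    moreover have "(\<integral>z. \<bar>truncation k (u (?S (z + h *\<^sub>R space_dir i))) ^ 2 * \<zeta> (z + h *\<^sub>R space_dir i)
            - truncation k (u (?S z)) ^ 2 * \<zeta> z\<bar> \<partial>lborel)
          \<le> \<bar>h\<bar> * (\<integral>z. \<bar>truncation k (u (?S z)) ^ 2 * \<zeta>' (space_dir i) z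
            - 2 * truncation k (u (?S z)) * ?Dh i z * \<zeta> z\<bar> \<partial>lborel)" for i h
    proof -
      let ?e = "space_dir i :: (real^'n) \<times> real"
      let ?c = "c ?e"
      have Sh: "?S (z + h *\<^sub>R ?e) = ?S z + (?c * h) *\<^sub>R ?e" for z
        by (simp only: diag_add diag_Basis[OF space_dir_Basis(1)] add.assoc)
      define L where "L w = \<bar>truncation k (u (w + (?c * h) *\<^sub>R ?e)) ^ 2 * ?z (w + (?c * h) *\<^sub>R ?e)
            - truncation k (u w) ^ 2 * ?z w\<bar>" for w
      define G where "G w = \<bar>truncation k (u w) ^ 2 * ?z' ?e w - 2 * truncation k (u w) * Du i w * ?z w\<bar>" for w
      have Lm: "L \<in> borel_measurable borel" "G \<in> borel_measurable borel"
        unfolding L_def[abs_def] G_def[abs_def] by measurable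
      have "integral\<^sup>L lborel L \<le> \<bar>?c * h\<bar> * integral\<^sup>L lborel G"
        unfolding L_def[abs_def] G_def[abs_def] by (rule D(6)[OF SU ct2])
      then have "J * (\<integral>z. L (?S z) \<partial>lborel) \<le> \<bar>?c * h\<bar> * (J * (\<integral>z. G (?S z) \<partial>lborel))"
        by (simp add: chg[OF _ Lm(1)] chg[OF _ Lm(2)])
      then have "J * (\<integral>z. L (?S z) \<partial>lborel) \<le> J * (\<bar>h\<bar> * (?c * (\<integral>z. G (?S z) \<partial>lborel)))"
        using c0(1)[of i] by (simp add: abs_mult mult_ac)
      then have "(\<integral>z. L (?S z) \<partial>lborel) \<le> \<bar>h\<bar> * (?c * (\<integral>z. G (?S z) \<partial>lborel))"
        using J by (rule mult_left_le_imp_le)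
      also have "?c * (\<integral>z. G (?S z) \<partial>lborel) = (\<integral>z. ?c * G (?S z) \<partial>lborel)" by simp
      also have "(\<lambda>z. ?c * G (?S z)) = (\<lambda>z. \<bar>truncation k (u (?S z)) ^ 2 * \<zeta>' ?e z
            - 2 * truncation k (u (?S z)) * ?Dh i z * \<zeta> z\<bar>)"
      proof
        fix z
        have "?c * G (?S z) = \<bar>?c * (truncation k (u (?S z)) ^ 2 * ?z' ?e (?S z) - 2 * truncation k (u (?S z)) * Du i (?S z) * ?z (?S z))\<bar>"
          using c0(1)[of i] by (simp add: G_def abs_mult)
        also have "\<dots> = \<bar>truncation k (u (?S z)) ^ 2 * \<zeta>' ?e z - 2 * truncation k (u (?S z)) * ?Dh i z * \<zeta> z\<bar>"
          unfolding inv using c0(1)[of i] by (intro arg_cong[where f=abs]) (simp add: right_diff_distrib)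
        finally show "?c * G (?S z) = \<bar>truncation k (u (?S z)) ^ 2 * \<zeta>' ?e z
            - 2 * truncation k (u (?S z)) * ?Dh i z * \<zeta> z\<bar>" .
      qed
      also have "(\<lambda>z. L (?S z)) = (\<lambda>z. \<bar>truncation k (u (?S (z + h *\<^sub>R ?e))) ^ 2 * \<zeta> (z + h *\<^sub>R ?e)
            - truncation k (u (?S z)) ^ 2 * \<zeta> z\<bar>)"
        unfolding L_def Sh[symmetric] by (simp only: inv)
      finally show ?thesis .
    qed
    ultimately show ?thesis unfolding Eeq using c0(2) by simp
  qed
  show ?thesis
    unfolding truncation_estimates_def
    by (intro conjI allI impI 1 2[THEN conjunct1] 2[THEN conjunct2, THEN conjunct1] 2[THEN conjunct2, THEN conjunct2, rule_format];
        (elim conjE)?; (assumption | measurable))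
qed

section \<open>Measure of superlevel sets from averages\<close>

text \<open>Continuous weights with values in the unit interval approximate the indicator of the set where
  \<open>e > c\<close>, and tested with that indicator the hypothesis says that the set is null. The interval
  from \<open>-2\<close> to \<open>2\<close> is a neighbourhood of the support of \<open>e\<close>.\<close>

lemma AE_le_from_continuous_weights:
  fixes e :: "real \<Rightarrow> real"
  assumes e: "integrable lborel e" and e0: "\<And>t. \<bar>t\<bar> > 1 \<Longrightarrow> e t = 0" and c: "c \<ge> 0"
    and weak: "\<And>\<theta>. continuous_on UNIV \<theta> \<Longrightarrow> (\<And>t. 0 \<le> \<theta> t) \<Longrightarrow> (\<And>t. \<theta> t \<le> 1) \<Longrightarrow>
      (\<integral>t. e t * \<theta> t \<partial>lborel) \<le> c * (\<integral>t. indicator {-2..2} t * \<theta> t \<partial>lborel)"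
  shows "AE t in lborel. e t \<le> c"
proof -
  have [measurable]: "e \<in> borel_measurable borel" using e by auto
  define B where "B = {t. e t > c} \<inter> {-2..2}"
  have [measurable]: "B \<in> sets borel" unfolding B_def by measurable
  have "(indicator B :: real \<Rightarrow> real) \<in> borel_measurable (lebesgue_on UNIV)"
    by (auto simp: lebesgue_on_UNIV_eq intro!: measurable_completion)
  then have "(indicator B :: real \<Rightarrow> real) measurable_on UNIV"
    by (subst measurable_on_iff_borel_measurable) auto
  then obtain N g where N: "negligible N" "\<And>n. continuous_on UNIV (g n)"
    "\<And>x. x \<notin> N \<Longrightarrow> (\<lambda>n. g n x) \<longlonglongrightarrow> indicat_real B x"
    unfolding measurable_on_def by auto
  define \<theta> where "\<theta> n t = min 1 (max 0 (g n t))" for n :: nat and t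
  have \<theta>c: "continuous_on UNIV (\<theta> n)" for n unfolding \<theta>_def by (intro continuous_intros N)
  have \<theta>01: "0 \<le> \<theta> n t" "\<theta> n t \<le> 1" for n t by (auto simp: \<theta>_def)
  have [measurable]: "\<theta> n \<in> borel_measurable borel" for n by (rule borel_measurable_continuous_onI[OF \<theta>c])
  have "AE t in lebesgue. t \<notin> N" using N(1) by (simp add: negligible_iff_null_sets AE_not_in)
  then have lim: "AE t in lborel. (\<lambda>n. \<theta> n t) \<longlonglongrightarrow> indicator B t"
    unfolding AE_completion_iff
  proof eventually_elim
    case (elim t)
    have "(\<lambda>n. \<theta> n t) \<longlonglongrightarrow> min 1 (max 0 (indicator B t))"
      unfolding \<theta>_def by (intro tendsto_intros N(3) elim)
    then show ?case by (simp add: indicator_def split: if_splits)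
  qed
  have I: "integrable lborel (indicator {-2..2} :: real \<Rightarrow> real)" by (intro integrable_real_indicator) auto
  have "(\<lambda>n. \<integral>t. e t * \<theta> n t \<partial>lborel) \<longlonglongrightarrow> (\<integral>t. e t * indicator B t \<partial>lborel)"
  proof (rule integral_dominated_convergence[where w="\<lambda>t. \<bar>e t\<bar>"])
    show "AE t in lborel. (\<lambda>n. e t * \<theta> n t) \<longlonglongrightarrow> e t * indicator B t"
      using lim by eventually_elim (intro tendsto_intros)
    show "AE t in lborel. norm (e t * \<theta> n t) \<le> \<bar>e t\<bar>" for n
      using \<theta>01[of n] by (auto simp: abs_mult intro!: mult_left_le)
  qed (use e in auto)
  moreover have "(\<lambda>n. c * (\<integral>t. indicator {-2..2} t * \<theta> n t \<partial>lborel)) \<longlonglongrightarrow> c * (\<integral>t. indicator {-2..2} t * indicator B t \<partial>lborel)"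
  proof (intro tendsto_mult_left integral_dominated_convergence[where w="indicator {-2..2}"])
    show "AE t in lborel. (\<lambda>n. indicator {-2..2} t * \<theta> n t) \<longlonglongrightarrow> indicator {-2..2} t * indicat_real B t"
      using lim by eventually_elim (intro tendsto_intros)
    show "AE t in lborel. norm (indicator {-2..2} t * \<theta> n t) \<le> indicator {-2..2} t" for n
      using \<theta>01[of n] by (auto simp: indicator_def)
  qed (use I in auto)
  ultimately have "(\<integral>t. e t * indicator B t \<partial>lborel) \<le> c * (\<integral>t. indicator {-2..2} t * indicator B t \<partial>lborel)"
    by (rule LIMSEQ_le) (intro exI[of _ 0] allI impI weak \<theta>c \<theta>01)
  moreover have "indicat_real {-2..2} t * indicator B t = indicator B t" for t
    by (auto simp: B_def indicator_def)
  ultimately have le: "(\<integral>t. e t * indicator B t \<partial>lborel) \<le> (\<integral>t. c * indicator B t \<partial>lborel)" by simp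
  have IB: "integrable lborel (indicator B :: real \<Rightarrow> real)"
    using emeasure_mono[of B "{-2..2}" lborel] by (intro integrable_real_indicator) (auto simp: B_def less_top[symmetric] top_unique)
  have Ie: "integrable lborel (\<lambda>t. e t * indicator B t)"
    by (rule integrable_real_mult_indicator) (use e in auto)
  have "(\<integral>t. (e t - c) * indicator B t \<partial>lborel) \<le> 0"
    using le Ie IB by (simp add: left_diff_distrib)
  moreover have nn: "0 \<le> (e t - c) * indicator B t" for t by (auto simp: B_def indicator_def)
  ultimately have "(\<integral>t. (e t - c) * indicator B t \<partial>lborel) = 0"
    using Bochner_Integration.integral_nonneg[OF nn, of lborel] by (intro antisym) auto
  moreover have "integrable lborel (\<lambda>t. (e t - c) * indicator B t)"
    using Ie IB by (simp add: left_diff_distrib)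
  ultimately have "AE t in lborel. (e t - c) * indicator B t = 0"
    using nn by (subst (asm) integral_nonneg_eq_0_iff_AE) auto
  then show ?thesis
  proof eventually_elim
    case (elim t)
    show ?case
    proof (cases "\<bar>t\<bar> > 1")
      case True then show ?thesis using e0 c by simp
    next
      case False
      then show ?thesis using elim by (auto simp: B_def indicator_def split: if_splits)
    qed
  qed
qed

lemma ennreal_abs_diff_triangle: "ennreal \<bar>a - c\<bar> \<le> ennreal \<bar>a - b\<bar> + ennreal \<bar>b - c\<bar>"
  unfolding ennreal_plus[OF abs_ge_zero abs_ge_zero, symmetric] by (rule ennreal_leI) linarith

text \<open>At a point where \<open>w\<close> is at least \<open>\<mu>\<close>, the function differs from its spatial mean over a box of
  side \<open>\<delta>\<close> by at least \<open>\<mu> / 2\<close>: from \<open>w \<le> \<mu> / 4 + w\<^sup>2 / \<mu>\<close> and the bound \<open>S\<close> for the slices, the mean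
  is at most \<open>\<mu> / 4 + S / (\<mu> * \<delta> ^ N)\<close>, where \<open>N\<close> is the space dimension, and hence at most \<open>\<mu> / 2\<close>.
  On the other hand the translation estimate bounds the mean deviation, integrated over all points, by
  \<open>N * \<delta> * G\<close>. Choosing \<open>\<delta>\<close> as small as the slice bound permits gives a gain over the trivial estimate
  of the superlevel set, in place of a Sobolev inequality.\<close>

lemma superlevel_measure_bound:
  fixes w :: "(real^'n::finite) \<times> real \<Rightarrow> real"
  assumes wm[measurable]: "w \<in> borel_measurable borel" and w0: "\<And>z. 0 \<le> w z" and wi: "integrable lborel w"
    and S: "AE t in lborel. (\<integral>\<^sup>+x. ennreal (w (x, t) ^ 2) \<partial>lborel) \<le> ennreal S" "S \<ge> 0"
    and G: "\<And>i h. (\<integral>z. \<bar>w (z + h *\<^sub>R space_dir i) - w z\<bar> \<partial>lborel) \<le> \<bar>h\<bar> * G" "G \<ge> 0"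
    and \<delta>: "\<delta> > 0" "\<mu> > 0" "4 * S \<le> \<delta> ^ CARD('n) * \<mu>\<^sup>2"
  shows "emeasure lborel {z. \<mu> \<le> w z} \<le> ennreal (2 / \<mu> * real CARD('n) * \<delta> * G)"
proof -
  let ?N = "CARD('n)"
  define Bx where "Bx = cbox 0 (\<delta> *\<^sub>R One :: real^'n)"
  have [measurable]: "Bx \<in> sets borel" by (simp add: Bx_def)
  have eB: "emeasure lborel Bx = ennreal (\<delta> ^ ?N)"
    using \<delta>(1) by (simp add: Bx_def emeasure_lborel_cbox_eq inner_sum_left_Basis)
  \<comment> \<open>a spatial translation is a composition of translations along the axes\<close>
  have shift: "(\<integral>\<^sup>+z. ennreal \<bar>w (z + (h, 0)) - w z\<bar> \<partial>lborel) \<le> ennreal ((\<Sum>i\<in>UNIV. \<bar>h $ i\<bar>) * G)" for h :: "real^'n"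
  proof -
    have one: "(\<integral>\<^sup>+z. ennreal \<bar>w (z + s *\<^sub>R space_dir i) - w z\<bar> \<partial>lborel) \<le> ennreal (\<bar>s\<bar> * G)" for s i
    proof -
      have "(\<integral>\<^sup>+z. ennreal \<bar>w (z + s *\<^sub>R space_dir i) - w z\<bar> \<partial>lborel)
          = ennreal (\<integral>z. \<bar>w (z + s *\<^sub>R space_dir i) - w z\<bar> \<partial>lborel)"
        by (intro nn_integral_eq_integral integrable_abs Bochner_Integration.integrable_diff integrable_lborel_shift wi) auto
      also have "\<dots> \<le> ennreal (\<bar>s\<bar> * G)" by (intro ennreal_leI G)
      finally show ?thesis .
    qed
    have "(\<integral>\<^sup>+z. ennreal \<bar>w (z + (\<Sum>i\<in>I. (h $ i) *\<^sub>R space_dir i)) - w z\<bar> \<partial>lborel) \<le> ennreal ((\<Sum>i\<in>I. \<bar>h $ i\<bar>) * G)"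
      if "finite I" for I
      using that
    proof (induction I)
      case (insert i I)
      let ?a = "\<Sum>i\<in>I. (h $ i) *\<^sub>R space_dir i :: (real^'n) \<times> real" and ?b = "(h $ i) *\<^sub>R space_dir i :: (real^'n) \<times> real"
      have eq: "z + (\<Sum>i\<in>insert i I. (h $ i) *\<^sub>R space_dir i) = (z + ?a) + ?b" for z
        by (simp only: sum.insert[OF insert(1,2)] add_ac)
      have "(\<integral>\<^sup>+z. ennreal \<bar>w (z + (\<Sum>i\<in>insert i I. (h $ i) *\<^sub>R space_dir i)) - w z\<bar> \<partial>lborel)
          \<le> (\<integral>\<^sup>+z. ennreal \<bar>w ((z + ?a) + ?b) - w (z + ?a)\<bar> + ennreal \<bar>w (z + ?a) - w z\<bar> \<partial>lborel)"
        unfolding eq by (intro nn_integral_mono ennreal_abs_diff_triangle)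
      also have "\<dots> = (\<integral>\<^sup>+z. ennreal \<bar>w ((z + ?a) + ?b) - w (z + ?a)\<bar> \<partial>lborel) + (\<integral>\<^sup>+z. ennreal \<bar>w (z + ?a) - w z\<bar> \<partial>lborel)"
        by (rule nn_integral_add) auto
      also have "(\<integral>\<^sup>+z. ennreal \<bar>w ((z + ?a) + ?b) - w (z + ?a)\<bar> \<partial>lborel) = (\<integral>\<^sup>+z. ennreal \<bar>w (z + ?b) - w z\<bar> \<partial>lborel)"
        by (rule nn_integral_lborel_shift[of "\<lambda>z. ennreal \<bar>w (z + ?b) - w z\<bar>"]) measurable
      also have "\<dots> + (\<integral>\<^sup>+z. ennreal \<bar>w (z + ?a) - w z\<bar> \<partial>lborel) \<le> ennreal (\<bar>h $ i\<bar> * G) + ennreal ((\<Sum>i\<in>I. \<bar>h $ i\<bar>) * G)"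
        by (intro add_mono one insert.IH)
      also have "\<dots> = ennreal ((\<Sum>i\<in>insert i I. \<bar>h $ i\<bar>) * G)"
        using insert(1,2) G(2) by (subst ennreal_plus[symmetric]) (auto simp: sum_nonneg distrib_right)
      finally show ?case .
    qed simp
    from this[OF finite] have "(\<integral>\<^sup>+z. ennreal \<bar>w (z + (\<Sum>i\<in>UNIV. (h $ i) *\<^sub>R space_dir i)) - w z\<bar> \<partial>lborel)
        \<le> ennreal ((\<Sum>i\<in>UNIV. \<bar>h $ i\<bar>) * G)" .
    moreover have "(\<Sum>i\<in>UNIV. (h $ i) *\<^sub>R space_dir i) = (h, 0::real)"
    proof (rule prod_eqI)
      show "fst (\<Sum>i\<in>UNIV. (h $ i) *\<^sub>R space_dir i :: (real^'n) \<times> real) = fst (h, 0::real)"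
        by (simp add: fst_sum vec_eq_iff axis_def if_distrib[of "\<lambda>x. _ * x"] cong: if_cong)
    qed (simp add: snd_sum)
    ultimately show ?thesis by simp
  qed
  have shiftB: "(\<integral>\<^sup>+z. ennreal \<bar>w (z + (h, 0)) - w z\<bar> \<partial>lborel) \<le> ennreal (real ?N * \<delta> * G)" if "h \<in> Bx" for h
  proof -
    have "\<bar>h $ i\<bar> \<le> \<delta>" for i
    proof -
      have b: "axis i 1 \<in> (Basis :: (real^'n) set)" by (auto simp: Basis_vec_def)
      have "0 \<le> h \<bullet> axis i 1" "h \<bullet> axis i 1 \<le> \<delta>"
        using that b by (auto simp: Bx_def mem_box inner_sum_left_Basis)
      then show ?thesis by (simp add: inner_axis)
    qed
    then have "(\<Sum>i\<in>UNIV. \<bar>h $ i\<bar>) \<le> real ?N * \<delta>"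
      using sum_mono[of UNIV "\<lambda>i. \<bar>h $ i\<bar>" "\<lambda>_. \<delta>"] by simp
    then show ?thesis using G(2) by (intro order_trans[OF shift] ennreal_leI mult_right_mono)
  qed
  \<comment> \<open>all integrals are taken in \<open>ennreal\<close>, so the mean is added to the smaller side rather than
    subtracted\<close>
  have pt: "ennreal (\<mu> * \<delta> ^ ?N / 2) \<le> (\<integral>\<^sup>+h. indicator Bx h * ennreal \<bar>w ((x, t) + (h, 0)) - w (x, t)\<bar> \<partial>lborel)"
    if St: "(\<integral>\<^sup>+x. ennreal (w (x, t) ^ 2) \<partial>lborel) \<le> ennreal S" and l: "\<mu> \<le> w (x, t)" for x t
  proof -
    let ?I = "\<integral>\<^sup>+h. indicator Bx h * ennreal \<bar>w ((x, t) + (h, 0)) - w (x, t)\<bar> \<partial>lborel"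
    have "ennreal (\<mu> * \<delta> ^ ?N) = (\<integral>\<^sup>+h. ennreal \<mu> * indicator Bx h \<partial>lborel)"
    proof (subst nn_integral_cmult_indicator)
      show "ennreal (\<mu> * \<delta> ^ ?N) = ennreal \<mu> * emeasure lborel Bx"
        unfolding eB using \<delta> by (intro ennreal_mult) auto
    qed simp
    also have "\<dots> \<le> (\<integral>\<^sup>+h. indicator Bx h * ennreal \<bar>w ((x, t) + (h, 0)) - w (x, t)\<bar>
        + (ennreal (\<mu> / 4) * indicator Bx h + ennreal (1 / \<mu>) * ennreal (w (h + x, t) ^ 2)) \<partial>lborel)"
    proof (rule nn_integral_mono)
      fix h
      let ?b = "w (h + x, t)"
      have "\<mu> * ?b \<le> \<mu>\<^sup>2 / 4 + ?b\<^sup>2"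
        using zero_le_power2[of "\<mu> / 2 - ?b"] by (simp add: power2_eq_square algebra_simps)
      then have "?b \<le> \<mu> / 4 + 1 / \<mu> * ?b\<^sup>2" using \<delta>(2) by (simp add: field_simps power2_eq_square)
      then have "\<mu> \<le> \<bar>?b - w (x, t)\<bar> + (\<mu> / 4 + 1 / \<mu> * ?b\<^sup>2)" using l by linarith
      then have "ennreal \<mu> \<le> ennreal (\<bar>?b - w (x, t)\<bar> + (\<mu> / 4 + 1 / \<mu> * ?b\<^sup>2))" by (rule ennreal_leI)
      also have "\<dots> = ennreal \<bar>?b - w (x, t)\<bar> + (ennreal (\<mu> / 4) + ennreal (1 / \<mu>) * ennreal (?b\<^sup>2))"
      proof -
        have nn: "0 \<le> \<mu> / 4" "0 \<le> 1 / \<mu> * ?b\<^sup>2" using \<delta>(2) by auto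
        have "ennreal (1 / \<mu> * ?b\<^sup>2) = ennreal (1 / \<mu>) * ennreal (?b\<^sup>2)"
          using \<delta>(2) by (intro ennreal_mult) auto
        then show ?thesis by (simp only: ennreal_plus abs_ge_zero nn add_nonneg_nonneg)
      qed
      finally show "ennreal \<mu> * indicator Bx h \<le> indicator Bx h * ennreal \<bar>w ((x, t) + (h, 0)) - w (x, t)\<bar>
        + (ennreal (\<mu> / 4) * indicator Bx h + ennreal (1 / \<mu>) * ennreal (w (h + x, t) ^ 2))"
        by (cases "h \<in> Bx") (auto simp: add.commute)
    qed
    also have "\<dots> = ?I + (\<integral>\<^sup>+h. ennreal (\<mu> / 4) * indicator Bx h + ennreal (1 / \<mu>) * ennreal (w (h + x, t) ^ 2) \<partial>lborel)"
      by (rule nn_integral_add) measurable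
    also have "(\<integral>\<^sup>+h. ennreal (\<mu> / 4) * indicator Bx h + ennreal (1 / \<mu>) * ennreal (w (h + x, t) ^ 2) \<partial>lborel)
        = (\<integral>\<^sup>+h. ennreal (\<mu> / 4) * indicator Bx h \<partial>lborel) + (\<integral>\<^sup>+h. ennreal (1 / \<mu>) * ennreal (w (h + x, t) ^ 2) \<partial>lborel)"
      by (rule nn_integral_add) measurable
    finally have le0: "ennreal (\<mu> * \<delta> ^ ?N) \<le> ?I + ((\<integral>\<^sup>+h. ennreal (\<mu> / 4) * indicator Bx h \<partial>lborel)
        + (\<integral>\<^sup>+h. ennreal (1 / \<mu>) * ennreal (w (h + x, t) ^ 2) \<partial>lborel))" .
    have I2: "(\<integral>\<^sup>+h. ennreal (\<mu> / 4) * indicator Bx h \<partial>lborel) = ennreal (\<mu> * \<delta> ^ ?N / 4)"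
    proof -
      have "(\<integral>\<^sup>+h. ennreal (\<mu> / 4) * indicator Bx h \<partial>lborel) = ennreal (\<mu> / 4) * ennreal (\<delta> ^ ?N)"
        by (subst nn_integral_cmult_indicator) (auto simp: eB)
      also have "\<dots> = ennreal (\<mu> / 4 * \<delta> ^ ?N)" using \<delta> by (intro ennreal_mult[symmetric]) auto
      finally show ?thesis by simp
    qed
    have "(\<integral>\<^sup>+h. ennreal (1 / \<mu>) * ennreal (w (h + x, t) ^ 2) \<partial>lborel)
        = ennreal (1 / \<mu>) * (\<integral>\<^sup>+h. ennreal (w (h + x, t) ^ 2) \<partial>lborel)"
      by (rule nn_integral_cmult) measurable
    also have "(\<integral>\<^sup>+h. ennreal (w (h + x, t) ^ 2) \<partial>lborel) = (\<integral>\<^sup>+h. ennreal (w (h, t) ^ 2) \<partial>lborel)"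
      by (rule nn_integral_lborel_shift[of "\<lambda>h. ennreal (w (h, t) ^ 2)" x]) measurable
    also have "ennreal (1 / \<mu>) * (\<integral>\<^sup>+h. ennreal (w (h, t) ^ 2) \<partial>lborel) \<le> ennreal (1 / \<mu>) * ennreal S"
      by (intro mult_left_mono St) auto
    also have "ennreal (1 / \<mu>) * ennreal S \<le> ennreal (\<mu> * \<delta> ^ ?N / 4)"
    proof -
      have "1 / \<mu> * S \<le> \<mu> * \<delta> ^ ?N / 4" using \<delta> by (simp add: field_simps power2_eq_square)
      moreover have "ennreal (1 / \<mu>) * ennreal S = ennreal (1 / \<mu> * S)"
        using \<delta>(2) S(2) by (intro ennreal_mult[symmetric]) auto
      ultimately show ?thesis by (simp only: ennreal_leI)
    qed
    finally have I3: "(\<integral>\<^sup>+h. ennreal (1 / \<mu>) * ennreal (w (h + x, t) ^ 2) \<partial>lborel) \<le> ennreal (\<mu> * \<delta> ^ ?N / 4)" .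
    have le: "ennreal (\<mu> * \<delta> ^ ?N) \<le> ?I + ennreal (\<mu> * \<delta> ^ ?N / 4) + ennreal (\<mu> * \<delta> ^ ?N / 4)"
      unfolding add.assoc by (rule order_trans[OF le0]) (unfold I2, intro add_left_mono I3)
    define a where "a = \<mu> * \<delta> ^ ?N / 4"
    have a: "0 \<le> a" "\<mu> * \<delta> ^ ?N = 4 * a" "\<mu> * \<delta> ^ ?N / 2 = 2 * a" using \<delta> by (auto simp: a_def)
    have a4: "\<mu> * \<delta> ^ ?N / 4 = a" by (simp add: a_def)
    have le': "ennreal (4 * a) \<le> ?I + ennreal a + ennreal a"
      unfolding a(2)[symmetric] using le[unfolded a4] .
    show ?thesis
    proof (cases ?I)
      case (real y)
      have "ennreal (4 * a) \<le> ennreal y + ennreal a + ennreal a"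
        using le' unfolding real(2) .
      also have "\<dots> = ennreal (y + a + a)" using real(1) a(1) by (simp only: ennreal_plus add_nonneg_nonneg)
      finally have "4 * a \<le> y + a + a" using real(1) a(1) by (subst (asm) ennreal_le_iff) auto
      then show ?thesis unfolding real(2) a(3) by (intro ennreal_leI) simp
    qed simp
  qed
  have ae: "AE z in (lborel :: ((real^'n) \<times> real) measure). (\<integral>\<^sup>+x. ennreal (w (x, snd z) ^ 2) \<partial>lborel) \<le> ennreal S"
  proof -
    have "AE z in (lborel \<Otimes>\<^sub>M lborel :: ((real^'n) \<times> real) measure).
        (\<integral>\<^sup>+x. ennreal (w (x, snd z) ^ 2) \<partial>lborel) \<le> ennreal S"
      by (rule lborel_pair.AE_pair_measure) (measurable, use S(1) in simp)
    then show ?thesis by (simp only: lborel_prod)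
  qed
  define A where "A = {z. \<mu> \<le> w z}"
  have [measurable]: "A \<in> sets borel" unfolding A_def by measurable
  have "ennreal (\<mu> * \<delta> ^ ?N / 2) * emeasure lborel A = (\<integral>\<^sup>+z. ennreal (\<mu> * \<delta> ^ ?N / 2) * indicator A z \<partial>lborel)"
    by (rule nn_integral_cmult_indicator[symmetric]) simp
  also have "\<dots> \<le> (\<integral>\<^sup>+z. (\<integral>\<^sup>+h. indicator Bx h * ennreal \<bar>w (z + (h, 0)) - w z\<bar> \<partial>lborel) \<partial>lborel)"
  proof (rule nn_integral_mono_AE)
    show "AE z in lborel. ennreal (\<mu> * \<delta> ^ ?N / 2) * indicator A z \<le> (\<integral>\<^sup>+h. indicator Bx h * ennreal \<bar>w (z + (h, 0)) - w z\<bar> \<partial>lborel)"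
      using ae
    proof eventually_elim
      case (elim z)
      show ?case
      proof (cases "z \<in> A")
        case True
        then show ?thesis using pt[of "snd z" "fst z"] elim by (simp add: A_def)
      qed simp
    qed
  qed
  also have "\<dots> = (\<integral>\<^sup>+h. (\<integral>\<^sup>+z. indicator Bx h * ennreal \<bar>w (z + (h, 0)) - w z\<bar> \<partial>lborel) \<partial>lborel)"
    by (rule lborel_pair.Fubini'[symmetric]) measurable
  also have "\<dots> \<le> (\<integral>\<^sup>+h. ennreal (real ?N * \<delta> * G) * indicator Bx h \<partial>lborel)"
  proof (rule nn_integral_mono)
    fix h
    have "(\<integral>\<^sup>+z. indicator Bx h * ennreal \<bar>w (z + (h, 0)) - w z\<bar> \<partial>lborel) = indicator Bx h * (\<integral>\<^sup>+z. ennreal \<bar>w (z + (h, 0)) - w z\<bar> \<partial>lborel)"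
      by (rule nn_integral_cmult) measurable
    then show "(\<integral>\<^sup>+z. indicator Bx h * ennreal \<bar>w (z + (h, 0)) - w z\<bar> \<partial>lborel) \<le> ennreal (real ?N * \<delta> * G) * indicator Bx h"
      using shiftB[of h] by (cases "h \<in> Bx") auto
  qed
  also have "\<dots> = ennreal (real ?N * \<delta> * G) * ennreal (\<delta> ^ ?N)"
    by (subst nn_integral_cmult_indicator) (auto simp: eB)
  finally have "ennreal (\<mu> * \<delta> ^ ?N / 2) * emeasure lborel A \<le> ennreal (real ?N * \<delta> * G * \<delta> ^ ?N)"
    using \<delta> G(2) by (simp add: ennreal_mult)
  then have "ennreal (2 / (\<mu> * \<delta> ^ ?N)) * (ennreal (\<mu> * \<delta> ^ ?N / 2) * emeasure lborel A)
      \<le> ennreal (2 / (\<mu> * \<delta> ^ ?N)) * ennreal (real ?N * \<delta> * G * \<delta> ^ ?N)"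
    by (intro mult_left_mono) auto
  moreover have "ennreal (2 / (\<mu> * \<delta> ^ ?N)) * (ennreal (\<mu> * \<delta> ^ ?N / 2) * emeasure lborel A) = emeasure lborel A"
  proof -
    have "ennreal (2 / (\<mu> * \<delta> ^ ?N)) * ennreal (\<mu> * \<delta> ^ ?N / 2) = ennreal (2 / (\<mu> * \<delta> ^ ?N) * (\<mu> * \<delta> ^ ?N / 2))"
      using \<delta> by (intro ennreal_mult[symmetric]) auto
    also have "2 / (\<mu> * \<delta> ^ ?N) * (\<mu> * \<delta> ^ ?N / 2) = 1" using \<delta> by simp
    finally show ?thesis by (simp only: mult.assoc[symmetric] ennreal_1 mult_1_left)
  qed
  moreover have "ennreal (2 / (\<mu> * \<delta> ^ ?N)) * ennreal (real ?N * \<delta> * G * \<delta> ^ ?N) = ennreal (2 / \<mu> * real ?N * \<delta> * G)"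
  proof -
    have "ennreal (2 / (\<mu> * \<delta> ^ ?N)) * ennreal (real ?N * \<delta> * G * \<delta> ^ ?N)
        = ennreal (2 / (\<mu> * \<delta> ^ ?N) * (real ?N * \<delta> * G * \<delta> ^ ?N))"
      using \<delta> G(2) by (intro ennreal_mult[symmetric]) auto
    also have "2 / (\<mu> * \<delta> ^ ?N) * (real ?N * \<delta> * G * \<delta> ^ ?N) = 2 / \<mu> * real ?N * \<delta> * G"
      using \<delta> by simp
    finally show ?thesis .
  qed
  ultimately show ?thesis by (simp add: A_def)
qed

section \<open>The De Giorgi iteration on the unit cube\<close>

lemma snd_borel_measurable[measurable]:
  "(snd :: 'a::euclidean_space \<times> 'b::euclidean_space \<Rightarrow> 'b) \<in> borel_measurable borel"
  by (intro borel_measurable_continuous_onI continuous_intros)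

text \<open>In the estimates \<open>n + 2\<close> is at least as large as every \<open>p i\<close>. Differentiation lowers the exponent by
  one, and \<open>g ^ (n + 1)\<close> to the power \<open>p\<close> is at most \<open>g ^ (n + 2)\<close> to the power
  \<open>p - 1\<close> for \<open>0 \<le> g \<le> 1\<close> and \<open>p \<le> n + 2\<close>, which allows derivatives of the cutoff to be absorbed. There
  is no plateau: on a smaller cube the explicit positive lower bound is enough.\<close>

definition bump :: "nat \<Rightarrow> real \<Rightarrow> real \<Rightarrow> real" where
  "bump n R s = (max 0 (R\<^sup>2 - s\<^sup>2)) ^ (n + 2)"

definition bump_deriv :: "nat \<Rightarrow> real \<Rightarrow> real \<Rightarrow> real" where
  "bump_deriv n R s = real (n + 2) * (max 0 (R\<^sup>2 - s\<^sup>2)) ^ (n + 1) * (- 2 * s)"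

lemma DERIV_bump: "(bump n R has_real_derivative bump_deriv n R s) (at s)"
  unfolding bump_def[abs_def] bump_deriv_def
  by (rule DERIV_chain2[OF DERIV_pospart_power]) (auto intro!: derivative_eq_intros)

lemma bump_base_bounds:
  assumes "0 < R" "R \<le> 1"
  shows "0 \<le> max 0 (R\<^sup>2 - s\<^sup>2)" "max 0 (R\<^sup>2 - s\<^sup>2) \<le> (1::real)"
  using power_le_one[of R 2] assms zero_le_power2[of s] by (auto simp: max_def intro: order_trans[of _ "R\<^sup>2"])

lemma bump_bounds:
  assumes "0 < R" "R \<le> 1"
  shows "0 \<le> bump n R s" "bump n R s \<le> 1"
  unfolding bump_def by (intro zero_le_power power_le_one bump_base_bounds[OF assms])+

lemma bump_deriv_bound:
  assumes "0 < R" "R \<le> 1"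
  shows "\<bar>bump_deriv n R s\<bar> \<le> 2 * real (n + 2) * (max 0 (R\<^sup>2 - s\<^sup>2)) ^ (n + 1)"
proof (cases "\<bar>s\<bar> \<le> 1")
  case True
  have "\<bar>bump_deriv n R s\<bar> = real (n + 2) * (max 0 (R\<^sup>2 - s\<^sup>2)) ^ (n + 1) * (2 * \<bar>s\<bar>)"
    unfolding bump_deriv_def abs_mult using bump_base_bounds[OF assms] by simp
  also have "\<dots> \<le> real (n + 2) * (max 0 (R\<^sup>2 - s\<^sup>2)) ^ (n + 1) * 2"
    using True bump_base_bounds[OF assms] by (intro mult_left_mono) auto
  finally show ?thesis by (simp only: mult_ac)
next
  case False
  then have "R\<^sup>2 \<le> s\<^sup>2" using assms abs_le_square_iff[of R s] by simp
  then show ?thesis by (simp add: bump_deriv_def)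
qed

text \<open>Applied to space-time, this is a cube in space and time; all anisotropy is in the scaling.\<close>

definition cube :: "real \<Rightarrow> 'a::euclidean_space set" where
  "cube R = cbox (- (R *\<^sub>R One)) (R *\<^sub>R One)"

lemma mem_cube: "z \<in> cube R \<longleftrightarrow> (\<forall>b\<in>Basis. \<bar>z \<bullet> b\<bar> \<le> R)"
  by (auto simp: cube_def mem_box inner_sum_left_Basis abs_le_iff minus_le_iff)

lemma compact_cube: "compact (cube R)" by (simp add: cube_def)

lemma cube_mono: "R \<le> S \<Longrightarrow> cube R \<subseteq> cube S" by (force simp: mem_cube)

definition cube_cutoff :: "nat \<Rightarrow> real \<Rightarrow> 'a::euclidean_space \<Rightarrow> real" where
  "cube_cutoff n R z = (\<Prod>b\<in>Basis. bump n R (z \<bullet> b))"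

definition cube_cutoff_deriv :: "nat \<Rightarrow> real \<Rightarrow> 'a::euclidean_space \<Rightarrow> 'a \<Rightarrow> real" where
  "cube_cutoff_deriv n R e z = bump_deriv n R (z \<bullet> e) * (\<Prod>b\<in>Basis-{e}. bump n R (z \<bullet> b))"

lemma cube_cutoff_split:
  "e \<in> Basis \<Longrightarrow> cube_cutoff n R z = bump n R (z \<bullet> e) * (\<Prod>b\<in>Basis-{e}. bump n R (z \<bullet> b))"
  unfolding cube_cutoff_def by (rule prod.remove) auto

lemma cube_cutoff_has_dir_deriv:
  fixes e :: "'a::euclidean_space"
  assumes e: "e \<in> Basis"
  shows "has_dir_deriv (cube_cutoff n R) e (cube_cutoff_deriv n R e z) z"
proof -
  have eq: "cube_cutoff n R (z + h *\<^sub>R e) = bump n R (z \<bullet> e + h) * (\<Prod>b\<in>Basis-{e}. bump n R (z \<bullet> b))" for h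
    unfolding cube_cutoff_split[OF e]
    using e by (intro arg_cong2[where f="(*)"] prod.cong arg_cong[where f="bump n R"]) (auto simp: inner_add_left inner_Basis)
  have "((\<lambda>h. bump n R (z \<bullet> e + h)) has_real_derivative bump_deriv n R (z \<bullet> e + 0) * 1) (at 0)"
    by (rule DERIV_chain2[OF DERIV_bump]) (auto intro!: derivative_eq_intros)
  from DERIV_cmult_right[OF this] show ?thesis
    unfolding has_dir_deriv_def eq cube_cutoff_deriv_def by simp
qed

lemma cube_cutoff_bounds:
  fixes z :: "'a::euclidean_space"
  assumes "0 < R" "R \<le> 1"
  shows "0 \<le> cube_cutoff n R z" "cube_cutoff n R z \<le> 1" "z \<notin> cube R \<Longrightarrow> cube_cutoff n R z = 0"
    "0 \<le> (\<Prod>b\<in>B. bump n R (z \<bullet> b))" "(\<Prod>b\<in>B. bump n R (z \<bullet> b)) \<le> 1"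
proof -
  show P: "0 \<le> (\<Prod>b\<in>B. bump n R (z \<bullet> b))" "(\<Prod>b\<in>B. bump n R (z \<bullet> b)) \<le> 1" for B
    using bump_bounds[OF assms] by (auto intro!: prod_nonneg prod_le_1)
  then show "0 \<le> cube_cutoff n R z" "cube_cutoff n R z \<le> 1" by (auto simp: cube_cutoff_def)
  assume "z \<notin> cube R"
  then obtain b where b: "b \<in> Basis" "\<bar>z \<bullet> b\<bar> > R" by (auto simp: mem_cube not_le)
  then have "R\<^sup>2 \<le> (z \<bullet> b)\<^sup>2" using assms abs_le_square_iff[of R "z \<bullet> b"] by simp
  then have "bump n R (z \<bullet> b) = 0" by (simp add: bump_def)
  then show "cube_cutoff n R z = 0" unfolding cube_cutoff_split[OF b(1)] by simp
qed

lemma cube_cutoff_deriv_bound: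
  fixes z :: "'a::euclidean_space"
  assumes R: "0 < R" "R \<le> 1"
  shows "\<bar>cube_cutoff_deriv n R e z\<bar> \<le> 2 * real (n + 2)"
    "\<bar>cube_cutoff_deriv n R e z\<bar> \<le> 2 * real (n + 2) * (max 0 (R\<^sup>2 - (z \<bullet> e)\<^sup>2)) ^ (n + 1) * (\<Prod>b\<in>Basis-{e}. bump n R (z \<bullet> b))"
proof -
  let ?P = "\<Prod>b\<in>Basis-{e}. bump n R (z \<bullet> b)"
  have P: "0 \<le> ?P" "?P \<le> 1" by (rule cube_cutoff_bounds[OF R])+
  show 2: "\<bar>cube_cutoff_deriv n R e z\<bar> \<le> 2 * real (n + 2) * (max 0 (R\<^sup>2 - (z \<bullet> e)\<^sup>2)) ^ (n + 1) * ?P"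
    unfolding cube_cutoff_deriv_def abs_mult abs_of_nonneg[OF P(1)]
    by (intro mult_right_mono bump_deriv_bound[OF R] P)
  also have "\<dots> \<le> 2 * real (n + 2) * 1 * 1"
    using bump_base_bounds[OF R] P by (intro mult_mono power_le_one) auto
  finally show "\<bar>cube_cutoff_deriv n R e z\<bar> \<le> 2 * real (n + 2)" by simp
qed

lemma cutoff_cube:
  assumes R: "0 < R" "R \<le> 1"
  shows "cutoff (cube R :: 'a::euclidean_space set) (cube_cutoff n R) (cube_cutoff_deriv n R)"
  unfolding cutoff_def
proof (intro conjI allI impI ballI)
  have "bump n R \<in> borel_measurable borel" unfolding bump_def[abs_def] by measurable
  note [measurable] = this
  show "cube_cutoff n R \<in> borel_measurable borel" unfolding cube_cutoff_def[abs_def] by measurable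
  show "bounded_fun (cube_cutoff n R)"
    by (rule bounded_funI[of _ 1]) (simp only: abs_of_nonneg[OF cube_cutoff_bounds(1)[OF R]] cube_cutoff_bounds(2)[OF R])
  show "bounded_fun (cube_cutoff_deriv n R e)" for e
    by (rule bounded_funI) (rule cube_cutoff_deriv_bound[OF R])
qed (use cube_cutoff_bounds[OF R] compact_cube cube_cutoff_has_dir_deriv in auto)

lemma inner_time_dir: "z \<bullet> time_dir = snd z" by (cases z) simp

lemma cube_cutoff_snd:
  fixes z :: "(real^'n::finite) \<times> real"
  assumes R: "0 < R" "R \<le> 1" and z: "\<bar>snd z\<bar> > 1"
  shows "cube_cutoff n R z = 0" "cube_cutoff_deriv n R e z = 0 \<or> e = time_dir"
proof -
  have "R\<^sup>2 \<le> (snd z)\<^sup>2" using R z abs_le_square_iff[of R "snd z"] by simp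
  then have 0: "bump n R (z \<bullet> time_dir) = 0" by (simp add: bump_def inner_time_dir)
  then show "cube_cutoff n R z = 0" unfolding cube_cutoff_split[OF space_dir_Basis(2)] by simp
  show "cube_cutoff_deriv n R e z = 0 \<or> e = time_dir"
  proof (cases "e = time_dir")
    case False
    then have "(\<Prod>b\<in>Basis-{e}. bump n R (z \<bullet> b)) = 0"
      using 0 space_dir_Basis(2) by (intro prod_zero) auto
    then show ?thesis by (simp add: cube_cutoff_deriv_def)
  qed simp
qed

text \<open>A cutoff of the cube times a weight \<open>\<omega>\<close> in time. The derivative \<open>- \<theta>\<close> of the weight has a favourable
  sign in the energy inequality, so that an arbitrary \<open>\<theta> \<ge> 0\<close> tests the energy of the time slices.\<close>

lemma cutoff_cube_weight:
  fixes \<omega> \<theta> :: "real \<Rightarrow> real"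
  assumes R: "0 < R" "R \<le> 1" and \<omega>: "\<And>s. (\<omega> has_real_derivative (- \<theta> s)) (at s)"
    and \<omega>b: "\<And>s. \<bar>s\<bar> \<le> 1 \<Longrightarrow> 0 \<le> \<omega> s" "\<And>s. \<bar>s\<bar> \<le> 1 \<Longrightarrow> \<omega> s \<le> I" and \<theta>: "\<And>s. \<bar>\<theta> s\<bar> \<le> 1"
  shows "cutoff (cube R :: ((real^'n::finite) \<times> real) set) (\<lambda>z. cube_cutoff n R z * \<omega> (snd z))
    (\<lambda>e z. cube_cutoff_deriv n R e z * \<omega> (snd z) + (if e = time_dir then - \<theta> (snd z) else 0) * cube_cutoff n R z)"
  unfolding cutoff_def
proof (intro conjI allI impI ballI)
  note c = cutoff_cube[OF R, of n, where 'a="(real^'n) \<times> real"]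
  note [measurable] = cutoffD(2)[OF c]
  have "continuous_on UNIV \<omega>" by (rule DERIV_continuous_on) (rule has_field_derivative_at_within[OF \<omega>])
  from borel_measurable_continuous_onI[OF this] have [measurable]: "\<omega> \<in> borel_measurable borel" .
  show "compact (cube R :: ((real^'n) \<times> real) set)" by (rule compact_cube)
  show "(\<lambda>z::(real^'n) \<times> real. cube_cutoff n R z * \<omega> (snd z)) \<in> borel_measurable borel" by measurable
  have I0: "0 \<le> I" using \<omega>b[of 0] by simp
  note b = cube_cutoff_bounds[OF R, where 'a="(real^'n) \<times> real" and n=n] and s0 = cube_cutoff_snd[OF R, of _ n]
  show "0 \<le> cube_cutoff n R z * \<omega> (snd z)" for z :: "(real^'n) \<times> real"
    using b(1)[of z] s0(1)[of z] \<omega>b(1)[of "snd z"] by (cases "\<bar>snd z\<bar> \<le> 1") auto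
  show "cube_cutoff n R z * \<omega> (snd z) = 0" if "z \<notin> cube R" for z :: "(real^'n) \<times> real"
    using b(3)[OF that] by simp
  have sndB: "\<bar>snd z\<bar> \<le> 1 \<or> z \<notin> cube R" for z :: "(real^'n) \<times> real"
    using R space_dir_Basis(2) inner_time_dir[of z] by (force simp: mem_cube)
  have bound: "\<bar>f z * \<omega> (snd z)\<bar> \<le> B * I" if "\<And>z. \<bar>f z\<bar> \<le> B" "\<And>z. z \<notin> cube R \<Longrightarrow> f z = 0"
    for f and z :: "(real^'n) \<times> real" and B
  proof (cases "\<bar>snd z\<bar> \<le> 1")
    case True
    then show ?thesis using that(1)[of z] \<omega>b[OF True] order_trans[OF abs_ge_zero that(1)[of z]]
      by (auto simp: abs_mult intro!: mult_mono)
  next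
    case False
    then show ?thesis using that sndB[of z] I0 order_trans[OF abs_ge_zero that(1)[of z]] by auto
  qed
  show "bounded_fun (\<lambda>z::(real^'n) \<times> real. cube_cutoff n R z * \<omega> (snd z))"
    by (rule bounded_funI, rule bound[of _ 1]) (use b in auto)
  fix e :: "(real^'n) \<times> real" assume e: "e \<in> Basis"
  have \<theta>z: "bounded_fun (\<lambda>z::(real^'n) \<times> real. (if e = time_dir then - \<theta> (snd z) else 0) * cube_cutoff n R z)"
    by (intro bounded_fun_mult cutoffD(5)[OF c] bounded_funI[of _ 1]) (use \<theta> in auto)
  have "bounded_fun (\<lambda>z::(real^'n) \<times> real. cube_cutoff_deriv n R e z * \<omega> (snd z))"
    by (rule bounded_funI, rule bound, rule cube_cutoff_deriv_bound[OF R]) (rule cutoffD(9)[OF c e])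
  from bounded_fun_add[OF this \<theta>z]
  show "bounded_fun (\<lambda>z::(real^'n) \<times> real. cube_cutoff_deriv n R e z * \<omega> (snd z) + (if e = time_dir then - \<theta> (snd z) else 0) * cube_cutoff n R z)" .
  fix z :: "(real^'n) \<times> real"
  have "has_dir_deriv (\<lambda>z. \<omega> (snd z)) e (if e = time_dir then - \<theta> (snd z) else 0) z"
  proof (cases "e = time_dir")
    case True
    have "((\<lambda>h. \<omega> (snd z + h)) has_real_derivative - \<theta> (snd z + 0) * 1) (at 0)"
      by (rule DERIV_chain2[OF \<omega>]) (auto intro!: derivative_eq_intros)
    then show ?thesis using True by (simp add: has_dir_deriv_def)
  next
    case False
    then have "snd e = 0" using e by (auto simp: Basis_prod_def)
    then show ?thesis using False by (simp add: has_dir_deriv_def)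
  qed
  from has_dir_deriv_mult[OF cube_cutoff_has_dir_deriv[OF e] this]
  show "has_dir_deriv (\<lambda>z. cube_cutoff n R z * \<omega> (snd z)) e
    (cube_cutoff_deriv n R e z * \<omega> (snd z) + (if e = time_dir then - \<theta> (snd z) else 0) * cube_cutoff n R z) z" .
qed

text \<open>Young's inequality with the weight \<open>g ^ (n + 2) * P\<close>, the value of the cutoff: the derivative of the
  cutoff is the cutoff times \<open>\<beta> / g\<close>, and the negative powers of \<open>g\<close> that Young's inequality produces
  are compensated by the weight because \<open>p \<le> n + 2\<close>.\<close>

lemma cutoff_young:
  fixes p :: real
  assumes V: "0 \<le> V" "V \<le> M" and a: "0 \<le> a" and g: "0 \<le> g" "g \<le> 1" and P: "0 \<le> P" "P \<le> 1"
    and d: "\<bar>d\<bar> \<le> \<beta> * g ^ (n + 1) * P" and p: "1 \<le> p" "p \<le> real n + 2" and \<beta>: "0 \<le> \<beta>"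
  shows "V\<^sup>2 * a powr (p - 1) * \<bar>d\<bar> \<le> V * a powr p * (g ^ (n + 2) * P) + M * (M * \<beta>) powr p"
proof (cases "g = 0")
  case True
  then have "d = 0" using d by simp
  then show ?thesis using True V by simp
next
  case False
  then have g0: "g > 0" using g by simp
  have "V\<^sup>2 * a powr (p - 1) * \<bar>d\<bar> \<le> V\<^sup>2 * a powr (p - 1) * (\<beta> * g ^ (n + 1) * P)"
    using V by (intro mult_left_mono d) auto
  also have "\<dots> = V * (g ^ (n + 2) * P) * (a powr (p - 1) * (V * \<beta> / g))"
    using g0 by (simp add: power2_eq_square field_simps)
  also have "\<dots> \<le> V * (g ^ (n + 2) * P) * (a powr p + (V * \<beta> / g) powr p)"
    using V g0 P p a \<beta> by (intro mult_left_mono powr_young) auto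
  also have "\<dots> = V * a powr p * (g ^ (n + 2) * P) + V * (g ^ (n + 2) * (V * \<beta> / g) powr p) * P"
    by (simp add: algebra_simps)
  also have "V * (g ^ (n + 2) * (V * \<beta> / g) powr p) * P \<le> M * (M * \<beta>) powr p * 1"
  proof (intro mult_mono)
    have "g ^ (n + 2) * (V * \<beta> / g) powr p = (V * \<beta>) powr p * (g powr (real n + 2) / g powr p)"
      using g0 V \<beta> powr_realpow[OF g0, of "n + 2"] by (simp add: powr_divide field_simps)
    also have "\<dots> \<le> (V * \<beta>) powr p * 1"
    proof (rule mult_left_mono)
      have "g powr (real n + 2) / g powr p = g powr (real n + 2 - p)" by (simp add: powr_diff)
      also have "\<dots> \<le> 1" using g0 g p by (intro powr_le1) auto
      finally show "g powr (real n + 2) / g powr p \<le> 1" .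
    qed simp
    finally have "g ^ (n + 2) * (V * \<beta> / g) powr p \<le> (V * \<beta>) powr p" by (simp only: mult_1_right)
    also have "\<dots> \<le> (M * \<beta>) powr p" using V \<beta> p by (intro powr_mono2 mult_right_mono) auto
    finally show "g ^ (n + 2) * (V * \<beta> / g) powr p \<le> (M * \<beta>) powr p" .
  qed (use V g0 P in auto)
  finally show ?thesis by simp
qed

text \<open>The constant of the energy estimate: the first term comes from the derivative of the cutoff in time,
  the others from those in space, by Young's inequality.\<close>

definition dg_const :: "('n::finite \<Rightarrow> real) \<Rightarrow> nat \<Rightarrow> real \<Rightarrow> real" where
  "dg_const p n M = M ^ 3 * (2 * real (n + 2)) + (\<Sum>i\<in>UNIV. M * (M * (2 * real (n + 2))) powr p i)"

definition sublevel :: "('a::euclidean_space \<Rightarrow> real) \<Rightarrow> real \<Rightarrow> real \<Rightarrow> 'a set" where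
  "sublevel u R k = {z \<in> cube R. u z < k}"

lemma sublevel_measurable: "u \<in> borel_measurable borel \<Longrightarrow> sublevel u R k \<in> sets borel"
proof -
  assume [measurable]: "u \<in> borel_measurable borel"
  have [measurable]: "(cube R :: 'a set) \<in> sets borel" by (rule borel_compact[OF compact_cube])
  have "sublevel u R k = cube R \<inter> {z. u z < k}" by (auto simp: sublevel_def)
  then show ?thesis by simp
qed

lemma sublevel_finite:
  fixes u :: "'a::euclidean_space \<Rightarrow> real"
  assumes "u \<in> borel_measurable borel"
  shows "emeasure lborel (sublevel u R k) < top"
proof -
  have "bounded (sublevel u R k)"
    by (rule bounded_subset[OF compact_imp_bounded[OF compact_cube[of R]]]) (auto simp: sublevel_def)
  from emeasure_bounded_finite[OF this] show ?thesis by simp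
qed

text \<open>The setting of one step of the iteration: a cube of half-side \<open>R\<close> and a level \<open>k\<close>. The lower bound \<open>m\<close> is
  required on the unit cube, so it is the same in all steps, and \<open>M\<close> bounds the truncation.\<close>

locale unit_cube_estimates =
  fixes U :: "((real^'n::finite) \<times> real) set" and p u Du and n :: nat and R k m M :: real
  assumes TE: "truncation_estimates U p u Du" and p: "\<And>i. p i > 2" and n: "\<And>i. p i \<le> real n + 2"
    and R: "0 < R" "R \<le> 1" and QU: "cube 1 \<subseteq> U"
    and m: "AE z in lborel. z \<in> cube 1 \<longrightarrow> m \<le> u z" and M: "0 < M" "k - m \<le> M"
begin

abbreviation (input) "Y \<equiv> measure lborel (sublevel u R k)"
abbreviation (input) "V \<equiv> \<lambda>z. truncation k (u z)"
abbreviation (input) "\<zeta> \<equiv> cube_cutoff n R"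

lemma VM: "AE z in lborel. 0 \<le> V z \<and> (z \<in> cube R \<longrightarrow> V z \<le> M)"
  using m
proof eventually_elim
  case (elim z)
  then show ?case using M cube_mono[OF R(2)] by (auto simp: truncation_def)
qed

lemma V_zero: "z \<in> cube R \<Longrightarrow> z \<notin> sublevel u R k \<Longrightarrow> V z = 0"
  by (auto simp: sublevel_def truncation_def)

lemma truncation_measurable: "truncation k \<in> borel_measurable borel"
  unfolding truncation_def[abs_def] by measurable

lemma bump_measurable: "cube_cutoff n R \<in> borel_measurable borel"
  by (rule cutoffD(2)[OF cutoff_cube[OF R]])

lemma dg_const_pos: "0 < dg_const p n M"
  unfolding dg_const_def using M by (intro add_pos_nonneg sum_nonneg) auto

lemma sublevel_integrable: "integrable lborel (indicator (sublevel u R k) :: _ \<Rightarrow> real)"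
  "(\<integral>z. indicator (sublevel u R k) z \<partial>lborel) = Y"
  using sublevel_measurable[OF truncation_estimatesD(1)[OF TE]] sublevel_finite[OF truncation_estimatesD(1)[OF TE]]
  by (auto intro!: integrable_real_indicator)

text \<open>In the energy inequality the term with the flux is estimated by \<open>cutoff_young\<close>, and half of the good
  energy term absorbs the part containing the gradient. What remains is bounded, and it vanishes outside
  the sublevel set because the truncation does, which gives the factor \<open>Y\<close>.\<close>

lemma caccioppoli:
  fixes \<omega> \<theta> :: "real \<Rightarrow> real"
  assumes \<omega>: "\<And>s. (\<omega> has_real_derivative (- \<theta> s)) (at s)"
    and \<omega>b: "\<And>s. \<bar>s\<bar> \<le> 1 \<Longrightarrow> 0 \<le> \<omega> s" "\<And>s. \<bar>s\<bar> \<le> 1 \<Longrightarrow> \<omega> s \<le> I"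
    and \<theta>: "\<And>s. 0 \<le> \<theta> s" "\<And>s. \<theta> s \<le> 1" "continuous_on UNIV \<theta>"
  shows "integrable lborel (\<lambda>z. V z ^ 3 / 3 * \<zeta> z * \<theta> (snd z))"
    "\<And>i. integrable lborel (\<lambda>z. V z * \<bar>Du i z\<bar> powr p i * \<zeta> z * \<omega> (snd z))"
    "(\<integral>z. V z ^ 3 / 3 * \<zeta> z * \<theta> (snd z) \<partial>lborel) + (\<Sum>i\<in>UNIV. \<integral>z. V z * \<bar>Du i z\<bar> powr p i * \<zeta> z * \<omega> (snd z) \<partial>lborel)
      \<le> dg_const p n M * I * Y"
proof -
  note D = truncation_estimatesD[OF TE]
  note [measurable] = D(1,2) truncation_measurable bump_measurable
  let ?\<beta> = "2 * real (n + 2)"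
  let ?A = "sublevel u R k"
  have I0: "0 \<le> I" using \<omega>b[of 0] by simp
  have "continuous_on UNIV \<omega>" by (rule DERIV_continuous_on) (rule has_field_derivative_at_within[OF \<omega>])
  note [measurable] = borel_measurable_continuous_onI[OF this] borel_measurable_continuous_onI[OF \<theta>(3)]
  note b = cube_cutoff_bounds[OF R, where 'a="(real^'n) \<times> real" and n=n]
  have sndB: "\<bar>snd z\<bar> \<le> 1" if "z \<in> cube R" for z :: "(real^'n) \<times> real"
    using that R space_dir_Basis(2) inner_time_dir[of z] by (force simp: mem_cube)
  let ?\<zeta>' = "\<lambda>e z. cube_cutoff_deriv n R e z * \<omega> (snd z) + (if e = time_dir then - \<theta> (snd z) else 0) * cube_cutoff n R z"
  have ct: "cutoff (cube R) (\<lambda>z. \<zeta> z * \<omega> (snd z)) ?\<zeta>'"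
    by (rule cutoff_cube_weight[OF R \<omega> \<omega>b]) (use \<theta> in auto)
  have RU: "cube R \<subseteq> U" using cube_mono[OF R(2)] QU by blast
  define E where "E = energy_density p k u Du (\<lambda>z. \<zeta> z * \<omega> (snd z)) ?\<zeta>'"
  have E: "integrable lborel E" "0 \<le> integral\<^sup>L lborel E"
    unfolding E_def by (rule D(4,5)[OF RU ct])+
  show i1: "integrable lborel (\<lambda>z. V z ^ 3 / 3 * \<zeta> z * \<theta> (snd z))"
  proof (rule integrableI_bounded_set[of "cube R" _ _ "M ^ 3"])
    show "emeasure lborel (cube R :: ((real^'n) \<times> real) set) < \<infinity>"
      by (intro emeasure_bounded_finite compact_imp_bounded compact_cube)
    show "cube R \<in> sets (lborel :: ((real^'n) \<times> real) measure)" using borel_compact[OF compact_cube[of R]] by simp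
    show "AE z in lborel. z \<in> cube R \<longrightarrow> norm (V z ^ 3 / 3 * \<zeta> z * \<theta> (snd z)) \<le> M ^ 3"
      using VM
    proof (eventually_elim, intro impI)
      fix z assume z: "0 \<le> V z \<and> (z \<in> cube R \<longrightarrow> V z \<le> M)" "z \<in> cube R"
      have "V z ^ 3 \<le> M ^ 3" using z by (intro power_mono) auto
      moreover have "0 \<le> V z ^ 3" using z by simp
      ultimately have "V z ^ 3 / 3 \<le> M ^ 3" by linarith
      then have "V z ^ 3 / 3 * \<zeta> z * \<theta> (snd z) \<le> M ^ 3 * 1 * 1"
        using z b(1,2)[of z] \<theta>(1,2)[of "snd z"] M by (intro mult_mono) auto
      then show "norm (V z ^ 3 / 3 * \<zeta> z * \<theta> (snd z)) \<le> M ^ 3"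
        using z b(1)[of z] \<theta>(1)[of "snd z"] by simp
    qed
  qed (use b(3) in auto)
  show i2: "integrable lborel (\<lambda>z. V z * \<bar>Du i z\<bar> powr p i * \<zeta> z * \<omega> (snd z))" for i
  proof (rule Bochner_Integration.integrable_bound)
    show "integrable lborel (\<lambda>z. M * I * (indicator (cube R) z * \<bar>Du i z\<bar> powr p i))"
      by (intro integrable_mult_right D(3) compact_cube RU)
    show "AE z in lborel. norm (V z * \<bar>Du i z\<bar> powr p i * \<zeta> z * \<omega> (snd z)) \<le> norm (M * I * (indicator (cube R) z * \<bar>Du i z\<bar> powr p i))"
      using VM
    proof eventually_elim
      case (elim z)
      show ?case
      proof (cases "z \<in> cube R")
        case True
        have c: "0 \<le> \<omega> (snd z)" "\<omega> (snd z) \<le> I" using \<omega>b[OF sndB[OF True]] by auto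
        have "V z * \<zeta> z * \<omega> (snd z) \<le> M * 1 * I"
          using elim True c b(1,2)[of z] M by (intro mult_mono) auto
        then have "V z * \<zeta> z * \<omega> (snd z) * \<bar>Du i z\<bar> powr p i \<le> M * 1 * I * \<bar>Du i z\<bar> powr p i"
          by (intro mult_right_mono) auto
        then show ?thesis using elim True c b(1)[of z] M I0 by (simp add: abs_mult mult_ac)
      qed (simp add: b(3))
    qed
  qed measurable
  have "AE z in lborel. E z + (V z ^ 3 / 3 * \<zeta> z * \<theta> (snd z) + (\<Sum>i\<in>UNIV. V z * \<bar>Du i z\<bar> powr p i * \<zeta> z * \<omega> (snd z)))
      \<le> dg_const p n M * I * indicator ?A z"
    using VM
  proof eventually_elim
    case (elim z)
    have eq: "E z + (V z ^ 3 / 3 * \<zeta> z * \<theta> (snd z) + (\<Sum>i\<in>UNIV. V z * \<bar>Du i z\<bar> powr p i * \<zeta> z * \<omega> (snd z)))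
      = V z ^ 3 / 3 * cube_cutoff_deriv n R time_dir z * \<omega> (snd z)
        + (\<Sum>i\<in>UNIV. (V z ^ 2 * flux (p i) (Du i z) * cube_cutoff_deriv n R (space_dir i) z - V z * \<bar>Du i z\<bar> powr p i * \<zeta> z) * \<omega> (snd z))"
      by (simp add: E_def energy_density_def algebra_simps sum.distrib sum_subtractf sum_distrib_left)
    show ?case
    proof (cases "z \<in> cube R")
      case False
      have "\<zeta> z = 0" "cube_cutoff_deriv n R time_dir z = 0" "cube_cutoff_deriv n R (space_dir i) z = 0" for i
        by (rule b(3)[OF False] cutoffD(9)[OF cutoff_cube[OF R] space_dir_Basis(1) False]
            cutoffD(9)[OF cutoff_cube[OF R] space_dir_Basis(2) False])+
      moreover have "z \<notin> ?A" using False by (auto simp: sublevel_def)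
      ultimately show ?thesis unfolding eq by simp
    next
      case True
      show ?thesis
      proof (cases "z \<in> ?A")
        case False
        then show ?thesis unfolding eq using V_zero[OF True] by simp
      next
        case zA: True
        have v: "0 \<le> V z" "V z \<le> M" using elim True by auto
        have c: "0 \<le> \<omega> (snd z)" "\<omega> (snd z) \<le> I" using \<omega>b[OF sndB[OF True]] by auto
        have "V z ^ 3 \<le> M ^ 3" using v by (intro power_mono) auto
        moreover have "0 \<le> V z ^ 3" using v by simp
        ultimately have V3: "0 \<le> V z ^ 3 / 3" "V z ^ 3 / 3 \<le> M ^ 3" by linarith+
        have "V z ^ 3 / 3 * cube_cutoff_deriv n R time_dir z \<le> V z ^ 3 / 3 * \<bar>cube_cutoff_deriv n R time_dir z\<bar>"
          using V3 by (intro mult_left_mono) auto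
        also have "\<dots> \<le> M ^ 3 * ?\<beta>"
          using V3 M by (intro mult_mono cube_cutoff_deriv_bound[OF R]) auto
        finally have "V z ^ 3 / 3 * cube_cutoff_deriv n R time_dir z * \<omega> (snd z) \<le> M ^ 3 * ?\<beta> * \<omega> (snd z)"
          using c by (intro mult_right_mono)
        also have "\<dots> \<le> M ^ 3 * ?\<beta> * I" using c M by (intro mult_left_mono) auto
        finally have t1: "V z ^ 3 / 3 * cube_cutoff_deriv n R time_dir z * \<omega> (snd z) \<le> M ^ 3 * ?\<beta> * I" .
        have t2: "(V z ^ 2 * flux (p i) (Du i z) * cube_cutoff_deriv n R (space_dir i) z - V z * \<bar>Du i z\<bar> powr p i * \<zeta> z) * \<omega> (snd z)
          \<le> M * (M * ?\<beta>) powr p i * I" for i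
        proof -
          let ?g = "max 0 (R\<^sup>2 - (z \<bullet> space_dir i)\<^sup>2)"
          let ?P = "\<Prod>b\<in>Basis-{space_dir i}. bump n R (z \<bullet> b)"
          have "V z ^ 2 * flux (p i) (Du i z) * cube_cutoff_deriv n R (space_dir i) z
            \<le> V z ^ 2 * (\<bar>flux (p i) (Du i z)\<bar> * \<bar>cube_cutoff_deriv n R (space_dir i) z\<bar>)"
            unfolding mult.assoc abs_mult[symmetric] by (intro mult_left_mono) auto
          also have "\<dots> = V z ^ 2 * \<bar>Du i z\<bar> powr (p i - 1) * \<bar>cube_cutoff_deriv n R (space_dir i) z\<bar>"
            by (simp add: abs_flux[OF p] mult.assoc)
          also have "\<dots> \<le> V z * \<bar>Du i z\<bar> powr p i * (?g ^ (n + 2) * ?P) + M * (M * ?\<beta>) powr p i"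
            by (rule cutoff_young[OF v _ bump_base_bounds[OF R] cube_cutoff_bounds(4,5)[OF R] cube_cutoff_deriv_bound(2)[OF R]])
              (use p[of i] n[of i] in auto)
          also have "?g ^ (n + 2) * ?P = \<zeta> z"
            unfolding cube_cutoff_split[OF space_dir_Basis(1)[of i]] bump_def by simp
          finally have "V z ^ 2 * flux (p i) (Du i z) * cube_cutoff_deriv n R (space_dir i) z - V z * \<bar>Du i z\<bar> powr p i * \<zeta> z
            \<le> M * (M * ?\<beta>) powr p i" by simp
          then have "(V z ^ 2 * flux (p i) (Du i z) * cube_cutoff_deriv n R (space_dir i) z - V z * \<bar>Du i z\<bar> powr p i * \<zeta> z) * \<omega> (snd z)
            \<le> M * (M * ?\<beta>) powr p i * \<omega> (snd z)" using c by (intro mult_right_mono)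
          also have "\<dots> \<le> M * (M * ?\<beta>) powr p i * I" using c M by (intro mult_left_mono) auto
          finally show ?thesis .
        qed
        show ?thesis
          unfolding eq
          using add_mono[OF t1 sum_mono[of UNIV, OF t2]] zA
          by (simp add: dg_const_def distrib_right sum_distrib_right)
      qed
    qed
  qed
  then have "(\<integral>z. E z + (V z ^ 3 / 3 * \<zeta> z * \<theta> (snd z) + (\<Sum>i\<in>UNIV. V z * \<bar>Du i z\<bar> powr p i * \<zeta> z * \<omega> (snd z))) \<partial>lborel)
      \<le> (\<integral>z. dg_const p n M * I * indicator ?A z \<partial>lborel)"
    by (rule integral_mono_AE[rotated 2])
      (intro Bochner_Integration.integrable_add Bochner_Integration.integrable_sum E i1 i2 integrable_mult_right sublevel_integrable)+
  also have "(\<integral>z. E z + (V z ^ 3 / 3 * \<zeta> z * \<theta> (snd z) + (\<Sum>i\<in>UNIV. V z * \<bar>Du i z\<bar> powr p i * \<zeta> z * \<omega> (snd z))) \<partial>lborel)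
      = integral\<^sup>L lborel E + ((\<integral>z. V z ^ 3 / 3 * \<zeta> z * \<theta> (snd z) \<partial>lborel) + (\<Sum>i\<in>UNIV. \<integral>z. V z * \<bar>Du i z\<bar> powr p i * \<zeta> z * \<omega> (snd z) \<partial>lborel))"
    using E i1 i2 by (simp add: Bochner_Integration.integral_add Bochner_Integration.integral_sum del: Bochner_Integration.integral_divide_zero Bochner_Integration.integral_mult_right_zero Bochner_Integration.integral_mult_left_zero)
  also have "(\<integral>z. dg_const p n M * I * indicator ?A z \<partial>lborel) = dg_const p n M * I * Y"
    using sublevel_integrable(2) by simp
  finally show "(\<integral>z. V z ^ 3 / 3 * \<zeta> z * \<theta> (snd z) \<partial>lborel) + (\<Sum>i\<in>UNIV. \<integral>z. V z * \<bar>Du i z\<bar> powr p i * \<zeta> z * \<omega> (snd z) \<partial>lborel)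
      \<le> dg_const p n M * I * Y" using E(2) by simp
qed

text \<open>The gradient of \<open>V\<^sup>2 * \<zeta>\<close> is bounded by a constant on the sublevel set plus \<open>2 * V * \<bar>Du i\<bar> * \<zeta>\<close>, and
  \<open>\<bar>Du i\<bar> \<le> 1 + \<bar>Du i\<bar> powr p i\<close> leads back to the energy estimate. Replacing the gradient by its
  power in this crude way loses no power of \<open>Y\<close>.\<close>

lemma truncation_translation:
  "(\<integral>z. \<bar>V (z + h *\<^sub>R space_dir i) ^ 2 * \<zeta> (z + h *\<^sub>R space_dir i) - V z ^ 2 * \<zeta> z\<bar> \<partial>lborel)
    \<le> \<bar>h\<bar> * ((M ^ 2 * (2 * real (n + 2)) + 2 * M + 2 * dg_const p n M) * Y)"
proof -
  note D = truncation_estimatesD[OF TE]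
  note [measurable] = D(1,2) truncation_measurable bump_measurable
  note c = cutoff_cube[OF R, of n, where 'a="(real^'n) \<times> real"]
  note [measurable] = cutoffD(8)[OF c space_dir_Basis(1)]
  let ?A = "sublevel u R k"
  have RU: "cube R \<subseteq> U" using cube_mono[OF R(2)] QU by blast
  note b = cube_cutoff_bounds[OF R, where 'a="(real^'n) \<times> real" and n=n]
  note C = caccioppoli[of "\<lambda>_. 1" "\<lambda>_. 0" 1]
  have iC: "integrable lborel (\<lambda>z. V z * \<bar>Du i z\<bar> powr p i * \<zeta> z)" for i
    using C(2)[of i] by simp
  have "(\<Sum>i\<in>UNIV. \<integral>z. V z * \<bar>Du i z\<bar> powr p i * \<zeta> z \<partial>lborel) \<le> dg_const p n M * Y"
    using C(3) by simp
  moreover have "(\<integral>z. V z * \<bar>Du i z\<bar> powr p i * \<zeta> z \<partial>lborel) \<le> (\<Sum>i\<in>UNIV. \<integral>z. V z * \<bar>Du i z\<bar> powr p i * \<zeta> z \<partial>lborel)"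
    using b(1) by (intro member_le_sum Bochner_Integration.integral_nonneg) (auto simp: truncation_def)
  ultimately have CY: "(\<integral>z. V z * \<bar>Du i z\<bar> powr p i * \<zeta> z \<partial>lborel) \<le> dg_const p n M * Y" by linarith
  let ?K = "M ^ 2 * (2 * real (n + 2)) + 2 * M"
  have pt: "AE z in lborel. \<bar>V z ^ 2 * cube_cutoff_deriv n R (space_dir i) z - 2 * V z * Du i z * \<zeta> z\<bar>
      \<le> ?K * indicator ?A z + 2 * (V z * \<bar>Du i z\<bar> powr p i * \<zeta> z)"
    using VM
  proof eventually_elim
    case (elim z)
    show ?case
    proof (cases "z \<in> ?A")
      case False
      show ?thesis
      proof (cases "z \<in> cube R")
        case True
        then show ?thesis using V_zero[OF True False] False by simp
      next
        case nc: False
        then show ?thesis using b(3)[OF nc] cutoffD(9)[OF c space_dir_Basis(1) nc] False by simp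
      qed
    next
      case zA: True
      then have True: "z \<in> cube R" by (auto simp: sublevel_def)
      have v: "0 \<le> V z" "V z \<le> M" using elim True by auto
      have "\<bar>V z ^ 2 * cube_cutoff_deriv n R (space_dir i) z - 2 * V z * Du i z * \<zeta> z\<bar>
        \<le> V z ^ 2 * \<bar>cube_cutoff_deriv n R (space_dir i) z\<bar> + 2 * V z * \<bar>Du i z\<bar> * \<zeta> z"
        using v b(1)[of z] by (intro order_trans[OF abs_triangle_ineq4]) (simp add: abs_mult)
      also have "\<dots> \<le> M ^ 2 * (2 * real (n + 2)) + 2 * V z * (1 + \<bar>Du i z\<bar> powr p i) * \<zeta> z"
        using v b(1)[of z] p[of i] power_mono[OF v(2,1), of 2]
        by (intro add_mono mult_mono mult_right_mono mult_left_mono cube_cutoff_deriv_bound[OF R] abs_le_one_plus_powr) auto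
      also have "\<dots> = M ^ 2 * (2 * real (n + 2)) + 2 * (V z * \<zeta> z) + 2 * (V z * \<bar>Du i z\<bar> powr p i * \<zeta> z)"
        by (simp add: algebra_simps)
      also have "V z * \<zeta> z \<le> M * 1" using v b(1,2)[of z] by (intro mult_mono) auto
      finally show ?thesis using zA by simp
    qed
  qed
  have "(\<integral>z. \<bar>V z ^ 2 * cube_cutoff_deriv n R (space_dir i) z - 2 * V z * Du i z * \<zeta> z\<bar> \<partial>lborel)
      \<le> (\<integral>z. ?K * indicator ?A z + 2 * (V z * \<bar>Du i z\<bar> powr p i * \<zeta> z) \<partial>lborel)"
  proof (rule integral_mono_AE[OF _ _ pt])
    show ii: "integrable lborel (\<lambda>z. ?K * indicator ?A z + 2 * (V z * \<bar>Du i z\<bar> powr p i * \<zeta> z))"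
      by (intro Bochner_Integration.integrable_add integrable_mult_right sublevel_integrable iC)
    show "integrable lborel (\<lambda>z. \<bar>V z ^ 2 * cube_cutoff_deriv n R (space_dir i) z - 2 * V z * Du i z * \<zeta> z\<bar>)"
      by (rule Bochner_Integration.integrable_bound[OF ii])
        (measurable, use pt in \<open>eventually_elim, auto intro: order_trans[OF _ abs_ge_self]\<close>)
  qed
  also have "\<dots> = ?K * (\<integral>z. indicator ?A z \<partial>lborel) + 2 * (\<integral>z. V z * \<bar>Du i z\<bar> powr p i * \<zeta> z \<partial>lborel)"
    using sublevel_integrable(1) iC[of i]
    by (subst Bochner_Integration.integral_add) (auto simp only: integrable_mult_right Bochner_Integration.integral_mult_right_zero)
  also have "\<dots> \<le> ?K * Y + 2 * (dg_const p n M * Y)"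
    unfolding sublevel_integrable(2) using CY by simp
  also have "\<dots> = (?K + 2 * dg_const p n M) * Y" by (simp add: algebra_simps)
  finally show ?thesis
    by (intro order_trans[OF D(6)[OF RU c]] mult_left_mono) auto
qed

text \<open>Let \<open>e t\<close> be the integral of \<open>V ^ 3 / 3 * \<zeta>\<close> over the slice at time \<open>t\<close>. For every continuous weight
  \<open>\<theta>\<close> the energy estimate, with \<open>\<omega>\<close> an antiderivative of \<open>- \<theta>\<close>, bounds the integral of \<open>e * \<theta>\<close> by a
  constant times the integral of \<open>\<theta>\<close>, and therefore bounds \<open>e\<close> almost everywhere. The square of
  \<open>V\<^sup>2 * \<zeta>\<close> is at most \<open>3 * M\<close> times \<open>V ^ 3 / 3 * \<zeta>\<close>.\<close>

lemma truncation_slices: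
  "AE t in lborel. (\<integral>\<^sup>+x. ennreal ((V (x, t) ^ 2 * \<zeta> (x, t)) ^ 2) \<partial>lborel) \<le> ennreal (3 * M * (dg_const p n M * Y))"
proof -
  note D = truncation_estimatesD[OF TE]
  note [measurable] = D(1,2) truncation_measurable bump_measurable
  note b = cube_cutoff_bounds[OF R, where 'a="(real^'n) \<times> real" and n=n]
  define q where "q z = V z ^ 3 / 3 * \<zeta> z" for z
  have qi: "integrable lborel q"
  proof -
    have "integrable lborel (\<lambda>z. V z ^ 3 / 3 * \<zeta> z * (\<lambda>_. 1) (snd z))"
      by (rule caccioppoli(1)[of "\<lambda>s. 1 - s" "\<lambda>_. 1" 2]) (auto intro!: derivative_eq_intros)
    then show ?thesis by (simp add: q_def[abs_def])
  qed
  have [measurable]: "q \<in> borel_measurable borel" unfolding q_def[abs_def] by measurable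
  have q0: "0 \<le> q z" for z using b(1)[of z] by (simp add: q_def truncation_def)
  have qi': "integrable (lborel \<Otimes>\<^sub>M lborel) (\<lambda>(x, t). q (x, t))" using qi by (simp add: lborel_prod)
  define e where "e t = (\<integral>x. q (x, t) \<partial>lborel)" for t
  have ei: "integrable lborel e"
    unfolding e_def using lborel_pair.integrable_snd[OF qi'] .
  have c0: "0 \<le> dg_const p n M * Y" using dg_const_pos by simp
  have ae: "AE t in lborel. e t \<le> dg_const p n M * Y"
  proof (rule AE_le_from_continuous_weights[OF ei _ c0])
    show "e t = 0" if "\<bar>t\<bar> > 1" for t
    proof -
      have "cube_cutoff n R (x, t) = 0" for x :: "real^'n"
        by (rule cube_cutoff_snd(1)[OF R]) (use that in simp)
      then show ?thesis by (simp add: e_def q_def)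
    qed
    fix \<theta> :: "real \<Rightarrow> real"
    assume \<theta>: "continuous_on UNIV \<theta>" "\<And>t. 0 \<le> \<theta> t" "\<And>t. \<theta> t \<le> 1"
    note [measurable] = borel_measurable_continuous_onI[OF \<theta>(1)]
    define I where "I = (\<integral>t. indicator {-2..2} t * \<theta> t \<partial>lborel)"
    \<comment> \<open>the antiderivative of \<open>- \<theta>\<close> that vanishes at the time 2, hence between 0 and \<open>I\<close> on the cube\<close>
    define \<omega> where "\<omega> s = I - (LBINT y=ereal (-2)..ereal s. \<theta> y)" for s
    have \<omega>: "(\<omega> has_real_derivative (- \<theta> s)) (at s)" for s
    proof -
      define l where "l = min (-2) s - 1"
      define r where "r = max (-2) s + 1"
      have lr: "l \<le> -2" "-2 \<le> r" "s \<in> {l<..<r}" by (auto simp: l_def r_def)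
      have "((\<lambda>u. LBINT y=ereal (-2)..ereal u. \<theta> y) has_vector_derivative \<theta> s) (at s within {l..r})"
        using lr by (intro interval_integral_FTC2) (auto intro: continuous_on_subset[OF \<theta>(1)])
      then have "((\<lambda>u. LBINT y=ereal (-2)..ereal u. \<theta> y) has_real_derivative \<theta> s) (at s)"
        using lr at_within_Icc_at[of l s r] by (simp add: has_real_derivative_iff_has_vector_derivative)
      then show ?thesis unfolding \<omega>_def by (auto intro!: derivative_eq_intros)
    qed
    have \<omega>2: "\<omega> 2 = 0" "\<omega> (-2) = I"
      by (simp_all add: \<omega>_def I_def interval_integral_Icc set_lebesgue_integral_def)
    have mono: "\<omega> t \<le> \<omega> s" if "s \<le> t" for s t
      by (rule DERIV_nonpos_imp_nonincreasing[OF that]) (use \<omega> \<theta>(2) in force)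
    have \<omega>b: "0 \<le> \<omega> s" "\<omega> s \<le> I" if "\<bar>s\<bar> \<le> 1" for s
      using mono[of s 2] mono[of "-2" s] that \<omega>2 by auto
    note C = caccioppoli[OF \<omega> \<omega>b \<theta>(2,3,1)]
    have "(\<integral>z. q z * \<theta> (snd z) \<partial>lborel) + (\<Sum>i\<in>UNIV. \<integral>z. V z * \<bar>Du i z\<bar> powr p i * \<zeta> z * \<omega> (snd z) \<partial>lborel)
        \<le> dg_const p n M * I * Y"
      unfolding q_def by (rule C(3))
    moreover have "0 \<le> (\<Sum>i\<in>UNIV. \<integral>z. V z * \<bar>Du i z\<bar> powr p i * \<zeta> z * \<omega> (snd z) \<partial>lborel)"
    proof (intro sum_nonneg Bochner_Integration.integral_nonneg)
      fix i and z :: "(real^'n) \<times> real"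
      show "0 \<le> V z * \<bar>Du i z\<bar> powr p i * \<zeta> z * \<omega> (snd z)"
        using \<omega>b(1)[of "snd z"] cube_cutoff_snd(1)[OF R, of z n] b(1)[of z]
        by (cases "\<bar>snd z\<bar> \<le> 1") (auto simp: truncation_def)
    qed
    ultimately have "(\<integral>z. q z * \<theta> (snd z) \<partial>lborel) \<le> dg_const p n M * I * Y" by linarith
    moreover have "(\<integral>t. e t * \<theta> t \<partial>lborel) = (\<integral>z. q z * \<theta> (snd z) \<partial>lborel)"
    proof -
      have "integrable (lborel \<Otimes>\<^sub>M lborel) (\<lambda>(x, t). q (x, t) * \<theta> t)"
        using C(1) by (simp add: lborel_prod q_def case_prod_unfold)
      from lborel_pair.integral_snd[OF this]
      show ?thesis by (simp add: e_def lborel_prod case_prod_unfold)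
    qed
    ultimately show "(\<integral>t. e t * \<theta> t \<partial>lborel) \<le> dg_const p n M * Y * (\<integral>t. indicator {-2..2} t * \<theta> t \<partial>lborel)"
      by (simp add: I_def mult_ac)
  qed
  have ae2: "AE t in lborel. integrable lborel (\<lambda>x. q (x, t))"
    using lborel_pair.AE_integrable_snd[OF qi'] .
  have ae3: "AE t in lborel. AE x in lborel. 0 \<le> V (x, t) \<and> ((x, t) \<in> cube R \<longrightarrow> V (x, t) \<le> M)"
    by (rule AE_lborel_slices[OF VM])
  show ?thesis
    using ae ae2 ae3
  proof eventually_elim
    case (elim t)
    have "(\<integral>\<^sup>+x. ennreal ((V (x, t) ^ 2 * \<zeta> (x, t)) ^ 2) \<partial>lborel) \<le> (\<integral>\<^sup>+x. ennreal (3 * M * q (x, t)) \<partial>lborel)"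
    proof (rule nn_integral_mono_AE)
      show "AE x in lborel. ennreal ((V (x, t) ^ 2 * \<zeta> (x, t)) ^ 2) \<le> ennreal (3 * M * q (x, t))"
        using elim(3)
      proof eventually_elim
        case (elim x)
        have "(V (x, t) ^ 2 * \<zeta> (x, t)) ^ 2 \<le> 3 * M * q (x, t)"
        proof (cases "(x, t) \<in> cube R")
          case True
          have "(V (x, t) ^ 2 * \<zeta> (x, t)) ^ 2 = V (x, t) ^ 3 * \<zeta> (x, t) * (V (x, t) * \<zeta> (x, t))"
            by (simp add: power2_eq_square power3_eq_cube)
          also have "\<dots> \<le> V (x, t) ^ 3 * \<zeta> (x, t) * (M * 1)"
            using elim True b(1,2)[of "(x, t)"] M by (intro mult_left_mono mult_mono) auto
          finally show ?thesis by (simp add: q_def mult_ac)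
        qed (simp add: b(3) q_def)
        then show ?case by (rule ennreal_leI)
      qed
    qed
    also have "\<dots> = ennreal (\<integral>x. 3 * M * q (x, t) \<partial>lborel)"
      using elim(2) M q0 by (intro nn_integral_eq_integral integrable_mult_right) auto
    also have "\<dots> = ennreal (3 * M * e t)" by (simp add: e_def)
    also have "\<dots> \<le> ennreal (3 * M * (dg_const p n M * Y))"
      using elim(1) M by (intro ennreal_leI mult_left_mono) auto
    finally show ?case .
  qed
qed

text \<open>On the smaller cube, \<open>u < k'\<close> forces \<open>V\<^sup>2 * \<zeta> \<ge> \<mu>\<close>, and the measure of that superlevel set is bounded by
  averaging over boxes of side \<open>\<delta>\<close>. With the least admissible \<open>\<delta>\<close>, a multiple of \<open>Y\<close> to the power
  \<open>1 / CARD('n)\<close>, the bound is superlinear in \<open>Y\<close>.\<close>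

lemma de_giorgi_step:
  assumes k': "k' < k" and R': "0 < R'" "R' < R"
    and \<mu>: "0 < \<mu>" "\<mu> \<le> (k - k')\<^sup>2 * ((R\<^sup>2 - R'\<^sup>2) ^ (n + 2)) ^ (CARD('n) + 1)"
    and \<delta>: "0 < \<delta>" "12 * M * dg_const p n M * Y \<le> \<delta> ^ CARD('n) * \<mu>\<^sup>2"
  shows "measure lborel (sublevel u R' k')
    \<le> 2 / \<mu> * real CARD('n) * \<delta> * ((M ^ 2 * (2 * real (n + 2)) + 2 * M + 2 * dg_const p n M) * Y)"
proof -
  note D = truncation_estimatesD[OF TE]
  note [measurable] = D(1,2) truncation_measurable bump_measurable
  note b = cube_cutoff_bounds[OF R, where 'a="(real^'n) \<times> real" and n=n]
  let ?C = "M ^ 2 * (2 * real (n + 2)) + 2 * M + 2 * dg_const p n M"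
  define w where "w z = V z ^ 2 * \<zeta> z" for z
  have [measurable]: "w \<in> borel_measurable borel" unfolding w_def[abs_def] by measurable
  have w0: "0 \<le> w z" for z using b(1)[of z] by (simp add: w_def)
  have wi: "integrable lborel w"
  proof (rule integrableI_bounded_set[of "cube R" _ _ "M ^ 2"])
    show "emeasure lborel (cube R :: ((real^'n) \<times> real) set) < \<infinity>"
      by (intro emeasure_bounded_finite compact_imp_bounded compact_cube)
    show "cube R \<in> sets (lborel :: ((real^'n) \<times> real) measure)" using borel_compact[OF compact_cube[of R]] by simp
    show "AE z in lborel. z \<in> cube R \<longrightarrow> norm (w z) \<le> M ^ 2"
      using VM
    proof (eventually_elim, intro impI)
      fix z assume z: "0 \<le> V z \<and> (z \<in> cube R \<longrightarrow> V z \<le> M)" "z \<in> cube R"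
      have "V z ^ 2 \<le> M ^ 2" using z by (intro power_mono) auto
      then have "V z ^ 2 * \<zeta> z \<le> M ^ 2 * 1" using b(1,2)[of z] by (intro mult_mono) auto
      then show "norm (w z) \<le> M ^ 2" using w0[of z] by (simp add: w_def)
    qed
  qed (use b(3) in \<open>auto simp: w_def\<close>)
  have C0: "0 \<le> ?C * Y" using M dg_const_pos by (intro mult_nonneg_nonneg add_nonneg_nonneg) auto
  have S0: "0 \<le> 3 * M * (dg_const p n M * Y)" using M dg_const_pos by simp
  have sub: "sublevel u R' k' \<subseteq> {z. \<mu> \<le> w z}"
  proof
    fix z assume z: "z \<in> sublevel u R' k'"
    then have uz: "u z < k'" and zc: "\<And>b. b \<in> Basis \<Longrightarrow> \<bar>z \<bullet> b\<bar> \<le> R'" by (auto simp: sublevel_def mem_cube)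
    have RR: "0 \<le> R\<^sup>2 - R'\<^sup>2" using R' by (simp add: power_mono less_imp_le)
    have bb: "(R\<^sup>2 - R'\<^sup>2) ^ (n + 2) \<le> bump n R (z \<bullet> b)" if "b \<in> Basis" for b
    proof -
      have "(z \<bullet> b)\<^sup>2 \<le> R'\<^sup>2" using zc[OF that] R' abs_le_square_iff[of "z \<bullet> b" R'] by simp
      then show ?thesis unfolding bump_def using RR by (intro power_mono) auto
    qed
    have "((R\<^sup>2 - R'\<^sup>2) ^ (n + 2)) ^ (CARD('n) + 1) = (\<Prod>b\<in>(Basis :: ((real^'n) \<times> real) set). (R\<^sup>2 - R'\<^sup>2) ^ (n + 2))"
      by simp
    also have "\<dots> \<le> \<zeta> z" unfolding cube_cutoff_def using bb RR by (intro prod_mono) auto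
    finally have z1: "((R\<^sup>2 - R'\<^sup>2) ^ (n + 2)) ^ (CARD('n) + 1) \<le> \<zeta> z" .
    have "(k - k')\<^sup>2 \<le> V z ^ 2" using uz k' by (intro power_mono) (auto simp: truncation_def)
    then have "(k - k')\<^sup>2 * ((R\<^sup>2 - R'\<^sup>2) ^ (n + 2)) ^ (CARD('n) + 1) \<le> w z"
      unfolding w_def using z1 RR by (intro mult_mono) auto
    then show "z \<in> {z. \<mu> \<le> w z}" using \<mu>(2) by simp
  qed
  have "emeasure lborel (sublevel u R' k') \<le> emeasure lborel {z. \<mu> \<le> w z}"
    by (intro emeasure_mono sub) simp
  also have "\<dots> \<le> ennreal (2 / \<mu> * real CARD('n) * \<delta> * (?C * Y))"
  proof (rule superlevel_measure_bound[OF _ w0 wi _ S0 _ C0 \<delta>(1) \<mu>(1)])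
    show "AE t in lborel. (\<integral>\<^sup>+x. ennreal ((w (x, t))\<^sup>2) \<partial>lborel) \<le> ennreal (3 * M * (dg_const p n M * Y))"
      unfolding w_def by (rule truncation_slices)
    show "(\<integral>z. \<bar>w (z + h *\<^sub>R space_dir i) - w z\<bar> \<partial>lborel) \<le> \<bar>h\<bar> * (?C * Y)" for i h
      unfolding w_def by (rule truncation_translation)
    show "4 * (3 * M * (dg_const p n M * Y)) \<le> \<delta> ^ CARD('n) * \<mu>\<^sup>2" using \<delta>(2) by (simp add: mult_ac)
  qed simp
  finally have "enn2real (emeasure lborel (sublevel u R' k')) \<le> enn2real (ennreal (2 / \<mu> * real CARD('n) * \<delta> * (?C * Y)))"
    by (rule enn2real_mono) simp
  also have "\<dots> = 2 / \<mu> * real CARD('n) * \<delta> * (?C * Y)"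
    using \<mu>(1) \<delta>(1) C0 by (intro enn2real_ennreal) auto
  finally show ?thesis by (simp add: measure_def)
qed

end

text \<open>The step is iterated with the half-sides \<open>1/2 + 2 ^ (- j - 1)\<close> and the levels \<open>k - gap * (1 - 2 ^ (- j))\<close>.
  The superlinear gain beats the growth of the constants if the measure at the start is small: it then
  decays like \<open>\<theta> ^ j\<close>, and the limit of the sublevel sets contains the set where \<open>u < k - gap\<close> on the
  cube of half-side \<open>1/2\<close>. The number \<open>\<nu>\<close> depends on \<open>p\<close>, \<open>M\<close> and \<open>gap\<close> alone, so it serves all scales.\<close>

theorem de_giorgi_lemma:
  fixes p :: "'n::finite \<Rightarrow> real"
  assumes p: "\<And>i. p i > 2" and M: "M > 0" and gap: "gap > 0"
  shows "\<exists>\<nu>>0. \<forall>U u Du k m. truncation_estimates U p u Du \<and> cube 1 \<subseteq> U \<and>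
    (AE z in lborel. z \<in> cube 1 \<longrightarrow> m \<le> u z) \<and> k - m \<le> M \<and> measure lborel (sublevel u 1 k) \<le> \<nu> \<longrightarrow>
    (AE z in lborel. z \<in> cube (1/2) \<longrightarrow> k - gap \<le> u z)"
proof -
  obtain n :: nat where "(\<Sum>i\<in>UNIV. p i) \<le> real n" using real_arch_simple by blast
  moreover have "p i \<le> (\<Sum>i\<in>UNIV. p i)" for i
    using p by (intro member_le_sum) (auto intro: less_imp_le[OF less_trans[of 0 2]])
  ultimately have n: "p i \<le> real n + 2" for i by (meson add_increasing2 order_trans zero_le_numeral)
  define N where "N = CARD('n)"
  have N: "real N > 0" by (simp add: N_def)
  define C1 where "C1 = dg_const p n M"
  have C1: "C1 > 0" unfolding C1_def dg_const_def using M by (intro add_pos_nonneg sum_nonneg) auto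
  define C2 where "C2 = M ^ 2 * (2 * real (n + 2)) + 2 * M + 2 * C1"
  have C2: "C2 > 0" unfolding C2_def using M C1 by (intro add_nonneg_pos) auto
  \<comment> \<open>\<open>x ^ j\<close> is the rate at which the lower bound of \<open>V\<^sup>2 * \<zeta>\<close> on the next sublevel set decays, so step \<open>j\<close>
    uses \<open>\<mu> * x ^ j\<close>, and \<open>\<delta> * x ^ j\<close> keeps the ratio of the two fixed. The slice condition compares \<open>Y\<close>
    with \<open>(\<delta> * x ^ j) ^ N * (\<mu> * x ^ j)\<^sup>2\<close>, which decays like \<open>\<theta> ^ j\<close> for \<open>\<theta> = x ^ (N + 2)\<close>. Then \<open>\<delta>\<close> is
    chosen such that the measure contracts by \<open>\<theta>\<close> in each step, and \<open>\<nu>\<close> such that the slice condition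
    holds at the start.\<close>
  define e where "e = 2 + (n + 2) * (N + 1)"
  define x :: real where "x = (1/2) ^ e"
  have "e > 0" by (simp add: e_def)
  then have x: "0 < x" "x < 1" by (auto simp: x_def power_less_one_iff)
  define \<mu> where "\<mu> = gap\<^sup>2 / 4 * (1/4) ^ ((n + 2) * (N + 1))"
  have \<mu>: "\<mu> > 0" using gap by (simp add: \<mu>_def)
  define \<theta> where "\<theta> = x ^ (N + 2)"
  have \<theta>: "0 < \<theta>" "\<theta> < 1" using x by (auto simp: \<theta>_def power_less_one_iff simp del: power_Suc)
  define \<delta> where "\<delta> = \<theta> * \<mu> / (2 * real N * C2)"
  have \<delta>: "\<delta> > 0" using \<theta> \<mu> N C2 by (simp add: \<delta>_def)
  define \<nu> where "\<nu> = \<delta> ^ N * \<mu>\<^sup>2 / (12 * M * C1)"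
  have \<nu>: "\<nu> > 0" using \<delta> \<mu> M C1 by (simp add: \<nu>_def)
  have main: "AE z in lborel. z \<in> cube (1/2) \<longrightarrow> k - gap \<le> u z"
    if TE: "truncation_estimates U p u Du" and QU: "cube 1 \<subseteq> U"
      and m: "AE z in lborel. z \<in> cube 1 \<longrightarrow> m \<le> u z" and km: "k - m \<le> M"
      and Y0: "measure lborel (sublevel u 1 k) \<le> \<nu>" for U u Du k m
  proof -
    define h :: "nat \<Rightarrow> real" where "h j = (1/2) ^ j" for j
    have h: "0 < h j" "h j \<le> 1" "h (Suc j) = h j / 2" for j by (auto simp: h_def power_le_one)
    define R where "R j = 1/2 + h j / 2" for j
    define K where "K j = k - gap * (1 - h j)" for j
    define Y where "Y j = measure lborel (sublevel u (R j) (K j))" for j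
    have um: "u \<in> borel_measurable borel" by (rule truncation_estimatesD(1)[OF TE])
    have R: "0 < R j" "R j \<le> 1" "0 < R (Suc j)" "R (Suc j) < R j" for j
      using h[of j] h(1)[of "Suc j"] by (auto simp: R_def)
    have K: "K (Suc j) < K j" "K j - m \<le> M" "K j - K (Suc j) = gap / 2 * h j" for j
    proof -
      have "0 < gap * h j" "0 \<le> gap * (1 - h j)" using gap h[of j] by auto
      then show "K (Suc j) < K j" "K j - m \<le> M" "K j - K (Suc j) = gap / 2 * h j"
        using km h(1)[of j] by (auto simp: K_def h(3) algebra_simps)
    qed
    have lev: "\<mu> * x ^ j \<le> (K j - K (Suc j))\<^sup>2 * (((R j)\<^sup>2 - (R (Suc j))\<^sup>2) ^ (n + 2)) ^ (N + 1)" for j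
    proof -
      have "(R j)\<^sup>2 - (R (Suc j))\<^sup>2 = (R j - R (Suc j)) * (R j + R (Suc j))"
        by (simp add: power2_eq_square algebra_simps)
      also have "R j - R (Suc j) = h j / 4" by (simp add: R_def h(3))
      finally have eq: "(R j)\<^sup>2 - (R (Suc j))\<^sup>2 = h j / 4 * (R j + R (Suc j))" .
      have "1 \<le> R j + R (Suc j)" using h(1)[of j] h(1)[of "Suc j"] by (simp add: R_def)
      then have "h j / 4 * 1 \<le> h j / 4 * (R j + R (Suc j))" using h(1)[of j] by (intro mult_left_mono) auto
      then have r: "h j / 4 \<le> (R j)\<^sup>2 - (R (Suc j))\<^sup>2" unfolding eq by simp
      have "x ^ j = h j ^ e" by (simp add: x_def h_def flip: power_mult) (simp add: mult.commute)
      also have "\<dots> = h j ^ 2 * h j ^ ((n + 2) * (N + 1))" unfolding e_def by (rule power_add)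
      finally have "\<mu> * x ^ j = (gap / 2 * h j)\<^sup>2 * (h j / 4) ^ ((n + 2) * (N + 1))"
        unfolding \<mu>_def by (simp only: power_mult_distrib power_divide power_one) (simp add: field_simps)
      also have "\<dots> = (K j - K (Suc j))\<^sup>2 * ((h j / 4) ^ (n + 2)) ^ (N + 1)"
        unfolding K(3) by (simp only: power_mult)
      also have "\<dots> \<le> (K j - K (Suc j))\<^sup>2 * (((R j)\<^sup>2 - (R (Suc j))\<^sup>2) ^ (n + 2)) ^ (N + 1)"
        using h(1)[of j] r by (intro mult_left_mono power_mono) auto
      finally show ?thesis .
    qed
    have Y: "Y j \<le> \<nu> * \<theta> ^ j" for j
    proof (induction j)
      case 0
      then show ?case using Y0 by (simp add: Y_def R_def K_def h_def)
    next
      case (Suc j)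
      have xj: "0 < x ^ j" using x by simp
      have A: "12 * M * C1 * Y j \<le> (\<delta> * x ^ j) ^ N * (\<mu> * x ^ j)\<^sup>2"
      proof -
        have "12 * M * C1 * Y j \<le> 12 * M * C1 * (\<nu> * \<theta> ^ j)"
          using M C1 by (intro mult_left_mono Suc) auto
        also have "\<dots> = \<delta> ^ N * \<mu>\<^sup>2 * \<theta> ^ j" using M C1 by (simp add: \<nu>_def)
        also have "\<theta> ^ j = (x ^ j) ^ N * (x ^ j) ^ 2"
          unfolding \<theta>_def power_mult[symmetric] power_add[symmetric]
          by (rule arg_cong[where f="\<lambda>k. x ^ k"]) (simp add: algebra_simps)
        also have "\<delta> ^ N * \<mu>\<^sup>2 * ((x ^ j) ^ N * (x ^ j) ^ 2) = (\<delta> * x ^ j) ^ N * (\<mu> * x ^ j)\<^sup>2"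
          by (simp only: power_mult_distrib mult_ac)
        finally show ?thesis .
      qed
      have "Y (Suc j) \<le> 2 / (\<mu> * x ^ j) * real N * (\<delta> * x ^ j) * (C2 * Y j)"
        unfolding Y_def C2_def C1_def N_def
        by (rule unit_cube_estimates.de_giorgi_step[OF unit_cube_estimates.intro[OF TE p n R(1,2) QU m M K(2)] K(1) R(3,4)])
          (use \<mu> xj \<delta> lev[of j] A in \<open>auto simp: N_def C1_def Y_def\<close>)
      also have "\<dots> = \<theta> * Y j" using \<mu> xj x N C2 by (simp add: \<delta>_def field_simps)
      also have "\<dots> \<le> \<theta> * (\<nu> * \<theta> ^ j)" using \<theta> by (intro mult_left_mono Suc) auto
      finally show ?case by (simp add: mult_ac)
    qed
    define B where "B = sublevel u (1/2) (k - gap)"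
    have Bm: "B \<in> sets borel" unfolding B_def by (rule sublevel_measurable[OF um])
    have BY: "measure lborel B \<le> \<nu> * \<theta> ^ j" for j
    proof -
      have "B \<subseteq> sublevel u (R j) (K j)"
      proof -
        have "cube (1/2) \<subseteq> cube (R j)" using h(1)[of j] by (intro cube_mono) (auto simp: R_def)
        moreover have "k - gap \<le> K j" using gap h(1)[of j] by (simp add: K_def algebra_simps)
        ultimately show ?thesis by (auto simp: B_def sublevel_def)
      qed
      then have "measure lborel B \<le> Y j"
        unfolding Y_def using sublevel_measurable[OF um] sublevel_finite[OF um]
        by (intro measure_mono_fmeasurable) (auto simp: Bm fmeasurable_def)
      then show ?thesis using Y[of j] by linarith
    qed
    have "(\<lambda>j. \<nu> * \<theta> ^ j) \<longlonglongrightarrow> \<nu> * 0"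
      using \<theta> by (intro tendsto_mult_left LIMSEQ_realpow_zero) auto
    then have "measure lborel B \<le> \<nu> * 0" by (rule LIMSEQ_le_const) (use BY in auto)
    then have "measure lborel B = 0" by (simp add: antisym)
    then have "emeasure lborel B = 0"
      using sublevel_finite[OF um, of "1/2" "k - gap"] unfolding B_def by (simp add: emeasure_eq_ennreal_measure)
    then have "AE z in lborel. z \<notin> B" using Bm by (intro AE_not_in) (auto simp: null_sets_def)
    then show ?thesis by eventually_elim (auto simp: B_def sublevel_def not_less)
  qed
  show ?thesis
    by (intro exI[of _ \<nu>] conjI allI impI \<nu>) ((elim conjE), (rule main; assumption))
qed

section \<open>From the unit cube to almost every point\<close>

lemma AE_diag:
  fixes a :: "'a::euclidean_space"
  assumes ae: "AE z in lborel. P z" and c: "\<And>b. b \<in> Basis \<Longrightarrow> c b > 0"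
  shows "AE z in lborel. P (a + diag c z)"
proof -
  obtain N where N: "N \<in> null_sets lborel" "{z \<in> space lborel. \<not> P z} \<subseteq> N"
    using ae unfolding eventually_ae_filter by auto
  then have [measurable]: "N \<in> sets borel" by (auto simp: null_sets_def)
  have "(\<integral>\<^sup>+z. indicator N z \<partial>lborel) = ennreal (\<Prod>b\<in>Basis. c b) * (\<integral>\<^sup>+z. indicator N (a + diag c z) \<partial>lborel)"
    by (rule nn_integral_diag[where f="\<lambda>_. 0" and c=c]) (use c in auto)
  moreover have "(\<integral>\<^sup>+z. indicator N z \<partial>lborel) = 0" using N(1) by (simp add: null_sets_def)
  moreover have "ennreal (\<Prod>b\<in>Basis. c b) \<noteq> 0" proof -
    have "0 < (\<Prod>b\<in>Basis. c b)" by (rule prod_pos) (rule c)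
    moreover have "ennreal P \<noteq> 0" if "0 < P" for P using that by (simp add: not_le)
    ultimately show ?thesis by blast
  qed
  ultimately have "(\<integral>\<^sup>+z. indicator N (a + diag c z) \<partial>lborel) = 0" by simp
  then have "AE z in lborel. indicator N (a + diag c z) = (0::ennreal)"
    by (subst (asm) nn_integral_0_iff_AE) measurable
  then show ?thesis by eventually_elim (use N(2) in \<open>auto simp: indicator_def split: if_splits\<close>)
qed

text \<open>The box with half-sides \<open>r powr (1 / p i)\<close> in space and \<open>r\<close> in time, described by its stretching factors.
  The description operator recovers the coordinate from the basis vector.\<close>

definition intrinsic_scale :: "('n::finite \<Rightarrow> real) \<Rightarrow> real \<Rightarrow> (real^'n) \<times> real \<Rightarrow> real" where
  "intrinsic_scale p r b = (if b = time_dir then r else r powr (1 / p (THE i. b = space_dir i)))"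

lemma intrinsic_scale_dirs:
  fixes p :: "'n::finite \<Rightarrow> real"
  shows "intrinsic_scale p r time_dir = r" "intrinsic_scale p r (space_dir i) = r powr (1 / p i)"
proof -
  have "(THE j. (space_dir i :: (real^'n) \<times> real) = space_dir j) = i" by (auto simp: axis_eq_axis)
  then show "intrinsic_scale p r (space_dir i) = r powr (1 / p i)" by (simp add: intrinsic_scale_def)
qed (simp add: intrinsic_scale_def)

lemma Basis_cases:
  assumes "b \<in> (Basis :: ((real^'n::finite) \<times> real) set)"
  obtains "b = time_dir" | i where "b = space_dir i"
  using assms by (auto simp: Basis_prod_def Basis_vec_def)

lemma intrinsic_scale_pos: "r > 0 \<Longrightarrow> b \<in> Basis \<Longrightarrow> intrinsic_scale p r b > 0"
  by (erule Basis_cases) (auto simp: intrinsic_scale_dirs)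

lemma intrinsic_scale_tendsto:
  assumes p: "\<And>i. p i > 0" and b: "b \<in> Basis"
  shows "(\<lambda>n. intrinsic_scale p (1 / real (Suc n)) b) \<longlonglongrightarrow> 0"
  using b
proof (cases rule: Basis_cases)
  case 1
  then show ?thesis using inverse_real_Suc_tendsto[of 1] by (simp add: intrinsic_scale_dirs)
next
  case (2 i)
  have "(\<lambda>n. (1 / real (Suc n)) powr (1 / p i)) \<longlonglongrightarrow> 0"
  proof (rule tendsto_zero_powrI[OF inverse_real_Suc_tendsto tendsto_const])
    show "\<forall>\<^sub>F n in sequentially. 0 \<le> 1 / real (Suc n)" by (intro always_eventually) simp
    show "0 < 1 / p i" using p[of i] by simp
  qed
  then show ?thesis using 2 by (simp add: intrinsic_scale_dirs)
qed

lemma norm_diag_le: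
  assumes "y \<in> cube 1" shows "norm (diag c y) \<le> (\<Sum>b\<in>Basis. \<bar>c b\<bar>)"
proof -
  have "norm (diag c y) \<le> (\<Sum>b\<in>Basis. \<bar>diag c y \<bullet> b\<bar>)" by (rule norm_le_l1)
  also have "\<dots> \<le> (\<Sum>b\<in>Basis. \<bar>c b\<bar>)"
    using assms by (intro sum_mono) (auto simp: diag_inner abs_mult mem_cube intro!: mult_left_le)
  finally show ?thesis .
qed

lemma diag_eventually_small:
  fixes c :: "nat \<Rightarrow> 'a::euclidean_space \<Rightarrow> real"
  assumes c: "\<And>b. b \<in> Basis \<Longrightarrow> (\<lambda>n. c n b) \<longlonglongrightarrow> 0" and d: "d > 0"
  shows "\<exists>n0. \<forall>n\<ge>n0. \<forall>y\<in>cube 1. norm (diag (c n) y) < d"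
proof -
  have "(\<lambda>n. \<Sum>b\<in>Basis. \<bar>c n b\<bar>) \<longlonglongrightarrow> (\<Sum>b\<in>(Basis::'a set). \<bar>0\<bar>)"
    by (intro tendsto_sum tendsto_rabs c)
  then have "\<forall>\<^sub>F n in sequentially. (\<Sum>b\<in>Basis. \<bar>c n b\<bar>) < d" using d by (intro order_tendstoD) auto
  then obtain n0 where n0: "\<And>n. n \<ge> n0 \<Longrightarrow> (\<Sum>b\<in>Basis. \<bar>c n b\<bar>) < d" by (auto simp: eventually_sequentially)
  show ?thesis
    by (intro exI[of _ n0] allI impI ballI) (rule le_less_trans[OF norm_diag_le n0])
qed

text \<open>Almost every point of \<open>A\<close> is a density point for the given boxes along some subsequence of scales. The
  mean over \<open>y\<close> in the cube of the measure of the points \<open>z \<in> A\<close> with \<open>z + diag (c n) y \<notin> A\<close> tends to zero,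
  because translations are continuous in the mean. By Tonelli and Markov's inequality the set of \<open>z \<in> A\<close>
  where the conclusion fails at scale \<open>n\<close> has measure tending to zero. This works
  for boxes of any shape, where an argument by coverings would have to compare boxes of different size.\<close>

lemma density_points:
  fixes A :: "'a::euclidean_space set" and c :: "nat \<Rightarrow> 'a \<Rightarrow> real"
  assumes [measurable]: "A \<in> sets borel" and A: "emeasure lborel A < top"
    and c: "\<And>b. b \<in> Basis \<Longrightarrow> (\<lambda>n. c n b) \<longlonglongrightarrow> 0" and \<nu>: "\<nu> > 0"
  shows "AE z in lborel. z \<in> A \<longrightarrow> (\<exists>n\<ge>l. emeasure lborel {y \<in> cube 1. z + diag (c n) y \<notin> A} \<le> ennreal \<nu>)"
proof -
  have [measurable]: "(cube 1 :: 'a set) \<in> sets borel" by (rule borel_compact[OF compact_cube])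
  define g where "g n z = (\<integral>\<^sup>+y. indicator (cube 1) y * (indicator A z * indicator (- A) (z + diag (c n) y)) \<partial>lborel)" for n z
  have [measurable]: "g n \<in> borel_measurable borel" for n unfolding g_def[abs_def] by measurable
  define B where "B n = {z. ennreal \<nu> \<le> g n z}" for n
  have [measurable]: "B n \<in> sets borel" for n unfolding B_def by measurable
  have "translation_continuous (indicat_real A)"
    by (rule translation_continuous_integrable) (use A in auto)
  let ?Q = "emeasure lborel (cube 1 :: 'a set)"
  have Q: "?Q < top" using emeasure_bounded_finite[OF compact_imp_bounded[OF compact_cube[of 1]]] by simp
  have small: "\<exists>n\<ge>l. emeasure lborel (B n) \<le> ennreal e" if e: "e > 0" for e
  proof -
    obtain q where q: "?Q = ennreal q" "q \<ge> 0" using Q by (cases ?Q) auto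
    define e' where "e' = e * \<nu> / (q + 1)"
    have e': "e' > 0" using e \<nu> q by (simp add: e'_def)
    obtain d where d: "d > 0" "\<And>h. norm h < d \<Longrightarrow> (\<integral>\<^sup>+x. ennreal \<bar>indicat_real A (x + h) - indicator A x\<bar> \<partial>lborel) \<le> ennreal e'"
      using \<open>translation_continuous (indicat_real A)\<close> e' unfolding translation_continuous_def by blast
    have "\<exists>n1. \<forall>n\<ge>n1. \<forall>y\<in>cube 1. norm (diag (c n) y) < d"
      by (rule diag_eventually_small[OF _ d(1)]) (rule c)
    then obtain n1 where n1: "\<And>n y. n \<ge> n1 \<Longrightarrow> y \<in> cube 1 \<Longrightarrow> norm (diag (c n) y) < d" by blast
    define n where "n = max l n1"
    have nd: "norm (diag (c n) y) < d" if "y \<in> cube 1" for y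
      by (rule n1[OF _ that]) (simp add: n_def)
    have "ennreal \<nu> * emeasure lborel (B n) = (\<integral>\<^sup>+z. ennreal \<nu> * indicator (B n) z \<partial>lborel)"
      by (rule nn_integral_cmult_indicator[symmetric]) simp
    also have "\<dots> \<le> (\<integral>\<^sup>+z. g n z \<partial>lborel)"
      by (intro nn_integral_mono) (auto simp: B_def indicator_def)
    also have "\<dots> = (\<integral>\<^sup>+y. (\<integral>\<^sup>+z. indicator (cube 1) y * (indicator A z * indicator (- A) (z + diag (c n) y)) \<partial>lborel) \<partial>lborel)"
      unfolding g_def
    proof (rule sym)
      have "(\<lambda>(z, y). indicator (cube 1) y * (indicator A z * indicator (- A) (z + diag (c n) y)) :: ennreal)
          \<in> borel_measurable (lborel \<Otimes>\<^sub>M lborel)"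
        by measurable
      from lborel_pair.Fubini'[OF this]
      show "(\<integral>\<^sup>+y. (\<integral>\<^sup>+z. indicator (cube 1) y * (indicator A z * indicator (- A) (z + diag (c n) y)) \<partial>lborel) \<partial>lborel)
        = (\<integral>\<^sup>+z. (\<integral>\<^sup>+y. indicator (cube 1) y * (indicator A z * indicator (- A) (z + diag (c n) y)) \<partial>lborel) \<partial>lborel)" .
    qed
    also have "\<dots> \<le> (\<integral>\<^sup>+y. ennreal e' * indicator (cube 1 :: 'a set) y \<partial>lborel)"
    proof (rule nn_integral_mono)
      fix y :: 'a
      show "(\<integral>\<^sup>+z. indicator (cube 1) y * (indicator A z * indicator (- A) (z + diag (c n) y)) \<partial>lborel) \<le> ennreal e' * indicator (cube 1) y"
      proof (cases "y \<in> cube 1")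
        case True
        have "(\<integral>\<^sup>+z. indicator A z * indicator (- A) (z + diag (c n) y) \<partial>lborel)
            \<le> (\<integral>\<^sup>+z. ennreal \<bar>indicat_real A (z + diag (c n) y) - indicator A z\<bar> \<partial>lborel)"
          by (intro nn_integral_mono) (auto simp: indicator_def)
        also have "\<dots> \<le> ennreal e'" by (rule d(2)[OF nd[OF True]])
        finally show ?thesis using True by simp
      qed simp
    qed
    also have "\<dots> = ennreal e' * ?Q" by (rule nn_integral_cmult_indicator) simp
    also have "\<dots> = ennreal (e' * q)" using q e' by (simp add: ennreal_mult)
    also have "\<dots> \<le> ennreal (\<nu> * e)"
    proof (rule ennreal_leI)
      have "e' * q \<le> e' * (q + 1)" using e' by simp
      also have "\<dots> = \<nu> * e" using q by (simp add: e'_def)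
      finally show "e' * q \<le> \<nu> * e" .
    qed
    also have "\<dots> = ennreal \<nu> * ennreal e" using \<nu> e by (intro ennreal_mult) auto
    finally have "ennreal \<nu> * emeasure lborel (B n) \<le> ennreal \<nu> * ennreal e" .
    moreover have "ennreal \<nu> \<noteq> 0" "ennreal \<nu> \<noteq> top" using \<nu> by (auto simp: not_le)
    ultimately have "emeasure lborel (B n) \<le> ennreal e"
      using ennreal_mult_le_mult_iff[THEN iffD1] by blast
    then show ?thesis by (intro exI[of _ n]) (simp add: n_def)
  qed
  have le: "emeasure lborel (\<Inter>n\<in>{l..}. B n) \<le> ennreal e" if e: "e > 0" for e
  proof -
    obtain n where n: "n \<ge> l" "emeasure lborel (B n) \<le> ennreal e" using small[OF e] by blast
    have "(\<Inter>n\<in>{l..}. B n) \<subseteq> B n" using n(1) by (intro INT_lower) simp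
    then have "emeasure lborel (\<Inter>n\<in>{l..}. B n) \<le> emeasure lborel (B n)" by (rule emeasure_mono) simp
    then show ?thesis using n(2) by (rule order_trans)
  qed
  have "emeasure lborel (\<Inter>n\<in>{l..}. B n) \<le> 0"
  proof (rule ennreal_le_epsilon)
    fix e :: real assume "0 < e"
    from le[OF this] show "emeasure lborel (\<Inter>n\<in>{l..}. B n) \<le> 0 + ennreal e" unfolding add_0_left .
  qed
  then have "emeasure lborel (\<Inter>n\<in>{l..}. B n) = 0" by (simp only: le_zero_eq)
  moreover have "(\<Inter>n\<in>{l..}. B n) \<in> sets lborel"
    by (rule sets.countable_INT') auto
  ultimately have "AE z in lborel. z \<notin> (\<Inter>n\<in>{l..}. B n)" by (intro AE_not_in) (auto simp: null_sets_def)
  then show ?thesis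
  proof (eventually_elim, intro impI)
    fix z assume "z \<notin> (\<Inter>n\<in>{l..}. B n)" and zA: "z \<in> A"
    then obtain n where n: "n \<ge> l" "g n z < ennreal \<nu>" by (auto simp: B_def not_le)
    have "g n z = (\<integral>\<^sup>+y. indicator {y \<in> cube 1. z + diag (c n) y \<notin> A} y \<partial>lborel)"
      unfolding g_def using zA by (intro nn_integral_cong) (auto simp: indicator_def)
    also have "\<dots> = emeasure lborel {y \<in> cube 1. z + diag (c n) y \<notin> A}"
    proof (rule nn_integral_indicator)
      have "{y \<in> cube 1. z + diag (c n) y \<notin> A} = cube 1 \<inter> ((\<lambda>y. z + diag (c n) y) -` (- A) \<inter> space borel)" by auto
      also have "\<dots> \<in> sets borel" by (intro sets.Int measurable_sets[of _ borel borel]) measurable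
      finally show "{y \<in> cube 1. z + diag (c n) y \<notin> A} \<in> sets lborel" by simp
    qed
    finally show "\<exists>n\<ge>l. emeasure lborel {y \<in> cube 1. z + diag (c n) y \<notin> A} \<le> ennreal \<nu>"
      using n by (intro exI[of _ n]) auto
  qed
qed

text \<open>At almost every point where \<open>u \<ge> k\<close>, the set where \<open>u < k\<close> occupies a fraction below the threshold of
  the De Giorgi lemma in some small intrinsic box. The rescaled function satisfies the same truncation
  estimates on the unit cube with the same bounds, so \<open>u \<ge> k - gap\<close> almost everywhere on half of the box.\<close>

theorem local_lower_bound_AE:
  fixes p :: "'n::finite \<Rightarrow> real"
  assumes TE: "truncation_estimates U p u Du" and U: "open U" and p: "\<And>i. p i > 2"
    and below: "\<And>C. compact C \<Longrightarrow> C \<subseteq> U \<Longrightarrow> \<exists>m. AE z in lborel. z \<in> C \<longrightarrow> m \<le> u z"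
    and C: "compact C" "C \<subseteq> U" and gap: "gap > 0"
  shows "AE z in lborel. z \<in> C \<and> k \<le> u z \<longrightarrow>
    (\<exists>V. open V \<and> z \<in> V \<and> (AE y in lborel. y \<in> V \<longrightarrow> k - gap \<le> u y))"
proof -
  have [measurable]: "u \<in> borel_measurable borel" by (rule truncation_estimatesD(1)[OF TE])
  obtain d C' where d: "d > 0" and C': "compact C'" and C'U: "C' \<subseteq> U"
    and ballC': "\<And>z. z \<in> C \<Longrightarrow> cball z d \<subseteq> C'"
    using compact_neighbourhood[OF C(1) U C(2)] by blast
  have [measurable]: "C' \<in> sets borel" using C' by (rule borel_compact)
  have inC': "z + y \<in> C'" if "z \<in> C" "norm y \<le> d" for z y
    using ballC'[OF that(1)] that(2) by (force simp: dist_norm)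
  obtain m where m: "AE z in lborel. z \<in> C' \<longrightarrow> m \<le> u z" using below[OF C' C'U] by blast
  define M where "M = max 1 (k - m)"
  have M: "M > 0" "k - m \<le> M" by (auto simp: M_def)
  from de_giorgi_lemma[of p, OF p M(1) gap] obtain \<nu> where \<nu>: "\<nu> > 0"
    and DG0: "\<forall>U u Du k m. truncation_estimates U p u Du \<and> cube 1 \<subseteq> U \<and>
    (AE z in lborel. z \<in> cube 1 \<longrightarrow> m \<le> u z) \<and> k - m \<le> M \<and> measure lborel (sublevel u 1 k) \<le> \<nu> \<longrightarrow>
    (AE z in lborel. z \<in> cube (1/2) \<longrightarrow> k - gap \<le> u z)"
    by (elim exE conjE) (rule that)
  note DG = DG0[rule_format, OF conjI[OF _ conjI[OF _ conjI[OF _ conjI]]]]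
  define c where "c n = intrinsic_scale p (1 / real (Suc n))" for n
  have cpos: "b \<in> Basis \<Longrightarrow> c n b > 0" for n b unfolding c_def by (rule intrinsic_scale_pos) auto
  have p0: "p i > 0" for i using p[of i] by simp
  have c0: "b \<in> Basis \<Longrightarrow> (\<lambda>n. c n b) \<longlonglongrightarrow> 0" for b unfolding c_def by (rule intrinsic_scale_tendsto[OF p0])
  have cp: "c n (space_dir i) powr p i = c n time_dir" for n i
    using p0[of i] by (simp add: c_def intrinsic_scale_dirs powr_powr)
  have "\<exists>n0. \<forall>n\<ge>n0. \<forall>y\<in>cube 1. norm (diag (c n) y) < d"
    by (rule diag_eventually_small[OF _ d]) (rule c0)
  then obtain n0 where n0: "\<And>n y. n \<ge> n0 \<Longrightarrow> y \<in> cube 1 \<Longrightarrow> norm (diag (c n) y) < d" by blast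
  have nd: "norm (diag (c n) y) \<le> d" if "y \<in> cube 1" "n \<ge> n0" for y n
    using n0[OF that(2,1)] by simp
  define A where "A = C' \<inter> {z. k \<le> u z}"
  have Am: "A \<in> sets borel" unfolding A_def by measurable
  have "bounded A" by (rule bounded_subset[OF compact_imp_bounded[OF C']]) (auto simp: A_def)
  then have Af: "emeasure lborel A < top" using emeasure_bounded_finite by fastforce
  have dp: "AE z in lborel. z \<in> A \<longrightarrow> (\<exists>n\<ge>n0. emeasure lborel {y \<in> cube 1. z + diag (c n) y \<notin> A} \<le> ennreal \<nu>)"
    by (rule density_points[OF Am Af _ \<nu>]) (rule c0)
  show ?thesis
    using dp
  proof (eventually_elim, intro impI)
    fix z assume z: "z \<in> A \<longrightarrow> (\<exists>n\<ge>n0. emeasure lborel {y \<in> cube 1. z + diag (c n) y \<notin> A} \<le> ennreal \<nu>)"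
      and zC: "z \<in> C \<and> k \<le> u z"
    have "z \<in> C'" using inC'[of z 0] zC d by simp
    with z zC obtain n where n: "n \<ge> n0" "emeasure lborel {y \<in> cube 1. z + diag (c n) y \<notin> A} \<le> ennreal \<nu>"
      by (auto simp: A_def)
    let ?S = "\<lambda>y. z + diag (c n) y"
    let ?v = "\<lambda>y. u (?S y)"
    have SC': "?S y \<in> C'" if "y \<in> cube 1" for y using inC' nd[OF that n(1)] zC by blast
    have TE': "truncation_estimates (?S -` U) p ?v (\<lambda>i y. c n (space_dir i) * Du i (?S y))"
      by (rule truncation_estimates_scale[OF TE p cpos cp])
    have QU: "cube 1 \<subseteq> ?S -` U" using SC' C'U by auto
    have m': "AE y in lborel. y \<in> cube 1 \<longrightarrow> m \<le> ?v y"
    proof -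
      have "AE y in lborel. ?S y \<in> C' \<longrightarrow> m \<le> ?v y" by (rule AE_diag[OF m]) (rule cpos)
      then show ?thesis by eventually_elim (use SC' in auto)
    qed
    have "sublevel ?v 1 k = {y \<in> cube 1. z + diag (c n) y \<notin> A}"
      using SC' by (auto simp: sublevel_def A_def not_le)
    then have "measure lborel (sublevel ?v 1 k) \<le> \<nu>"
      using n(2) \<nu> by (simp add: measure_def enn2real_leI)
    from DG[OF TE' QU m' M(2) this]
    have half: "AE y in lborel. y \<in> cube (1/2) \<longrightarrow> k - gap \<le> ?v y" .
    let ?d = "\<lambda>b. 1 / c n b"
    have dpos: "b \<in> Basis \<Longrightarrow> ?d b > 0" for b using cpos by simp
    \<comment> \<open>\<open>?T\<close> is the inverse of \<open>?S\<close>, in the form \<open>a + diag d w\<close> of the change of variables\<close>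
    let ?T = "\<lambda>w. - diag ?d z + diag ?d w"
    have ST: "?S (?T w) = w" for w
    proof -
      have "?T w = diag ?d (w - z)" using diag_add[of ?d w "- z"] by (simp add: diag_minus)
      then have "?S (?T w) = z + diag (c n) (diag ?d (w - z))" by simp
      also have "diag (c n) (diag ?d (w - z)) = w - z"
      proof (rule diag_diag)
        fix b :: "(real^'n) \<times> real" assume "b \<in> Basis"
        from cpos[OF this, of n] show "c n b * (1 / c n b) = 1" by simp
      qed
      finally show ?thesis by simp
    qed
    have "AE w in lborel. ?T w \<in> cube (1/2) \<longrightarrow> k - gap \<le> ?v (?T w)"
      by (rule AE_diag[OF half dpos])
    then have lower: "AE w in lborel. ?T w \<in> cube (1/2) \<longrightarrow> k - gap \<le> u w" by (simp only: ST)
    define V where "V = ?T -` interior (cube (1/2))"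
    have "open V" unfolding V_def
      by (rule open_vimage[OF open_interior continuous_on_diag])
    moreover have "z \<in> V"
    proof -
      have "0 \<in> ball (0::(real^'n) \<times> real) (1/2)" by simp
      moreover have "ball (0::(real^'n) \<times> real) (1/2) \<subseteq> cube (1/2)"
      proof
        fix y :: "(real^'n) \<times> real" assume "y \<in> ball 0 (1/2)"
        then have "norm y \<le> 1/2" by simp
        then show "y \<in> cube (1/2)" unfolding mem_cube using Basis_le_norm order_trans by blast
      qed
      ultimately have "0 \<in> interior (cube (1/2) :: ((real^'n) \<times> real) set)"
        using interior_maximal[OF _ open_ball] by blast
      then show ?thesis by (simp add: V_def)
    qed
    moreover have "AE y in lborel. y \<in> V \<longrightarrow> k - gap \<le> u y"
      using lower by eventually_elim (use interior_subset in \<open>auto simp: V_def\<close>)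
    ultimately show "\<exists>V. open V \<and> z \<in> V \<and> (AE y in lborel. y \<in> V \<longrightarrow> k - gap \<le> u y)" by blast
  qed
qed

section \<open>The essential lower limit\<close>

text \<open>The limit of the essential infima of \<open>u\<close> over shrinking neighbourhoods, written as the supremum of all
  essential lower bounds near \<open>z\<close>.\<close>

definition ess_lower_limit :: "'a::euclidean_space set \<Rightarrow> ('a \<Rightarrow> real) \<Rightarrow> 'a \<Rightarrow> ereal" where
  "ess_lower_limit U u z = Sup {ereal q | q. \<exists>V. open V \<and> z \<in> V \<and> (AE y in lborel. y \<in> V \<inter> U \<longrightarrow> q \<le> u y)}"

lemma ess_lower_limit_ge:
  "open V \<Longrightarrow> z \<in> V \<Longrightarrow> (AE y in lborel. y \<in> V \<inter> U \<longrightarrow> q \<le> u y) \<Longrightarrow> ereal q \<le> ess_lower_limit U u z"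
  unfolding ess_lower_limit_def by (rule Sup_upper) blast

text \<open>An essential lower bound on a neighbourhood of \<open>z\<close> is one near every point of that neighbourhood.\<close>

lemma lower_semicontinuous_ess_lower_limit: "lower_semicontinuous_on U (ess_lower_limit U u)"
  unfolding lower_semicontinuous_on_def
proof
  fix z assume z: "z \<in> U"
  show "ess_lower_limit U u z \<le> Liminf (at z within U) (ess_lower_limit U u)"
    unfolding ess_lower_limit_def[of U u z]
  proof (rule Sup_least, clarify)
    fix q V assume V: "open V" "z \<in> V" "AE y in lborel. y \<in> V \<inter> U \<longrightarrow> q \<le> u y"
    have "\<forall>\<^sub>F y in at z within U. y \<in> V" using V by (auto simp: eventually_at_topological)
    then have "\<forall>\<^sub>F y in at z within U. ereal q \<le> ess_lower_limit U u y"
      by eventually_elim (rule ess_lower_limit_ge[OF V(1) _ V(3)])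
    then show "ereal q \<le> Liminf (at z within U) (ess_lower_limit U u)" by (rule Liminf_bounded)
  qed
qed

text \<open>It suffices to consider neighbourhoods in a countable base and rational lower bounds, and for each of
  these countably many pairs the lower bound fails on a null set only.\<close>

lemma ess_lower_limit_le_AE: "AE z in lborel. z \<in> U \<longrightarrow> ess_lower_limit U u z \<le> ereal (u z)"
proof -
  obtain \<B> :: "'a set set" where \<B>: "countable \<B>" "\<And>B. B \<in> \<B> \<Longrightarrow> open B"
    "\<And>S. open S \<Longrightarrow> \<exists>\<C>\<subseteq>\<B>. S = \<Union>\<C>"
    using univ_second_countable by metis
  have "AE z in lborel. \<forall>B\<in>\<B>. \<forall>q\<in>\<rat>. (AE y in lborel. y \<in> B \<inter> U \<longrightarrow> q \<le> u y) \<longrightarrow> z \<in> B \<inter> U \<longrightarrow> q \<le> u z"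
  proof (intro AE_ball_countable[THEN iffD2, rule_format] \<B>(1) countable_rat)
    fix B and q :: real
    show "AE z in lborel. (AE y in lborel. y \<in> B \<inter> U \<longrightarrow> q \<le> u y) \<longrightarrow> z \<in> B \<inter> U \<longrightarrow> q \<le> u z"
      by (cases "AE y in lborel. y \<in> B \<inter> U \<longrightarrow> q \<le> u y") auto
  qed
  then show ?thesis
  proof (eventually_elim, intro impI)
    fix z assume *: "\<forall>B\<in>\<B>. \<forall>q\<in>\<rat>. (AE y in lborel. y \<in> B \<inter> U \<longrightarrow> q \<le> u y) \<longrightarrow> z \<in> B \<inter> U \<longrightarrow> q \<le> u z"
      and z: "z \<in> U"
    show "ess_lower_limit U u z \<le> ereal (u z)"
      unfolding ess_lower_limit_def
    proof (rule Sup_least, clarify)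
      fix q V assume V: "open V" "z \<in> V" "AE y in lborel. y \<in> V \<inter> U \<longrightarrow> q \<le> u y"
      obtain B where B: "B \<in> \<B>" "z \<in> B" "B \<subseteq> V" using \<B>(3)[OF V(1)] V(2) by blast
      have "q \<le> u z"
      proof (rule field_le_epsilon)
        fix e :: real assume "e > 0"
        then obtain q' where q': "q' \<in> \<rat>" "q - e < q'" "q' < q" using Rats_dense_in_real[of "q - e" q] by auto
        have "AE y in lborel. y \<in> B \<inter> U \<longrightarrow> q' \<le> u y" using V(3) by eventually_elim (use B q' in force)
        then have "q' \<le> u z" using * B q'(1) z by blast
        then show "q \<le> u z + e" using q' by simp
      qed
      then show "ereal q \<le> ereal (u z)" by simp
    qed
  qed
qed

theorem theorem4p1:
  fixes \<Omega> :: "(real^'n::{finite,linorder}) set"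
    and T :: real
    and p :: "'n \<Rightarrow> real"
    and u :: "(real^'n::_) \<times> real \<Rightarrow> real"
  assumes "CARD('n) > 1"
    and "open \<Omega>" and "bounded \<Omega>" and "T > 0"
    and "mono p"
    and "\<forall>i. 2 < p i"
    and "harmonic_mean p < real CARD('n)"
    and "\<forall>i. p i < sobolev_conjugate CARD('n) (harmonic_mean p)"
    and "local_weak_supersolution p \<Omega> T u"
    and "locally_bounded_below_on (cylinder \<Omega> T) u"
  shows "\<exists>v :: (real^'n::_) \<times> real \<Rightarrow> ereal.
           lower_semicontinuous_on (cylinder \<Omega> T) v \<and>
           (\<forall>z\<in>cylinder \<Omega> T. v z \<noteq> -\<infinity>) \<and>
           (AE z in lebesgue. z \<in> cylinder \<Omega> T \<longrightarrow> v z = ereal (u z))"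
proof (intro exI conjI)
  let ?U = "cylinder \<Omega> T"
  let ?v = "ess_lower_limit ?U u"
  have p: "p i > 2" for i using assms(6) by blast
  have U: "open ?U" by (rule open_cylinder[OF assms(2)])
  have below: "\<exists>m. AE z in lborel. z \<in> C \<longrightarrow> m \<le> u z" if "compact C" "C \<subseteq> ?U" for C
    using assms(10) that unfolding locally_bounded_below_on_def AE_completion_iff by blast
  obtain u' Du where ks: "kernel_supersolution ?U p u' Du"
    and u': "AE z in lborel. z \<in> ?U \<longrightarrow> u' z = u z"
    using kernel_supersolution_representative[OF assms(9,2,4) p] by blast
  have below': "\<exists>m. AE z in lborel. z \<in> C \<longrightarrow> m \<le> u' z" if C: "compact C" "C \<subseteq> ?U" for C
  proof -
    obtain m where "AE z in lborel. z \<in> C \<longrightarrow> m \<le> u z" using below[OF C] by blast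
    then have "AE z in lborel. z \<in> C \<longrightarrow> m \<le> u' z" using u' by eventually_elim (use C(2) in auto)
    then show ?thesis by blast
  qed
  have TE: "truncation_estimates ?U p u' Du"
    by (rule truncation_estimates_supersolution[OF ks U p below'])
  show "lower_semicontinuous_on ?U ?v" by (rule lower_semicontinuous_ess_lower_limit)
  show "\<forall>z\<in>?U. ?v z \<noteq> -\<infinity>"
  proof
    fix z assume "z \<in> ?U"
    then obtain r where r: "r > 0" "cball z r \<subseteq> ?U" using U open_contains_cball by blast
    obtain m where "AE y in lborel. y \<in> cball z r \<longrightarrow> m \<le> u y" using below[OF compact_cball r(2)] by blast
    then have "AE y in lborel. y \<in> ball z r \<inter> ?U \<longrightarrow> m \<le> u y" by eventually_elim auto
    then have "ereal m \<le> ?v z" using r(1) by (intro ess_lower_limit_ge[of "ball z r"]) auto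
    then show "?v z \<noteq> -\<infinity>" by auto
  qed
  \<comment> \<open>compact sets exhausting the cylinder, rational levels and gaps \<open>1 / (l + 1)\<close>: countably many
    exceptional null sets\<close>
  obtain C where C: "\<And>j::nat. compact (C j)" "\<And>j. C j \<subseteq> ?U" "\<Union>(range C) = ?U"
    using open_Union_compact_subsets[OF U] by metis
  have "AE z in lborel. \<forall>j::nat. \<forall>k\<in>\<rat>. \<forall>l::nat. z \<in> C j \<and> k \<le> u' z \<longrightarrow>
      (\<exists>V. open V \<and> z \<in> V \<and> (AE y in lborel. y \<in> V \<longrightarrow> k - 1 / real (Suc l) \<le> u' y))"
  proof (intro AE_all_countable[THEN iffD2] AE_ball_countable[THEN iffD2] countable_rat allI ballI)
    fix j l :: nat and k :: real
    show "AE z in lborel. z \<in> C j \<and> k \<le> u' z \<longrightarrow>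
      (\<exists>V. open V \<and> z \<in> V \<and> (AE y in lborel. y \<in> V \<longrightarrow> k - 1 / real (Suc l) \<le> u' y))"
      by (rule local_lower_bound_AE[OF TE U p below' C(1,2)]) simp_all
  qed
  then have "AE z in lborel. z \<in> ?U \<longrightarrow> ereal (u z) \<le> ?v z"
    using u'
  proof (eventually_elim, intro impI)
    fix z
    assume *: "\<forall>j::nat. \<forall>k\<in>\<rat>. \<forall>l::nat. z \<in> C j \<and> k \<le> u' z \<longrightarrow>
      (\<exists>V. open V \<and> z \<in> V \<and> (AE y in lborel. y \<in> V \<longrightarrow> k - 1 / real (Suc l) \<le> u' y))"
      and uz: "z \<in> ?U \<longrightarrow> u' z = u z" and z: "z \<in> ?U"
    obtain j where j: "z \<in> C j" using z C(3) by blast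
    show "ereal (u z) \<le> ?v z"
    proof (rule ereal_le_epsilon2)
      fix e :: real assume e: "0 < e"
      obtain k where k: "k \<in> \<rat>" "u z - e / 2 < k" "k < u z" using Rats_dense_in_real[of "u z - e / 2" "u z"] e by auto
      obtain l where l: "1 / real (Suc l) < e / 2" using reals_Archimedean[of "e / 2"] e by (auto simp: inverse_eq_divide)
      obtain V where V: "open V" "z \<in> V" "AE y in lborel. y \<in> V \<longrightarrow> k - 1 / real (Suc l) \<le> u' y"
      proof -
        have "k \<le> u' z" using k uz z by simp
        from *[rule_format, OF k(1) conjI[OF j this], of l] that show ?thesis by blast
      qed
      have "AE y in lborel. y \<in> V \<inter> ?U \<longrightarrow> k - 1 / real (Suc l) \<le> u y"
        using V(3) u' by eventually_elim auto
      then have "ereal (k - 1 / real (Suc l)) \<le> ?v z" by (rule ess_lower_limit_ge[OF V(1,2)])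
      then have "ereal (k - 1 / real (Suc l)) + ereal e \<le> ?v z + ereal e" by (rule add_right_mono)
      then have *: "ereal (k - 1 / real (Suc l) + e) \<le> ?v z + ereal e" by (simp only: plus_ereal.simps)
      have "u z \<le> k - 1 / real (Suc l) + e" using k l by linarith
      then have "ereal (u z) \<le> ereal (k - 1 / real (Suc l) + e)" by (simp only: ereal_less_eq)
      then show "ereal (u z) \<le> ?v z + ereal e" using * by (rule order_trans)
    qed
  qed
  with ess_lower_limit_le_AE[of ?U u] have "AE z in lborel. z \<in> ?U \<longrightarrow> ?v z = ereal (u z)"
    by eventually_elim (auto intro: antisym)
  then show "AE z in lebesgue. z \<in> ?U \<longrightarrow> ?v z = ereal (u z)" by (rule AE_completion)
qed

end
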